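(* Let $\mathbf{X}=(X_t)_{t\ge0}$ be a spectrally positive Lévy process of unbounded variation with Lévy–Khintchine exponent $\psi$ and Laplace exponent $\varphi$. Suppose that $\sigma=0$ and $\varphi''\in\mathrm{WLSC}(\alpha-2,c,x_0)$ for some $c\in(0,1]$, $x_0\ge0$ and $\alpha>0$, where $x_0\le\theta_1$ in case both $\theta_1>0$ and $x_0>0$. Assume also that the Lévy measure $\nu(dx)$ has an almost monotone density $\nu(x)$. Then the probability distribution of $X_t$ has a density $p(t,\cdot)$. Moreover, there is $C>0$ such that for all $t\in(0,1/\Phi(x_0))$ and $x\in\mathbb{R}$, $$p\big(t,x+t\,b_{1/\psi^{-1}(1/t)}\big)\le C\min\big\{\Phi^{-1}(1/t),\ t\,\eta(|x|)\big\}.$$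
   Context: A spectrally positive Lévy process is a Lévy process on $\mathbb{R}$ with only positive jumps. There are $\sigma\ge 0$, $b\in\mathbb{R}$ and a $\sigma$-finite measure $\nu$ on $(0,\infty)$ with $\int_{(0,\infty)}(1\wedge x^2)\,\nu(dx)<\infty$ such that $\mathbb{E}e^{i\xi X_t}=e^{-t\psi(\xi)}$ and $\mathbb{E}e^{-\lambda X_t}=e^{t\varphi(\lambda)}$ ($\xi\in\mathbb{R}$, $\lambda\ge0$), where $$\psi(\xi)=\sigma^2\xi^2-i\xi b-\int_{(0,\infty)}\big(e^{i\xi x}-1-i\xi x\mathbf{1}_{x<1}\big)\nu(dx),\qquad \varphi(\lambda)=\sigma^2\lambda^2-b\lambda+\int_{(0,\infty)}\big(e^{-\lambda x}-1+\lambda x\mathbf{1}_{x<1}\big)\nu(dx).$$ Unbounded (infinite) variation means that $\sigma>0$ or $\int_{(0,1)}x\,\nu(dx)=\infty$. $\theta_1=\inf\{s>0:\varphi'(s)>0\}$. Scaling: a nonnegative function $f$ belongs to $\mathrm{WLSC}(\alpha,c,x_1)$ if $f(\lambda x)\ge c\lambda^{\alpha}f(x)$ for all $\lambda\ge1$ and $x>x_1$. Almost monotone density: there is $C_0\ge1$ with $\nu(y)\le C_0\nu(x)$ for all $y\ge x>0$. $\psi^*(r)=\sup_{|z|\le r}\mathrm{Re}\,\psi(z)$ for $r>0$, and $\psi^{-1}(s)=\sup\{r>0:\psi^*(r)=s\}$. $\Phi(x)=x^2\varphi''(x)$ for $x>0$, $\Phi^*(r)=\sup_{0<s\le r}\Phi(s)$,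 $\Phi^{-1}(s)=\sup\{r>0:\Phi^*(r)=s\}$. Conventions: $\Phi(0)=\Phi(0^+)=0$, and $1/0=\infty$. For $r>0$, $b_r=b+\int_{(0,\infty)}s\,(\mathbf{1}_{s<r}-\mathbf{1}_{s<1})\,\nu(ds)$. The function $\eta:[0,\infty)\to[0,\infty]$ is defined by $\eta(0)=\infty$, $\eta(s)=s^{-1}\Phi^*(1/s)$ for $0<s<x_0^{-1}$, and $\eta(s)=A s^{-1}|\varphi(1/s)|$ for $s\ge x_0^{-1}$, where $A=\Phi^*(x_0)/|\varphi(x_0)|$ (if $x_0=0$ the last range is empty and $A$ is not needed). $p(t,\cdot)$ denotes the continuous version of the density of $X_t$. *)

theory Defs
  imports "HOL-Probability.Probability"
begin

section \<open>Spectrally positive Levy processes\<close>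

text \<open>The time parameter is a nonnegative real; the values \<open>X t\<close> for \<open>t < 0\<close> are irrelevant.\<close>

definition cadlag :: "(real \<Rightarrow> real) \<Rightarrow> bool" where
  "cadlag f \<longleftrightarrow>
     (\<forall>t\<ge>0. (f \<longlongrightarrow> f t) (at_right t)) \<and>
     (\<forall>t>0. \<exists>l. (f \<longlongrightarrow> l) (at_left t))"

definition levy_process :: "'a measure \<Rightarrow> (real \<Rightarrow> 'a \<Rightarrow> real) \<Rightarrow> bool" where
  "levy_process M X \<longleftrightarrow>
     prob_space M \<and>
     (\<forall>t\<ge>0. X t \<in> borel_measurable M) \<and>
     (AE \<omega> in M. X 0 \<omega> = 0) \<and>
     (\<forall>(n::nat) (\<tau>::nat \<Rightarrow> real). 0 \<le> \<tau> 0 \<longrightarrow> mono \<tau> \<longrightarrow>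
        prob_space.indep_vars M (\<lambda>_. borel) (\<lambda>i \<omega>. X (\<tau> (Suc i)) \<omega> - X (\<tau> i) \<omega>) {..<n}) \<and>
     (\<forall>s t. 0 \<le> s \<longrightarrow> s \<le> t \<longrightarrow>
        distr M borel (\<lambda>\<omega>. X t \<omega> - X s \<omega>) = distr M borel (X (t - s))) \<and>
     (AE \<omega> in M. cadlag (\<lambda>t. X t \<omega>))"

definition spectrally_positive_levy_process ::
    "'a measure \<Rightarrow> (real \<Rightarrow> 'a \<Rightarrow> real) \<Rightarrow> bool" where
  "spectrally_positive_levy_process M X \<longleftrightarrow>
     levy_process M X \<and>
     (AE \<omega> in M. \<forall>t>0. Lim (at_left t) (\<lambda>s. X s \<omega>) \<le> X t \<omega>)"

section \<open>Levy--Khintchine and Laplace exponents\<close>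

text \<open>A measure on \<open>(0, \<infinity>)\<close> is represented as a Borel measure on the real line
  that does not charge \<open>(-\<infinity>, 0]\<close>.\<close>

definition positive_levy_measure :: "real measure \<Rightarrow> bool" where
  "positive_levy_measure \<nu> \<longleftrightarrow>
     sets \<nu> = sets borel \<and> sigma_finite_measure \<nu> \<and> emeasure \<nu> {..0} = 0 \<and>
     (\<integral>\<^sup>+x\<in>{0<..}. ennreal (min 1 (x\<^sup>2)) \<partial>\<nu>) < \<infinity>"

definition levy_psi :: "real \<Rightarrow> real \<Rightarrow> real measure \<Rightarrow> real \<Rightarrow> complex" where
  "levy_psi \<sigma> b \<nu> \<xi> =
     of_real (\<sigma>\<^sup>2 * \<xi>\<^sup>2) - \<i> * of_real (\<xi> * b)
     - (LINT x:{0<..}|\<nu>. exp (\<i> * of_real (\<xi> * x)) - 1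
          - \<i> * of_real (\<xi> * x * indicator {..<1} x))"

text \<open>Only arguments \<open>l \<ge> 0\<close> are meaningful: for \<open>l < 0\<close> the integral may diverge.\<close>

definition levy_phi :: "real \<Rightarrow> real \<Rightarrow> real measure \<Rightarrow> real \<Rightarrow> real" where
  "levy_phi \<sigma> b \<nu> l =
     \<sigma>\<^sup>2 * l\<^sup>2 - b * l
     + (LINT x:{0<..}|\<nu>. exp (- (l * x)) - 1 + l * x * indicator {..<1} x)"

definition has_levy_triplet ::
    "'a measure \<Rightarrow> (real \<Rightarrow> 'a \<Rightarrow> real) \<Rightarrow> real \<Rightarrow> real \<Rightarrow> real measure \<Rightarrow> bool" where
  "has_levy_triplet M X \<sigma> b \<nu> \<longleftrightarrow>
     0 \<le> \<sigma> \<and> positive_levy_measure \<nu> \<and>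
     (\<forall>t\<ge>0. \<forall>\<xi>. char (distr M borel (X t)) \<xi> = exp (- (of_real t * levy_psi \<sigma> b \<nu> \<xi>))) \<and>
     (\<forall>t\<ge>0. \<forall>l\<ge>0. (LINT \<omega>|M. exp (- (l * X t \<omega>))) = exp (t * levy_phi \<sigma> b \<nu> l))"

definition unbounded_variation :: "real \<Rightarrow> real measure \<Rightarrow> bool" where
  "unbounded_variation \<sigma> \<nu> \<longleftrightarrow>
     \<sigma> > 0 \<or> (\<integral>\<^sup>+x\<in>{0<..<1}. ennreal x \<partial>\<nu>) = \<infinity>"

definition levy_drift :: "real \<Rightarrow> real measure \<Rightarrow> real \<Rightarrow> real" where
  "levy_drift b \<nu> r =
     b + (LINT s:{0<..}|\<nu>. s * (indicator {..<r} s - indicator {..<1} s))"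

definition has_almost_monotone_density :: "real measure \<Rightarrow> bool" where
  "has_almost_monotone_density \<nu> \<longleftrightarrow>
     (\<exists>(n::real \<Rightarrow> real) C0. n \<in> borel_measurable borel \<and> (\<forall>x. 0 \<le> n x) \<and>
        \<nu> = density lborel (\<lambda>x. ennreal (n x) * indicator {0<..} x) \<and>
        C0 \<ge> 1 \<and> (\<forall>x y. 0 < x \<longrightarrow> x \<le> y \<longrightarrow> n y \<le> C0 * n x))"

section \<open>Scaling and auxiliary functions\<close>

definition WLSC :: "real \<Rightarrow> real \<Rightarrow> real \<Rightarrow> (real \<Rightarrow> real) set" where
  "WLSC \<alpha> c x1 = {f. (\<forall>x>0. 0 \<le> f x) \<and>
     (\<forall>l\<ge>1. \<forall>x>x1. f (l * x) \<ge> c * l powr \<alpha> * f x)}"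

definition theta1 :: "(real \<Rightarrow> real) \<Rightarrow> real" where
  "theta1 \<phi> = Inf {s. 0 < s \<and> 0 < deriv \<phi> s}"

definition psi_star :: "(real \<Rightarrow> complex) \<Rightarrow> real \<Rightarrow> real" where
  "psi_star \<psi> r = (SUP z\<in>{z. \<bar>z\<bar> \<le> r}. Re (\<psi> z))"

definition psi_inv :: "(real \<Rightarrow> complex) \<Rightarrow> real \<Rightarrow> real" where
  "psi_inv \<psi> s = Sup {r. 0 < r \<and> psi_star \<psi> r = s}"

text \<open>At \<open>x = 0\<close> the factor \<open>x\<^sup>2\<close> forces the value \<open>0\<close>, which is the limit of \<open>Phi \<phi>\<close>
  at \<open>0\<close> from the right, whatever the value of the (total) function \<open>deriv\<close> there.\<close>

definition Phi :: "(real \<Rightarrow> real) \<Rightarrow> real \<Rightarrow> real" where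
  "Phi \<phi> x = x\<^sup>2 * deriv (deriv \<phi>) x"

definition Phi_star :: "(real \<Rightarrow> real) \<Rightarrow> real \<Rightarrow> real" where
  "Phi_star \<phi> r = (SUP s\<in>{0<..r}. Phi \<phi> s)"

definition Phi_inv :: "(real \<Rightarrow> real) \<Rightarrow> real \<Rightarrow> real" where
  "Phi_inv \<phi> s = Sup {r. 0 < r \<and> Phi_star \<phi> r = s}"

text \<open>In \<open>ennreal\<close>, \<open>1 / 0 = \<infinity>\<close>; so for \<open>x0 = 0\<close> the second case below
  covers all \<open>s > 0\<close> and the third one is void.\<close>

definition eta :: "(real \<Rightarrow> real) \<Rightarrow> real \<Rightarrow> real \<Rightarrow> ennreal" where
  "eta \<phi> x0 s =
     (if s = 0 then \<infinity>
      else if ennreal s < 1 / ennreal x0 then ennreal (Phi_star \<phi> (1 / s) / s)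
      else ennreal (Phi_star \<phi> x0 / \<bar>\<phi> x0\<bar> * (\<bar>\<phi> (1 / s)\<bar> / s)))"

end

theory Submission
  imports Defs
begin

text \<open>
  The density of \<open>X t\<close> is the Fourier integral of \<open>exp (- t \<psi>)\<close>, and both bounds are read off from
  this integral. Put \<open>\<rho> = \<psi>\<inverse>(1/t)\<close> and \<open>r = 1/\<rho>\<close>; this is the spatial scale of the process at time
  \<open>t\<close>, because \<open>t \<Phi>(\<rho>)\<close> stays between two positive constants (\<open>inverse_scale\<close>).

  The almost monotone density makes the truncated second moment \<open>U(r) = \<integral>\<^bsub>y<r\<^esub> y\<^sup>2 \<nu>(dy)\<close> comparable to
  \<open>\<phi>''(1/r)\<close>, so that \<open>Re \<psi>(\<xi>)\<close> dominates a multiple of \<open>\<Phi>(|\<xi>|)\<close>. By lower scaling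
  \<open>t Re \<psi>(\<xi>) \<ge> \<kappa> |\<xi>/\<rho>|\<^sup>\<alpha> - \<kappa>\<close>, and integrating \<open>exp (- t Re \<psi>)\<close> gives a bound of order \<open>\<rho>\<close>, which is at most
  a multiple of \<open>\<Phi>\<inverse>(1/t)\<close>.

  For the spatial decay the jumps are split at \<open>r\<close>, which is exactly what the centring \<open>t b\<^bsub>r\<^esub>\<close> does. The
  exponent of the small jumps is smooth with derivatives controlled by powers of \<open>r\<close>, and three
  integrations by parts show that their density is \<open>O(r\<^sup>2/|x|\<^sup>3)\<close>. The large jumps form a compound
  Poisson variable whose expected number of jumps \<open>t \<nu>[r,\<infinity>)\<close> is bounded. The profile \<open>U(x)/x\<^sup>3\<close> dominates the Levy density, is almost decreasing
  and is doubling. Hence one more convolution with the large jumps multiplies a bound of the form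
  constant times \<open>t U(|x|)/|x|\<^sup>3\<close> by at most a constant (the sum of two terms exceeds \<open>x\<close> only if one of
  them exceeds \<open>x/2\<close>), and the factor \<open>1/k!\<close> of the \<open>k\<close>-th Poisson term absorbs the resulting geometric
  growth (\<open>compound_poisson_fourier_bound\<close>). Since \<open>t U(r)\<close> is comparable to \<open>r\<^sup>2\<close> and \<open>U\<close> is increasing,
  the small jump bound is below a multiple of \<open>t\<close> times the same profile, and \<open>kernel_estimate\<close> results.

  It remains to compare the profile with \<open>\<eta>\<close>. It is at most a multiple of \<open>\<Phi>(1/x)/x\<close>, and below \<open>x0\<close> convexity of
  \<open>\<phi>\<close> and the position of \<open>x0\<close> relative to \<open>\<theta>\<^sub>1\<close> give \<open>\<Phi> \<le> 2 |\<phi>|\<close> (\<open>\<Phi>_le_levy_phi\<close>).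

  Scaling is known only above \<open>x0\<close>, whereas \<open>\<rho>\<close> may lie somewhat below \<open>x0\<close>. By positivity and
  monotonicity of \<open>\<phi>''\<close> it extends, with a smaller constant, to \<open>[\<delta>,\<infinity>)\<close> for each \<open>\<delta> > 0\<close>, and all scales that
  belong to \<open>t < 1/\<Phi>(x0)\<close> lie above a fixed \<open>\<delta>\<close> that depends on the process alone.
\<close>

section \<open>Differentiation under the integral and Fourier integrals\<close>

text \<open>
  The first point at which a continuous function reaches the level \<open>s\<close> is also a point at which its
  running supremum equals \<open>s\<close>; this is how the generalised inverses are seen to be suprema of nonempty sets.
\<close>

lemma first_hitting:
  fixes h :: "real \<Rightarrow> real"
  assumes cont: "continuous_on {0..} h" and h0: "h 0 = 0" and s: "0 < s" and z: "0 \<le> z" "s \<le> h z"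
  obtains r where "0 < r" "h r = s" "\<And>x. 0 \<le> x \<Longrightarrow> x \<le> r \<Longrightarrow> h x \<le> s"
proof -
  define S where "S = {0..z} \<inter> h -` {s}"
  have hit: "\<exists>x\<in>{0..w}. h x = s" if "0 \<le> w" "s \<le> h w" for w
    using IVT'[of h 0 s w] that h0 s continuous_on_subset[OF cont, of "{0..w}"] by (auto simp: Bex_def)
  have "continuous_on {0..z} h" using cont by (rule continuous_on_subset) auto
  then have "closed S" unfolding S_def by (intro continuous_closed_preimage) auto
  then have "compact S"
    unfolding compact_eq_bounded_closed by (auto simp: S_def intro: bounded_subset[of "{0..z}"])
  moreover have "S \<noteq> {}" using hit[OF z] z by (auto simp: S_def)
  ultimately obtain r where r: "r \<in> S" "\<And>x. x \<in> S \<Longrightarrow> r \<le> x"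
    using compact_attains_inf by metis
  have le: "h x \<le> s" if "0 \<le> x" "x \<le> r" for x
  proof (rule ccontr)
    assume "\<not> h x \<le> s"
    then obtain w where w: "w \<in> {0..x}" "h w = s" using hit[of x] \<open>0 \<le> x\<close> by auto
    then have "w \<in> S" using r(1) that by (auto simp: S_def)
    then have "r \<le> w" by (rule r)
    then have "x = w" using w that by auto
    then show False using w \<open>\<not> h x \<le> s\<close> by simp
  qed
  have "r \<noteq> 0" using r(1) h0 s by (auto simp: S_def)
  then show thesis using r(1) le by (intro that[of r]) (auto simp: S_def)
qed

text \<open>
  A remainder that is quadratic in \<open>h\<close> with an integrable weight can be integrated directly, so no
  dominated convergence is needed. The Laplace exponent and the exponent of the small jumps are
  differentiated in this way.
\<close>

lemma has_vector_derivative_integral: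
  fixes k :: "real \<Rightarrow> 'a \<Rightarrow> 'b::{banach,second_countable_topology}"
  assumes d: "0 < d"
    and k: "\<And>z. \<bar>z - x\<bar> < d \<Longrightarrow> integrable M (k z)"
    and k': "integrable M k'" and w: "integrable M w"
    and rem: "\<And>h. \<bar>h\<bar> < d \<Longrightarrow> AE y in M. norm (k (x + h) y - k x y - h *\<^sub>R k' y) \<le> h\<^sup>2 * w y"
  shows "((\<lambda>z. \<integral>y. k z y \<partial>M) has_vector_derivative (\<integral>y. k' y \<partial>M)) (at x)"
proof -
  let ?K = "\<lambda>z. \<integral>y. k z y \<partial>M" and ?K' = "\<integral>y. k' y \<partial>M" and ?W = "\<integral>y. w y \<partial>M"
  have bound: "norm ((?K (x + h) - ?K x - h *\<^sub>R ?K') /\<^sub>R \<bar>h\<bar>) \<le> \<bar>h\<bar> * ?W" if h: "\<bar>h\<bar> < d" for h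
  proof (cases "h = 0")
    case False
    have ix: "integrable M (k (x + h))" "integrable M (k x)"
      using k[of "x + h"] k[of x] h d by auto
    have "?K (x + h) - ?K x - h *\<^sub>R ?K' = (\<integral>y. k (x + h) y - k x y - h *\<^sub>R k' y \<partial>M)"
      using ix k' by simp
    also have "norm \<dots> \<le> (\<integral>y. norm (k (x + h) y - k x y - h *\<^sub>R k' y) \<partial>M)"
      by (rule integral_norm_bound)
    also have "\<dots> \<le> (\<integral>y. h\<^sup>2 * w y \<partial>M)"
      using ix k' w rem[OF h] by (intro integral_mono_AE) auto
    finally have "norm (?K (x + h) - ?K x - h *\<^sub>R ?K') \<le> h\<^sup>2 * ?W" by simp
    then have "norm (?K (x + h) - ?K x - h *\<^sub>R ?K') / \<bar>h\<bar> \<le> h\<^sup>2 * ?W / \<bar>h\<bar>"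
      by (rule divide_right_mono) simp
    also have "h\<^sup>2 * ?W / \<bar>h\<bar> = \<bar>h\<bar> * ?W"
      using False by (simp add: field_simps power2_eq_square)
    finally show ?thesis by (simp add: divide_inverse mult.commute)
  qed simp
  have "((\<lambda>h. (?K (x + h) - ?K x - h *\<^sub>R ?K') /\<^sub>R norm h) \<longlongrightarrow> 0) (at 0)"
  proof (rule Lim_null_comparison)
    show "\<forall>\<^sub>F h in at 0. norm ((?K (x + h) - ?K x - h *\<^sub>R ?K') /\<^sub>R norm h) \<le> \<bar>h\<bar> * ?W"
      unfolding eventually_at using d bound by (intro exI[of _ d]) (auto simp: dist_real_def)
    show "((\<lambda>h. \<bar>h\<bar> * ?W) \<longlongrightarrow> 0) (at (0::real))"
      by (rule tendsto_eq_intros | simp)+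
  qed
  from tendsto_norm_zero[OF this] show ?thesis
    unfolding has_vector_derivative_def has_derivative_at
    by (simp add: bounded_linear_scaleR_left divide_inverse_commute)
qed

lemma has_bochner_integral_cauchy_kernel:
  assumes r: "0 < r"
  shows "has_bochner_integral lborel (\<lambda>x::real. 1 / (1 + (x * r)\<^sup>2)) (pi / r)"
proof -
  have 1: "integrable lborel (\<lambda>x::real. 1 / (1 + x\<^sup>2))" and 2: "(\<integral>x. 1 / (1 + x\<^sup>2) \<partial>lborel) = pi"
    using integrable_inverse_1_plus_square LBINT_inverse_1_plus_square
    by (simp_all add: set_integrable_def interval_lebesgue_integral_def set_lebesgue_integral_def inverse_eq_divide einterval_def)
  have "has_bochner_integral lborel (\<lambda>x::real. 1 / (1 + x\<^sup>2)) pi"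
    using 1 2 by (simp add: has_bochner_integral_iff)
  from lborel_has_bochner_integral_real_affine_iff[of r "\<lambda>x. 1 / (1 + x\<^sup>2)" pi 0] this r
  show ?thesis by (simp add: mult.commute divide_inverse)
qed

lemma exp_ge_power:
  fixes v :: real
  assumes "0 \<le> v"
  shows "v ^ N / fact N \<le> exp v"
proof -
  have "v ^ N / fact N \<le> (\<Sum>n\<in>{N}. v ^ n /\<^sub>R fact n)" by (simp add: field_simps)
  also have "\<dots> \<le> exp v"
    unfolding exp_def using assms
    by (intro sum_le_suminf) (auto intro: summable_exp)
  finally show ?thesis .
qed

text \<open>
  The exponential beats \<open>v ^ N\<close>; an \<open>N\<close> with \<open>\<alpha> N \<ge> 5\<close> pays for the cube and for the Cauchy kernel
  \<open>1 / (1 + u\<^sup>2)\<close>, whose integral is explicit.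
\<close>

lemma stretched_exponential_bound:
  assumes \<alpha>: "0 < \<alpha>" and \<kappa>: "0 < \<kappa>"
  shows "\<exists>B>0. \<forall>u::real. (1 + \<bar>u\<bar> ^ 3) * exp (- (\<kappa> * \<bar>u\<bar> powr \<alpha>)) \<le> B / (1 + u\<^sup>2)"
proof -
  obtain N :: nat where N: "5 / \<alpha> \<le> real N" using real_arch_simple by blast
  then have N5: "5 \<le> \<alpha> * real N" using \<alpha> by (simp add: field_simps)
  \<comment> \<open>the two summands serve \<open>\<bar>u\<bar> \<le> 1\<close> and \<open>\<bar>u\<bar> > 1\<close>\<close>
  define B where "B = 4 + 4 * fact N / \<kappa> ^ N"
  have Bp: "0 < B" using \<kappa> by (simp add: B_def add_pos_pos)
  have "(1 + \<bar>u\<bar> ^ 3) * exp (- (\<kappa> * \<bar>u\<bar> powr \<alpha>)) * (1 + u\<^sup>2) \<le> B" for u :: real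
  proof (cases "\<bar>u\<bar> \<le> 1")
    case True
    have "(1 + \<bar>u\<bar> ^ 3) * exp (- (\<kappa> * \<bar>u\<bar> powr \<alpha>)) * (1 + u\<^sup>2) \<le> (1 + 1) * 1 * (1 + 1)"
      using True \<kappa> by (intro mult_mono add_mono) (auto simp: power_le_one abs_square_le_1)
    also have "\<dots> \<le> B" using \<kappa> by (simp add: B_def)
    finally show ?thesis .
  next
    case False
    define v where "v = \<kappa> * \<bar>u\<bar> powr \<alpha>"
    have v: "v > 0" using False \<kappa> by (simp add: v_def)
    have "v ^ N / fact N \<le> exp v" using v by (intro exp_ge_power) simp
    moreover have "v ^ N = \<kappa> ^ N * \<bar>u\<bar> powr (\<alpha> * real N)"
      using False by (simp add: v_def power_mult_distrib powr_powr powr_realpow[symmetric])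
    moreover have "\<bar>u\<bar> ^ 5 \<le> \<bar>u\<bar> powr (\<alpha> * real N)"
      using False N5 powr_mono[of 5 "\<alpha> * real N" "\<bar>u\<bar>"] by (simp add: powr_numeral)
    ultimately have "\<kappa> ^ N * \<bar>u\<bar> ^ 5 / fact N \<le> exp v"
      using \<kappa> by (smt (verit) divide_right_mono fact_ge_zero mult_left_mono zero_less_power)
    then have e: "\<bar>u\<bar> ^ 5 * exp (- v) \<le> fact N / \<kappa> ^ N"
      using \<kappa> by (simp add: exp_minus field_simps)
    have "1 \<le> \<bar>u\<bar> ^ 3" "1 \<le> \<bar>u\<bar> ^ 2" using False one_le_power[of "\<bar>u\<bar>"] by (simp_all only: not_le less_imp_le)
    then have "(1 + \<bar>u\<bar> ^ 3) * (1 + u\<^sup>2) \<le> (2 * \<bar>u\<bar> ^ 3) * (2 * \<bar>u\<bar> ^ 2)"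
      by (intro mult_mono) auto
    also have "\<dots> = 4 * \<bar>u\<bar> ^ 5" by (simp add: power_add[symmetric] numeral_eq_Suc)
    finally have "(1 + \<bar>u\<bar> ^ 3) * (1 + u\<^sup>2) * exp (- v) \<le> 4 * (\<bar>u\<bar> ^ 5 * exp (- v))"
      by (simp add: mult.assoc[symmetric])
    also have "\<dots> \<le> 4 * (fact N / \<kappa> ^ N)" using e by simp
    also have "\<dots> \<le> B" by (simp add: B_def)
    finally show ?thesis by (simp add: v_def mult_ac)
  qed
  then show ?thesis using Bp
    by (intro exI[of _ B]) (auto simp: pos_le_divide_eq add_pos_nonneg)
qed

definition fourier_int :: "(real \<Rightarrow> complex) \<Rightarrow> real \<Rightarrow> complex" where
  "fourier_int f x = (CLBINT \<xi>. iexp (- (\<xi> * x)) * f \<xi>)"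

lemma tendsto_cauchy_kernel:
  assumes "0 < r"
  shows "((\<lambda>x::real. B / (1 + (x * r)\<^sup>2)) \<longlongrightarrow> 0) at_top"
    and "((\<lambda>x::real. B / (1 + (x * r)\<^sup>2)) \<longlongrightarrow> 0) at_bot"
proof -
  have "filterlim (\<lambda>x. x * r) at_top at_top"
    using assms filterlim_tendsto_pos_mult_at_top[OF tendsto_const, of r "\<lambda>x. x" at_top]
    by (simp add: filterlim_ident mult.commute)
  then have "filterlim (\<lambda>x. 1 + (x * r)\<^sup>2) at_top at_top"
    by (intro filterlim_tendsto_add_at_top[OF tendsto_const] filterlim_pow_at_top) auto
  then show 1: "((\<lambda>x::real. B / (1 + (x * r)\<^sup>2)) \<longlongrightarrow> 0) at_top"
    by (intro tendsto_divide_0[OF tendsto_const] filterlim_at_top_imp_at_infinity)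
  show "((\<lambda>x::real. B / (1 + (x * r)\<^sup>2)) \<longlongrightarrow> 0) at_bot"
    unfolding filterlim_at_bot_mirror using 1 by simp
qed

lemma cauchy_dominated_integrable:
  fixes f :: "real \<Rightarrow> 'b::{banach,second_countable_topology}"
  assumes "0 < r" "f \<in> borel_measurable borel" "\<And>\<xi>. norm (f \<xi>) \<le> B / (1 + (\<xi> * r)\<^sup>2)"
  shows "integrable lborel f" and "(\<integral>\<xi>. norm (f \<xi>) \<partial>lborel) \<le> B * pi / r"
proof -
  have h: "has_bochner_integral lborel (\<lambda>x::real. B * (1 / (1 + (x * r)\<^sup>2))) (B * (pi / r))"
    by (rule has_bochner_integral_mult_right[OF has_bochner_integral_cauchy_kernel[OF assms(1)]])
  then have i: "integrable lborel (\<lambda>x::real. B * (1 / (1 + (x * r)\<^sup>2)))"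
    and e: "(\<integral>x. B * (1 / (1 + (x * r)\<^sup>2)) \<partial>lborel) = B * (pi / r)"
    using has_bochner_integral_iff by blast+
  have "norm (f \<xi>) \<le> B * (1 / (1 + (\<xi> * r)\<^sup>2))" for \<xi> using assms(3)[of \<xi>] by simp
  then have le: "norm (f \<xi>) \<le> norm (B * (1 / (1 + (\<xi> * r)\<^sup>2)))" "norm (f \<xi>) \<le> B * (1 / (1 + (\<xi> * r)\<^sup>2))" for \<xi>
    by (smt (verit) real_norm_def)+
  show int: "integrable lborel f"
    by (rule Bochner_Integration.integrable_bound[OF i]) (use assms(2) le in auto)
  show "(\<integral>\<xi>. norm (f \<xi>) \<partial>lborel) \<le> B * pi / r"
    using integral_mono[OF integrable_norm[OF int] i le(2)] e by simp
qed

lemma norm_fourier_int_le: "norm (fourier_int f x) \<le> (\<integral>\<xi>. norm (f \<xi>) \<partial>lborel)"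
  unfolding fourier_int_def
  by (rule order_trans[OF integral_norm_bound]) (simp add: norm_mult)

text \<open>
  Integration by parts. The Cauchy kernel bounds provide integrability and make the boundary terms
  vanish.
\<close>

lemma fourier_int_derivative:
  fixes f f' :: "real \<Rightarrow> complex"
  assumes r: "0 < r"
    and der: "\<And>\<xi>. (f has_vector_derivative f' \<xi>) (at \<xi>)" and cont: "continuous_on UNIV f'"
    and f: "\<And>\<xi>. norm (f \<xi>) \<le> B / (1 + (\<xi> * r)\<^sup>2)"
    and f': "\<And>\<xi>. norm (f' \<xi>) \<le> B' / (1 + (\<xi> * r)\<^sup>2)"
  shows "fourier_int f' x = \<i> * x * fourier_int f x"
proof -
  let ?e = "\<lambda>\<xi>. iexp (- (\<xi> * x))"
  have contf: "continuous_on UNIV f"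
    using der by (auto intro!: continuous_at_imp_continuous_on has_vector_derivative_continuous)
  note int = cauchy_dominated_integrable(1)[OF r borel_measurable_continuous_onI[OF contf] f]
    cauchy_dominated_integrable(1)[OF r borel_measurable_continuous_onI[OF cont] f']
  have ie: "integrable lborel (\<lambda>\<xi>. ?e \<xi> * g \<xi>)" if "integrable lborel g" for g :: "real \<Rightarrow> complex"
    by (rule Bochner_Integration.integrable_bound[OF that]) (use that in \<open>auto simp: norm_mult\<close>)
  have dF: "((\<lambda>\<xi>. ?e \<xi> * f \<xi>) has_vector_derivative (?e \<xi> * f' \<xi> - \<i> * x * (?e \<xi> * f \<xi>))) (at \<xi>)" for \<xi>
  proof -
    have "(?e has_vector_derivative (- \<i> * x * ?e \<xi>)) (at \<xi>)"
      by (auto intro!: derivative_eq_intros simp: has_vector_derivative_complex_iff Re_exp Im_exp)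
    from has_vector_derivative_mult[OF this der] show ?thesis by (simp add: algebra_simps)
  qed
  have "(LBINT \<xi>=-\<infinity>..\<infinity>. ?e \<xi> * f' \<xi> - \<i> * x * (?e \<xi> * f \<xi>)) = 0 - 0"
  proof (rule interval_integral_FTC_integrable[where F="\<lambda>\<xi>. ?e \<xi> * f \<xi>"])
    show "((\<lambda>\<xi>. ?e \<xi> * f \<xi>) has_vector_derivative (?e \<xi> * f' \<xi> - \<i> * x * (?e \<xi> * f \<xi>))) (at \<xi>)" for \<xi>
      by (rule dF)
    show "isCont (\<lambda>\<xi>. ?e \<xi> * f' \<xi> - \<i> * x * (?e \<xi> * f \<xi>)) \<xi>" for \<xi>
      using cont contf by (auto intro!: continuous_intros simp: continuous_on_eq_continuous_at)
    show "set_integrable lborel (einterval (-\<infinity>) \<infinity>) (\<lambda>\<xi>. ?e \<xi> * f' \<xi> - \<i> * x * (?e \<xi> * f \<xi>))"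
      using ie[OF int(1)] ie[OF int(2)] by (simp add: set_integrable_def einterval_def)
    have n: "norm (?e \<xi> * f \<xi>) \<le> B / (1 + (\<xi> * r)\<^sup>2)" for \<xi> using f by (simp add: norm_mult)
    show "(((\<lambda>\<xi>. ?e \<xi> * f \<xi>) \<circ> real_of_ereal) \<longlongrightarrow> 0) (at_right (-\<infinity>))"
      unfolding ereal_tendsto_simps
      by (rule Lim_null_comparison[OF _ tendsto_cauchy_kernel(2)[OF r, of B]]) (rule always_eventually, rule allI, rule n)
    show "(((\<lambda>\<xi>. ?e \<xi> * f \<xi>) \<circ> real_of_ereal) \<longlongrightarrow> 0) (at_left \<infinity>)"
      unfolding ereal_tendsto_simps
      by (rule Lim_null_comparison[OF _ tendsto_cauchy_kernel(1)[OF r, of B]]) (rule always_eventually, rule allI, rule n)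
  qed auto
  then have "(\<integral>\<xi>. ?e \<xi> * f' \<xi> - \<i> * x * (?e \<xi> * f \<xi>) \<partial>lborel) = 0"
    by (simp add: interval_lebesgue_integral_def set_lebesgue_integral_def einterval_def)
  then show ?thesis
    using ie[OF int(1)] ie[OF int(2)] by (simp add: fourier_int_def)
qed

section \<open>Fourier inversion\<close>

lemma fourier_int_measurable [measurable]:
  assumes [measurable]: "f \<in> borel_measurable borel"
  shows "fourier_int f \<in> borel_measurable borel"
  unfolding fourier_int_def by measurable

lemma continuous_on_fourier_int:
  assumes f: "integrable lborel f"
  shows "continuous_on UNIV (fourier_int f)"
proof -
  have "isCont (fourier_int f) x" for x
    unfolding continuous_at_sequentially comp_def fourier_int_def
  proof safe
    fix X :: "nat \<Rightarrow> real" assume X: "X \<longlonglongrightarrow> x"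
    show "(\<lambda>n. CLBINT \<xi>. iexp (- (\<xi> * X n)) * f \<xi>) \<longlonglongrightarrow> (CLBINT \<xi>. iexp (- (\<xi> * x)) * f \<xi>)"
    proof (rule integral_dominated_convergence[where w="\<lambda>\<xi>. norm (f \<xi>)"])
      show "AE \<xi> in lborel. (\<lambda>n. iexp (- (\<xi> * X n)) * f \<xi>) \<longlonglongrightarrow> iexp (- (\<xi> * x)) * f \<xi>"
        using X by (intro AE_I2 tendsto_intros)
    qed (use f in \<open>auto simp: norm_mult\<close>)
  qed
  then show ?thesis by (auto intro: continuous_at_imp_continuous_on)
qed

text \<open>
  When the characteristic function is integrable, the truncated integrals in Levy's inversion formula
  converge absolutely, and its kernel is \<open>\<integral>\<^bsub>[a,b]\<^esub> exp (- i t x) dx\<close>, so Fubini moves the integral over \<open>[a,b]\<close> outside.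
\<close>

lemma (in real_distribution) interval_measure_fourier:
  assumes int: "integrable lborel (char M)" and ab: "a \<le> b" and at: "measure M {a} = 0" "measure M {b} = 0"
  shows "measure M {a<..b} = (\<integral>x. indicator {a..b} x *\<^sub>R (Re (fourier_int (char M) x) / (2 * pi)) \<partial>lborel)"
proof -
  let ?\<phi> = "char M"
  let ?K = "\<lambda>t. (iexp (- (t * a)) - iexp (- (t * b))) / (\<i> * t)"
  have Kb: "norm (?K t) \<le> b - a" for t
    using Levy_Inversion_aux2[of "-b" "-a" t] ab by (cases "t = 0") auto
  have lim: "(\<lambda>T. 1 / (2 * pi) * (CLBINT t=-real T..real T. ?K t * ?\<phi> t)) \<longlonglongrightarrow> 1 / (2 * pi) * (CLBINT t. ?K t * ?\<phi> t)"
  proof (intro tendsto_intros)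
    have "(\<lambda>T::nat. CLBINT t. indicator {-real T<..<real T} t *\<^sub>R (?K t * ?\<phi> t)) \<longlonglongrightarrow> (CLBINT t. ?K t * ?\<phi> t)"
    proof (rule integral_dominated_convergence[where w="\<lambda>t. (b - a) * norm (?\<phi> t)"])
      show "integrable lborel (\<lambda>t. (b - a) * norm (?\<phi> t))" using int by auto
      show "AE t in lborel. (\<lambda>T. indicator {-real T<..<real T} t *\<^sub>R (?K t * ?\<phi> t)) \<longlonglongrightarrow> ?K t * ?\<phi> t"
      proof (intro AE_I2)
        fix t :: real
        obtain N :: nat where "\<bar>t\<bar> < real N" using reals_Archimedean2 by blast
        then have "\<forall>\<^sub>F T in sequentially. indicator {-real T<..<real T} t *\<^sub>R (?K t * ?\<phi> t) = ?K t * ?\<phi> t"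
          by (intro eventually_sequentiallyI[of N]) (auto simp: indicator_def abs_less_iff)
        then show "(\<lambda>T. indicator {-real T<..<real T} t *\<^sub>R (?K t * ?\<phi> t)) \<longlonglongrightarrow> ?K t * ?\<phi> t"
          by (rule tendsto_eventually)
      qed
      show "AE t in lborel. norm (indicator {-real T<..<real T} t *\<^sub>R (?K t * ?\<phi> t)) \<le> (b - a) * norm (?\<phi> t)" for T
      proof (intro AE_I2)
        fix t :: real
        have "norm (?K t * ?\<phi> t) \<le> (b - a) * norm (?\<phi> t)"
          unfolding norm_mult[of "?K t"] by (intro mult_right_mono Kb) auto
        then show "norm (indicator {-real T<..<real T} t *\<^sub>R (?K t * ?\<phi> t)) \<le> (b - a) * norm (?\<phi> t)"
          using ab by (auto split: split_indicator)
      qed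
    qed auto
    then show "(\<lambda>T. CLBINT t=-real T..real T. ?K t * ?\<phi> t) \<longlonglongrightarrow> (CLBINT t. ?K t * ?\<phi> t)"
      by (simp add: interval_lebesgue_integral_def set_lebesgue_integral_def)
  qed
  have "complex_of_real (measure M {a<..b}) = 1 / (2 * pi) * (CLBINT t. ?K t * ?\<phi> t)"
    by (rule LIMSEQ_unique[OF _ lim]) (use Levy_Inversion[OF ab at] in simp)
  also have "(CLBINT t. ?K t * ?\<phi> t) = (CLBINT t. (CLBINT x. indicator {a..b} x *\<^sub>R (iexp (- (t * x)) * ?\<phi> t)))"
  proof (rule integral_cong_AE)
    show "AE t in lborel. ?K t * ?\<phi> t = (CLBINT x. indicator {a..b} x *\<^sub>R (iexp (- (t * x)) * ?\<phi> t))"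
    proof (rule AE_mp[OF AE_lborel_singleton[of 0]], intro AE_I2 impI)
      fix t :: real assume t: "t \<noteq> 0"
      let ?F = "\<lambda>x. - iexp (- (t * x)) / (\<i> * t) * ?\<phi> t"
      have "(CLBINT x. indicator {a..b} x *\<^sub>R (iexp (- (t * x)) * ?\<phi> t)) = ?F b - ?F a"
      proof (rule integral_FTC_Icc[OF ab])
        show "(?F has_vector_derivative (iexp (- (t * x)) * ?\<phi> t)) (at x within {a..b})" for x
        proof (rule has_vector_derivative_mult_left)
          have "((\<lambda>x. iexp (- (t * x))) has_vector_derivative (- \<i> * t * iexp (- (t * x)))) (at x within {a..b})"
            by (auto intro!: derivative_eq_intros simp: has_vector_derivative_complex_iff Re_exp Im_exp)
          from has_vector_derivative_mult_left[OF this, of "- 1 / (\<i> * t)"]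
          show "((\<lambda>x. - iexp (- (t * x)) / (\<i> * t)) has_vector_derivative iexp (- (t * x))) (at x within {a..b})"
            using t by (simp add: field_simps)
        qed
        show "continuous_on {a..b} (\<lambda>x. iexp (- (t * x)) * ?\<phi> t)" by (intro continuous_intros)
      qed
      also have "\<dots> = ?K t * ?\<phi> t" using t by (simp add: field_simps)
      finally show "?K t * ?\<phi> t = (CLBINT x. indicator {a..b} x *\<^sub>R (iexp (- (t * x)) * ?\<phi> t))" ..
    qed
  qed auto
  also have "\<dots> = (CLBINT x. (CLBINT t. indicator {a..b} x *\<^sub>R (iexp (- (t * x)) * ?\<phi> t)))"
  proof (rule lborel_pair.Fubini_integral)
    show "integrable (lborel \<Otimes>\<^sub>M lborel) (\<lambda>(x, t). indicator {a..b} x *\<^sub>R (iexp (- (t * x)) * ?\<phi> t))"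
    proof (rule lborel_pair.Fubini_integrable)
      have [measurable]: "?\<phi> \<in> borel_measurable borel" by (rule char_measurable)
      show "(\<lambda>(x, t). indicator {a..b} x *\<^sub>R (iexp (- (t * x)) * ?\<phi> t)) \<in> borel_measurable (lborel \<Otimes>\<^sub>M lborel)"
        by measurable
      have "(\<lambda>x. \<integral>t. norm (indicator {a..b} x *\<^sub>R (iexp (- (t * x)) * ?\<phi> t)) \<partial>lborel)
          = (\<lambda>x. indicator {a..b} x *\<^sub>R (\<integral>t. norm (?\<phi> t) \<partial>lborel))"
        by (auto simp: norm_mult fun_eq_iff split: split_indicator)
      then show "integrable lborel (\<lambda>x. \<integral>t. norm (case (x, t) of (x, t) \<Rightarrow> indicator {a..b} x *\<^sub>R (iexp (- (t * x)) * ?\<phi> t)) \<partial>lborel)"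
        by (simp add: integrable_indicator_iff emeasure_lborel_Icc_eq)
      have "integrable lborel (\<lambda>t. iexp (- (t * x)) * ?\<phi> t)" for x
        by (rule Bochner_Integration.integrable_bound[OF int]) (auto simp: norm_mult)
      then show "AE x in lborel. integrable lborel (\<lambda>t. case (x, t) of (x, t) \<Rightarrow> indicator {a..b} x *\<^sub>R (iexp (- (t * x)) * ?\<phi> t))"
        by (intro AE_I2) auto
    qed
  qed
  also have "\<dots> = (CLBINT x. indicator {a..b} x *\<^sub>R fourier_int ?\<phi> x)"
    by (simp add: fourier_int_def)
  finally have "complex_of_real (measure M {a<..b}) = 1 / (2 * pi) * (CLBINT x. indicator {a..b} x *\<^sub>R fourier_int ?\<phi> x)" .
  then have "measure M {a<..b} = Re (1 / (2 * pi) * (CLBINT x. indicator {a..b} x *\<^sub>R fourier_int ?\<phi> x))"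
    by (metis Re_complex_of_real)
  also have "\<dots> = 1 / (2 * pi) * Re (CLBINT x. indicator {a..b} x *\<^sub>R fourier_int ?\<phi> x)"
    by (simp add: Re_divide power2_eq_square)
  also have "Re (CLBINT x. indicator {a..b} x *\<^sub>R fourier_int ?\<phi> x) = (\<integral>x. Re (indicator {a..b} x *\<^sub>R fourier_int ?\<phi> x) \<partial>lborel)"
  proof (rule integral_Re[symmetric])
    show "integrable lborel (\<lambda>x. indicator {a..b} x *\<^sub>R fourier_int ?\<phi> x)"
      using borel_integrable_atLeastAtMost'[OF continuous_on_subset[OF continuous_on_fourier_int[OF int]], of a b]
      by (simp add: set_integrable_def)
  qed
  finally show ?thesis
    by (simp add: mult.commute)
qed

text \<open>
  The inversion formula is available only between points that carry no atom. Those are dense, and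
  the measure of a short interval is at most a constant times its length, so there are no atoms at
  all. The density is nonnegative because it is continuous and integrates to the measure of every interval.
\<close>

lemma (in real_distribution) fourier_inversion_density:
  assumes int: "integrable lborel (char M)"
  defines "p \<equiv> \<lambda>x. Re (fourier_int (char M) x) / (2 * pi)"
  shows "continuous_on UNIV p" and "\<And>x. 0 \<le> p x" and "M = density lborel (\<lambda>x. ennreal (p x))"
proof -
  show cont: "continuous_on UNIV p"
    unfolding p_def by (intro continuous_intros continuous_on_fourier_int int) auto
  then have [measurable]: "p \<in> borel_measurable borel" by (rule borel_measurable_continuous_onI)
  define B where "B = (\<integral>\<xi>. norm (char M \<xi>) \<partial>lborel) / (2 * pi)"
  have pB: "p x \<le> B" for x
    using norm_fourier_int_le[of "char M" x] complex_Re_le_cmod[of "fourier_int (char M) x"]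
    by (auto simp: p_def B_def intro!: divide_right_mono)
  have B0: "0 \<le> B" by (simp add: B_def integral_nonneg_AE)
  have ipI: "integrable lborel (\<lambda>x. indicator {a..b} x *\<^sub>R p x)" for a b
    using borel_integrable_atLeastAtMost'[OF continuous_on_subset[OF cont], of a b] by (simp add: set_integrable_def)
  have cI: "integrable lborel (\<lambda>x. indicator {a..b} x *\<^sub>R v)" for a b v :: real
    by (intro integrable_scaleR_left) (simp add: integrable_indicator_iff emeasure_lborel_Icc_eq)
  have im: "measure M {a<..b} = (\<integral>x. indicator {a..b} x *\<^sub>R p x \<partial>lborel)"
    if "a \<le> b" "measure M {a} = 0" "measure M {b} = 0" for a b
    using interval_measure_fourier[OF int that] by (simp add: p_def)
  have cnt: "countable {x. measure M {x} \<noteq> 0}" using countable_support by simp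
  have atoms: "measure M {x} = 0" for x
  proof -
    have "measure M {x} \<le> 0 + e" if e: "0 < e" for e
    proof -
      define d where "d = e / (2 * B + 1)"
      have d: "0 < d" "B * (2 * d) \<le> e"
        using e B0 by (auto simp: d_def field_simps intro: add_nonneg_pos mult_nonneg_nonneg)
      obtain a where a: "a \<in> {x - d<..<x}" "a \<notin> {x. measure M {x} \<noteq> 0}"
        using real_interval_avoid_countable_set[of "x - d" x, OF _ cnt] d by auto
      obtain b where b: "b \<in> {x<..<x + d}" "b \<notin> {x. measure M {x} \<noteq> 0}"
        using real_interval_avoid_countable_set[of x "x + d", OF _ cnt] d by auto
      have "measure M {x} \<le> measure M {a<..b}" using a b by (intro finite_measure_mono) auto
      also have "\<dots> = (\<integral>x. indicator {a..b} x *\<^sub>R p x \<partial>lborel)" using a b by (intro im) auto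
      also have "\<dots> \<le> (\<integral>x. indicator {a..b} x *\<^sub>R B \<partial>lborel)"
        using pB by (intro integral_mono ipI cI) (auto split: split_indicator)
      also have "\<dots> = B * (b - a)" using a b by simp
      also have "\<dots> \<le> B * (2 * d)" using a b B0 by (intro mult_left_mono) auto
      finally show ?thesis using d by simp
    qed
    then have "measure M {x} \<le> 0" by (rule field_le_epsilon)
    then show ?thesis using measure_nonneg[of M "{x}"] by linarith
  qed
  have im': "measure M {a<..b} = (\<integral>x. indicator {a..b} x *\<^sub>R p x \<partial>lborel)" if "a \<le> b" for a b
    using im[OF that atoms atoms] .
  show nn: "0 \<le> p x" for x
  proof (rule ccontr)
    assume "\<not> 0 \<le> p x"
    then have neg: "p x < 0" by simp
    have "isCont p x" using cont by (simp add: continuous_on_eq_continuous_at)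
    then obtain d where d: "0 < d" "\<And>y. \<bar>y - x\<bar> < d \<Longrightarrow> \<bar>p y - p x\<bar> < - p x / 2"
      using neg unfolding continuous_at_eps_delta dist_real_def by (metis half_gt_zero neg_0_less_iff_less)
    have "0 \<le> measure M {x<..x + d / 2}" by simp
    also have "\<dots> = (\<integral>y. indicator {x..x + d / 2} y *\<^sub>R p y \<partial>lborel)" using d by (intro im') auto
    also have "\<dots> \<le> (\<integral>y. indicator {x..x + d / 2} y *\<^sub>R (p x / 2) \<partial>lborel)"
    proof (intro integral_mono ipI cI)
      fix y
      show "indicator {x..x + d / 2} y *\<^sub>R p y \<le> indicator {x..x + d / 2} y *\<^sub>R (p x / 2)"
        using d(1) d(2)[of y] by (auto split: split_indicator)
    qed
    also have "\<dots> = d / 2 * (p x / 2)" using d by simp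
    also have "\<dots> < 0" using d neg by (simp add: mult_pos_neg)
    finally show False by simp
  qed
  let ?E = "range (\<lambda>(a::real, b). {a<..b})"
  have SE: "sets (borel :: real measure) = sigma_sets UNIV ?E"
    by (subst borel_sigma_sets_Ioc) (rule sets_measure_of, auto)
  show "M = density lborel (\<lambda>x. ennreal (p x))"
  proof (rule measure_eqI_generator_eq[where E = ?E and \<Omega> = UNIV and A = "\<lambda>i::nat. {- real i<..real i}"])
    show "Int_stable ?E"
      by (auto simp: Int_stable_def)
    show "emeasure M X = emeasure (density lborel (\<lambda>x. ennreal (p x))) X" if X: "X \<in> ?E" for X
    proof -
      from X obtain a b where X': "X = {a<..b}" by auto
      show ?thesis
      proof (cases "a \<le> b")
        case True
        have "emeasure (density lborel (\<lambda>x. ennreal (p x))) X = (\<integral>\<^sup>+x. ennreal (p x) * indicator {a<..b} x \<partial>lborel)"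
          using X' by (simp add: emeasure_density)
        also have "\<dots> = (\<integral>\<^sup>+x. ennreal (indicator {a..b} x *\<^sub>R p x) \<partial>lborel)"
          by (rule nn_integral_cong_AE, rule AE_mp[OF AE_lborel_singleton[of a]])
             (auto split: split_indicator)
        also have "\<dots> = ennreal (measure M {a<..b})"
          unfolding im'[OF True] by (rule nn_integral_eq_integral[OF ipI]) (auto simp: nn)
        finally show ?thesis using X' by (simp add: emeasure_eq_measure)
      next
        case False
        then show ?thesis using X' by simp
      qed
    qed
    show "sets M = sigma_sets UNIV ?E"
      using SE by (simp add: events_eq_borel)
    show "sets (density lborel (\<lambda>x. ennreal (p x))) = sigma_sets UNIV ?E"
      using SE by simp
    show "(\<Union>i. {- real i<..real i}) = UNIV"
    proof (intro equalityI subsetI)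
      fix x :: real
      obtain N :: nat where "\<bar>x\<bar> < real N" using reals_Archimedean2 by blast
      then show "x \<in> (\<Union>i. {- real i<..real i})" by (auto intro!: exI[of _ N])
    qed simp
  qed auto
qed

section \<open>Compound Poisson perturbations\<close>

text \<open>
  If \<open>f\<close> is the Fourier transform of \<open>q\<close>, then \<open>f\<close> times the exponential is that of the series
  \<open>\<Sum>j. q * k\<^sup>*\<^sup>j / j!\<close>, where \<open>*\<close> is convolution. The terms are estimated by induction on \<open>j\<close>: in
  \<open>\<integral> Q\<^sub>j(x - y) k(y) dy\<close> the part \<open>y \<ge> x/2\<close> is bounded by the pointwise bound on \<open>k\<close> times the \<open>L\<^sup>1\<close> norm of
  \<open>Q\<^sub>j\<close>, and on the rest \<open>|x - y| \<ge> |x|/2\<close>, so the pointwise bound on \<open>Q\<^sub>j\<close> applies. As \<open>k\<close> lives on the positive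
  half line, the latter also covers negative \<open>x\<close>.
\<close>

lemma compound_poisson_fourier_bound:
  fixes f :: "real \<Rightarrow> complex" and k H :: "real \<Rightarrow> real"
  assumes f: "integrable lborel f"
    and k: "integrable lborel k" "\<And>y. 0 \<le> k y" "\<And>y. y \<le> 0 \<Longrightarrow> k y = 0" "(\<integral>y. k y \<partial>lborel) \<le> m"
    and H: "\<And>x. 0 < x \<Longrightarrow> 0 \<le> H x" "\<And>x y. 0 < x \<Longrightarrow> x / 2 \<le> y \<Longrightarrow> H y \<le> C * H x"
    and kH: "\<And>x y. 0 < x \<Longrightarrow> x / 2 \<le> y \<Longrightarrow> k y \<le> E * H x"
    and nonneg: "0 \<le> C" "0 \<le> D" "0 \<le> E" "0 \<le> I"
    and f_H: "\<And>x. x \<noteq> 0 \<Longrightarrow> norm (fourier_int f x) \<le> D * H \<bar>x\<bar>"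
    and f_1: "(\<integral>\<^sup>+x. norm (fourier_int f x) \<partial>lborel) \<le> ennreal I"
    and x: "x \<noteq> 0"
  shows "norm (fourier_int (\<lambda>\<xi>. f \<xi> * exp (CLBINT y. iexp (\<xi> * y) * k y)) x)
           \<le> (D + E * I) * exp (1 + m + m * C) * H \<bar>x\<bar>"
proof -
  define N where "N \<xi> = (CLBINT y. iexp (\<xi> * y) * k y)" for \<xi> :: real
  define Q where "Q n = fourier_int (\<lambda>\<xi>. f \<xi> * N \<xi> ^ n)" for n :: nat
  have [measurable]: "f \<in> borel_measurable borel" "k \<in> borel_measurable borel"
    using f k(1) by auto
  have [measurable]: "N \<in> borel_measurable borel" unfolding N_def by measurable
  have [measurable]: "Q n \<in> borel_measurable borel" for n unfolding Q_def by measurable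
  have m: "0 \<le> m" using order_trans[OF Bochner_Integration.integral_nonneg k(4)] k(2) by auto
  have nnk: "(\<integral>\<^sup>+y. ennreal (k y) \<partial>lborel) \<le> ennreal m"
    using k by (subst nn_integral_eq_integral) (auto intro: ennreal_leI)
  have N_le: "norm (N \<xi>) \<le> m" for \<xi>
  proof -
    have "norm (N \<xi>) \<le> (\<integral>y. norm (iexp (\<xi> * y) * k y) \<partial>lborel)"
      unfolding N_def by (rule integral_norm_bound)
    also have "\<dots> = (\<integral>y. k y \<partial>lborel)" using k(2) by (simp add: norm_mult)
    finally show ?thesis using k(4) by simp
  qed
  have int: "integrable lborel (\<lambda>\<xi>. f \<xi> * N \<xi> ^ n)" for n
  proof (rule Bochner_Integration.integrable_bound)
    show "integrable lborel (\<lambda>\<xi>. m ^ n * norm (f \<xi>))" using f by auto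
    show "AE \<xi> in lborel. norm (f \<xi> * N \<xi> ^ n) \<le> norm (m ^ n * norm (f \<xi>))"
      using N_le m by (auto simp: norm_mult norm_power mult.commute[of "norm (f _)"] intro!: mult_right_mono power_mono)
  qed measurable
  have rec: "Q (Suc n) z = (CLBINT y. Q n (z - y) * k y)" for n z
  proof -
    let ?g = "\<lambda>\<xi> y. iexp (- (\<xi> * (z - y))) * (f \<xi> * N \<xi> ^ n) * k y"
    have "Q (Suc n) z = (CLBINT \<xi>. (CLBINT y. ?g \<xi> y))"
      unfolding Q_def fourier_int_def
    proof (rule Bochner_Integration.integral_cong[OF refl])
      fix \<xi> :: real
      have "(CLBINT y. ?g \<xi> y) = (CLBINT y. (iexp (- (\<xi> * z)) * (f \<xi> * N \<xi> ^ n)) * (iexp (\<xi> * y) * k y))"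
        by (intro Bochner_Integration.integral_cong) (auto simp: algebra_simps exp_add[symmetric] exp_diff exp_minus divide_inverse)
      also have "\<dots> = (iexp (- (\<xi> * z)) * (f \<xi> * N \<xi> ^ n)) * N \<xi>"
        unfolding N_def by (rule integral_mult_right_zero)
      finally show "iexp (- (\<xi> * z)) * (f \<xi> * N \<xi> ^ Suc n) = (CLBINT y. ?g \<xi> y)" by simp
    qed
    also have "\<dots> = (CLBINT y. (CLBINT \<xi>. ?g \<xi> y))"
    proof (rule lborel_pair.Fubini_integral[symmetric], rule lborel_pair.Fubini_integrable)
      have "(\<lambda>\<xi>. \<integral>y. norm (?g \<xi> y) \<partial>lborel) = (\<lambda>\<xi>. norm (f \<xi> * N \<xi> ^ n) * (\<integral>y. k y \<partial>lborel))"
        using k(2) by (simp add: norm_mult)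
      then show "integrable lborel (\<lambda>\<xi>. \<integral>y. norm (case (\<xi>, y) of (\<xi>, y) \<Rightarrow> ?g \<xi> y) \<partial>lborel)"
        using integrable_mult_left[OF integrable_norm[OF int[of n]], of "\<integral>y. k y \<partial>lborel"] by simp
      have "integrable lborel (?g \<xi>)" for \<xi>
        by (rule Bochner_Integration.integrable_bound[OF integrable_mult_right[OF k(1), of "norm (f \<xi> * N \<xi> ^ n)"]])
           (auto simp: norm_mult k(2))
      then show "AE \<xi> in lborel. integrable lborel (\<lambda>y. case (\<xi>, y) of (\<xi>, y) \<Rightarrow> ?g \<xi> y)" by simp
    qed measurable
    also have "\<dots> = (CLBINT y. Q n (z - y) * k y)"
      unfolding Q_def fourier_int_def by (simp add: mult.assoc flip: integral_mult_left_zero)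
    finally show ?thesis .
  qed
  have recn: "ennreal (norm (Q (Suc n) z)) \<le> (\<integral>\<^sup>+y. ennreal (norm (Q n (z - y))) * ennreal (k y) \<partial>lborel)" for n z
  proof (cases "integrable lborel (\<lambda>y. Q n (z - y) * k y)")
    case True
    have "ennreal (norm (Q (Suc n) z)) \<le> (\<integral>\<^sup>+y. norm (Q n (z - y) * k y) \<partial>lborel)"
      unfolding rec by (rule integral_norm_bound_ennreal[OF True])
    also have "\<dots> = (\<integral>\<^sup>+y. ennreal (norm (Q n (z - y))) * ennreal (k y) \<partial>lborel)"
      using k(2) by (simp add: norm_mult ennreal_mult)
    finally show ?thesis .
  next
    case False
    then show ?thesis unfolding rec by (simp add: not_integrable_integral_eq)
  qed
  have shift: "(\<integral>\<^sup>+z. ennreal (norm (Q n (z - y))) \<partial>lborel) = (\<integral>\<^sup>+z. ennreal (norm (Q n z)) \<partial>lborel)" for n y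
    using nn_integral_real_affine[of "\<lambda>z. ennreal (norm (Q n z))" 1 "-y"] by simp
  have refl: "(\<integral>\<^sup>+y. ennreal (norm (Q n (z - y))) \<partial>lborel) = (\<integral>\<^sup>+z. ennreal (norm (Q n z)) \<partial>lborel)" for n z
    using nn_integral_real_affine[of "\<lambda>z. ennreal (norm (Q n z))" "-1" "z"] by simp
  have L1: "(\<integral>\<^sup>+z. ennreal (norm (Q n z)) \<partial>lborel) \<le> ennreal (I * m ^ n)" for n
  proof (induction n)
    case 0
    then show ?case using f_1 by (simp add: Q_def)
  next
    case (Suc n)
    have "(\<integral>\<^sup>+z. ennreal (norm (Q (Suc n) z)) \<partial>lborel)
        \<le> (\<integral>\<^sup>+z. \<integral>\<^sup>+y. ennreal (norm (Q n (z - y))) * ennreal (k y) \<partial>lborel \<partial>lborel)"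
      by (intro nn_integral_mono recn)
    also have "\<dots> = (\<integral>\<^sup>+y. \<integral>\<^sup>+z. ennreal (norm (Q n (z - y))) * ennreal (k y) \<partial>lborel \<partial>lborel)"
      by (rule lborel_pair.Fubini') measurable
    also have "\<dots> = (\<integral>\<^sup>+y. (\<integral>\<^sup>+z. ennreal (norm (Q n z)) \<partial>lborel) * ennreal (k y) \<partial>lborel)"
      by (simp add: nn_integral_multc shift)
    also have "\<dots> = (\<integral>\<^sup>+z. ennreal (norm (Q n z)) \<partial>lborel) * (\<integral>\<^sup>+y. ennreal (k y) \<partial>lborel)"
      by (simp add: nn_integral_cmult)
    also have "\<dots> \<le> ennreal (I * m ^ n) * ennreal m"
      by (intro mult_mono Suc nnk) auto
    also have "\<dots> = ennreal (I * m ^ Suc n)"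
      using nonneg m by (simp add: ennreal_mult[symmetric] mult_ac)
    finally show ?case .
  qed
  \<comment> \<open>one convolution step turns the bound \<open>b\<close> into at most \<open>(1 + m * C) * b\<close>; the summand \<open>m\<close> ensures \<open>m ^ n \<le> L ^ n\<close>\<close>
  define L where "L = 1 + m + m * C"
  have L: "1 \<le> L" "m \<le> L" "0 \<le> L" using m nonneg by (auto simp: L_def)
  have Qb: "norm (Q n z) \<le> (D + E * I) * L ^ n * H \<bar>z\<bar>" if "z \<noteq> 0" for n z
    using that
  proof (induction n arbitrary: z)
    case 0
    have "D * H \<bar>z\<bar> \<le> (D + E * I) * H \<bar>z\<bar>"
      using nonneg H(1)[of "\<bar>z\<bar>"] 0 by (intro mult_right_mono) auto
    then show ?case using f_H[OF 0] by (simp add: Q_def)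
  next
    case (Suc n)
    let ?h = "H \<bar>z\<bar>" and ?D = "(D + E * I) * L ^ n"
    have h: "0 \<le> ?h" using H(1)[of "\<bar>z\<bar>"] Suc.prems by simp
    have D: "0 \<le> ?D" using nonneg L by simp
    have pt: "ennreal (norm (Q n (z - y))) * ennreal (k y)
        \<le> ennreal (E * ?h) * ennreal (norm (Q n (z - y))) + ennreal (?D * C * ?h) * ennreal (k y)" for y
    proof -
      have "norm (Q n (z - y)) * k y \<le> E * ?h * norm (Q n (z - y)) + ?D * C * ?h * k y"
      proof (cases "\<bar>z\<bar> / 2 \<le> y")
        case True
        then have "k y * norm (Q n (z - y)) \<le> E * ?h * norm (Q n (z - y))"
          using kH[of "\<bar>z\<bar>" y] Suc.prems by (intro mult_right_mono) auto
        then show ?thesis using D nonneg h k(2)[of y] by (simp add: mult.commute add_increasing2)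
      next
        case False
        show ?thesis
        proof (cases "y \<le> 0")
          case True
          then show ?thesis using k(3) nonneg h by simp
        next
          case y: False
          have "\<bar>z\<bar> / 2 \<le> \<bar>z - y\<bar>" "z - y \<noteq> 0" using False y Suc.prems by (auto simp: abs_if split: if_splits)
          then have "norm (Q n (z - y)) \<le> ?D * (C * ?h)"
            using Suc.IH[of "z - y"] H(2)[of "\<bar>z\<bar>" "\<bar>z - y\<bar>"] D Suc.prems
            by (meson mult_left_mono order_trans zero_less_abs_iff)
          then have "norm (Q n (z - y)) * k y \<le> ?D * (C * ?h) * k y"
            using k(2) by (intro mult_right_mono)
          moreover have "0 \<le> E * ?h * norm (Q n (z - y))" using nonneg h by simp
          ultimately show ?thesis by (simp add: mult.assoc)
        qed
      qed
      then show ?thesis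
        using k(2)[of y] h D nonneg
        by (simp add: ennreal_mult[symmetric] ennreal_plus[symmetric] ennreal_leI del: ennreal_plus)
    qed
    have "ennreal (norm (Q (Suc n) z)) \<le> (\<integral>\<^sup>+y. ennreal (norm (Q n (z - y))) * ennreal (k y) \<partial>lborel)"
      by (rule recn)
    also have "\<dots> \<le> (\<integral>\<^sup>+y. ennreal (E * ?h) * ennreal (norm (Q n (z - y))) + ennreal (?D * C * ?h) * ennreal (k y) \<partial>lborel)"
      by (intro nn_integral_mono pt)
    also have "\<dots> = ennreal (E * ?h) * (\<integral>\<^sup>+y. ennreal (norm (Q n y)) \<partial>lborel) + ennreal (?D * C * ?h) * (\<integral>\<^sup>+y. ennreal (k y) \<partial>lborel)"
      by (simp add: nn_integral_add nn_integral_cmult refl)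
    also have "\<dots> \<le> ennreal (E * ?h) * ennreal (I * m ^ n) + ennreal (?D * C * ?h) * ennreal m"
      by (intro add_mono mult_left_mono L1 nnk) auto
    also have "\<dots> = ennreal (E * ?h * (I * m ^ n) + ?D * C * ?h * m)"
      using D h m nonneg by (simp add: ennreal_mult[symmetric] ennreal_plus[symmetric] del: ennreal_plus)
    finally have "norm (Q (Suc n) z) \<le> E * ?h * (I * m ^ n) + ?D * C * ?h * m"
      using D h m nonneg by (subst (asm) ennreal_le_iff) auto
    also have "\<dots> = (E * I * m ^ n + ?D * (m * C)) * ?h" by (simp add: algebra_simps)
    also have "\<dots> \<le> ((D + E * I) * L ^ n * 1 + ?D * (m * C)) * ?h"
      using nonneg m L h
      by (intro mult_right_mono[OF _ h] add_mono) (auto intro!: mult_mono power_mono)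
    also have "\<dots> \<le> (?D * L) * ?h"
    proof (rule mult_right_mono[OF _ h])
      have "?D * (1 + m * C) \<le> ?D * L" using D m by (intro mult_left_mono) (auto simp: L_def)
      then show "(D + E * I) * L ^ n * 1 + ?D * (m * C) \<le> ?D * L" by (simp add: algebra_simps)
    qed
    finally show ?case by (simp add: mult_ac)
  qed
  let ?t = "\<lambda>n \<xi>. iexp (- (\<xi> * x)) * (f \<xi> * N \<xi> ^ n) /\<^sub>R fact n"
  have tint: "integrable lborel (?t n)" for n
    by (intro integrable_scaleR_right, rule Bochner_Integration.integrable_bound[OF int[of n]])
       (auto simp: norm_mult)
  have tn: "norm (?t n \<xi>) \<le> norm (f \<xi>) * (m ^ n /\<^sub>R fact n)" for n \<xi>
    using N_le[of \<xi>] m by (auto simp: norm_mult norm_power divide_inverse intro!: mult_left_mono power_mono mult_right_mono)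
  have sm: "summable (\<lambda>n. norm (?t n \<xi>))" for \<xi>
    by (rule summable_comparison_test'[where N = 0, OF summable_mult[OF summable_exp_generic[of m], of "norm (f \<xi>)"]])
       (use tn in auto)
  have "(\<lambda>n. \<integral>\<xi>. ?t n \<xi> \<partial>lborel) sums (\<integral>\<xi>. (\<Sum>n. ?t n \<xi>) \<partial>lborel)"
  proof (rule sums_integral[OF tint])
    show "AE \<xi> in lborel. summable (\<lambda>n. norm (?t n \<xi>))" using sm by simp
    show "summable (\<lambda>n. \<integral>\<xi>. norm (?t n \<xi>) \<partial>lborel)"
    proof (rule summable_comparison_test'[where N = 0, OF summable_mult[OF summable_exp_generic[of m], of "\<integral>\<xi>. norm (f \<xi>) \<partial>lborel"]])
      fix n
      have "(\<integral>\<xi>. norm (?t n \<xi>) \<partial>lborel) \<le> (\<integral>\<xi>. norm (f \<xi>) * (m ^ n /\<^sub>R fact n) \<partial>lborel)"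
        by (intro integral_mono integrable_norm tint tn) (use f in auto)
      then show "norm (\<integral>\<xi>. norm (?t n \<xi>) \<partial>lborel) \<le> (\<integral>\<xi>. norm (f \<xi>) \<partial>lborel) * (m ^ n /\<^sub>R fact n)"
        by (simp add: integral_nonneg_AE)
    qed
  qed
  moreover have "(\<Sum>n. ?t n \<xi>) = iexp (- (\<xi> * x)) * (f \<xi> * exp (N \<xi>))" for \<xi>
  proof -
    have "(\<lambda>n. (iexp (- (\<xi> * x)) * f \<xi>) * (N \<xi> ^ n /\<^sub>R fact n)) sums ((iexp (- (\<xi> * x)) * f \<xi>) * exp (N \<xi>))"
      by (intro sums_mult exp_converges)
    then show ?thesis by (simp add: sums_iff mult_ac)
  qed
  moreover have "(\<integral>\<xi>. ?t n \<xi> \<partial>lborel) = Q n x /\<^sub>R fact n" for n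
    by (simp add: Q_def fourier_int_def)
  ultimately have S: "(\<lambda>n. Q n x /\<^sub>R fact n) sums fourier_int (\<lambda>\<xi>. f \<xi> * exp (N \<xi>)) x"
    by (simp add: fourier_int_def)
  have b: "norm (Q n x /\<^sub>R fact n) \<le> (D + E * I) * H \<bar>x\<bar> * (L ^ n /\<^sub>R fact n)" for n
    using Qb[OF x, of n] by (simp add: field_simps)
  have "(\<lambda>n. (D + E * I) * H \<bar>x\<bar> * (L ^ n /\<^sub>R fact n)) sums ((D + E * I) * H \<bar>x\<bar> * exp L)"
    by (intro sums_mult exp_converges)
  then have "norm (fourier_int (\<lambda>\<xi>. f \<xi> * exp (N \<xi>)) x) \<le> (D + E * I) * H \<bar>x\<bar> * exp L"
    using S b norm_suminf_le[of "\<lambda>n. Q n x /\<^sub>R fact n" "\<lambda>n. (D + E * I) * H \<bar>x\<bar> * (L ^ n /\<^sub>R fact n)"]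
    by (simp add: sums_iff)
  then show ?thesis by (simp add: N_def L_def mult_ac)
qed

section \<open>Levy measures with an almost monotone density\<close>

lemma one_minus_cos_upper: "1 - cos u \<le> u\<^sup>2 / 2" for u :: real
proof -
  have "norm (iexp u - (\<Sum>k\<le>1. (\<i> * u) ^ k / fact k)) \<le> \<bar>u\<bar> ^ 2 / 2"
    using iexp_approx1[of u 1] by (simp add: numeral_2_eq_2)
  moreover have "Re (iexp u - (\<Sum>k\<le>1. (\<i> * u) ^ k / fact k)) = cos u - 1"
    by (simp add: Re_exp)
  ultimately show ?thesis
    using abs_Re_le_cmod[of "iexp u - (\<Sum>k\<le>1. (\<i> * u) ^ k / fact k)"] by simp
qed

lemma one_minus_cos_lower:
  fixes u :: real
  assumes "\<bar>u\<bar> \<le> 1"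
  shows "u\<^sup>2 / 3 \<le> 1 - cos u"
proof -
  have "norm (iexp u - (\<Sum>k\<le>2. (\<i> * u) ^ k / fact k)) \<le> \<bar>u\<bar> ^ 3 / 6"
    using iexp_approx1[of u 2] by (simp add: numeral_3_eq_3 numeral_2_eq_2)
  moreover have "Re (iexp u - (\<Sum>k\<le>2. (\<i> * u) ^ k / fact k)) = cos u - 1 + u\<^sup>2 / 2"
    by (simp add: Re_exp numeral_2_eq_2 power2_eq_square)
  ultimately have "\<bar>cos u - 1 + u\<^sup>2 / 2\<bar> \<le> \<bar>u\<bar> ^ 3 / 6"
    using abs_Re_le_cmod[of "iexp u - (\<Sum>k\<le>2. (\<i> * u) ^ k / fact k)"] by simp
  also have "\<bar>u\<bar> ^ 3 \<le> u\<^sup>2"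
    using assms mult_left_mono[of "\<bar>u\<bar>" 1 "u\<^sup>2"] by (simp add: power3_eq_cube power2_eq_square)
  finally show ?thesis using abs_ge_self[of "cos u - 1 + u\<^sup>2 / 2"] by linarith
qed

lemma exp_ge_quadratic: "0 \<le> u \<Longrightarrow> 1 + u + u\<^sup>2 / 2 \<le> exp u" for u :: real
  using exp_lower_Taylor_quadratic by simp

lemma nn_integral_powr_tail:
  fixes r \<beta> :: real
  assumes r: "0 < r" and \<beta>: "0 < \<beta>"
  shows "(\<integral>\<^sup>+x. ennreal (x powr (- 1 - \<beta>)) * indicator {r..} x \<partial>lborel) = ennreal (r powr - \<beta> / \<beta>)"
proof -
  have lim: "((\<lambda>x. - (x powr - \<beta> / \<beta>)) \<longlongrightarrow> - (0 / \<beta>)) at_top"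
    using \<beta> by (intro tendsto_intros tendsto_neg_powr filterlim_ident) auto
  have "(\<integral>\<^sup>+x. ennreal (x powr (- 1 - \<beta>)) * indicator {r..} x \<partial>lborel) = - (0 / \<beta>) - - (r powr - \<beta> / \<beta>)"
  proof (rule nn_integral_FTC_atLeast[OF _ _ _ lim])
    fix x assume "r \<le> x"
    then have "0 < x" using r by simp
    then have "((\<lambda>x. - (x powr - \<beta> / \<beta>)) has_real_derivative - (- \<beta> * x powr (- \<beta> - 1) / \<beta>)) (at x)"
      by (intro derivative_intros DERIV_cdivide DERIV_minus has_real_derivative_powr)
    then have D: "((\<lambda>x. - (x powr - \<beta> / \<beta>)) has_real_derivative x powr (- \<beta> - 1)) (at x)"
      using \<beta> by simp
    have "- 1 - \<beta> = - \<beta> - 1" by simp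
    then show "((\<lambda>x. - (x powr - \<beta> / \<beta>)) has_real_derivative x powr (- 1 - \<beta>)) (at x)"
      using D by (simp only:)
  qed auto
  then show ?thesis by simp
qed

text \<open>
  The process enters the analytic part only through its Levy measure. Almost monotonicity is what
  turns integrals of \<open>\<nu>\<close> into pointwise bounds on its density and back.
\<close>

locale monotone_levy =
  fixes \<nu> :: "real measure" and n :: "real \<Rightarrow> real" and C0 :: real
  assumes n_measurable [measurable]: "n \<in> borel_measurable borel"
    and n_nonneg: "\<And>x. 0 \<le> n x"
    and \<nu>_density: "\<nu> = density lborel (\<lambda>x. ennreal (n x) * indicator {0<..} x)"
    and C0: "1 \<le> C0"
    and almost_monotone: "\<And>x y. 0 < x \<Longrightarrow> x \<le> y \<Longrightarrow> n y \<le> C0 * n x"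
    and levy_integrable: "(\<integral>\<^sup>+x\<in>{0<..}. ennreal (min 1 (x\<^sup>2)) \<partial>\<nu>) < \<infinity>"
    and nontrivial: "emeasure \<nu> UNIV \<noteq> 0"
begin

lemma sets_\<nu> [measurable_cong, simp]: "sets \<nu> = sets borel" and space_\<nu> [simp]: "space \<nu> = UNIV"
  by (simp_all add: \<nu>_density)

lemma AE_pos: "AE y in \<nu>. 0 < y"
  unfolding \<nu>_density by (subst AE_density) (auto split: split_indicator)

lemma nn_integral_\<nu>:
  assumes [measurable]: "h \<in> borel_measurable borel"
  shows "(\<integral>\<^sup>+y. h y \<partial>\<nu>) = (\<integral>\<^sup>+y. ennreal (n y) * indicator {0<..} y * h y \<partial>lborel)"
  unfolding \<nu>_density by (subst nn_integral_density) auto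

lemma integrable_min: "integrable \<nu> (\<lambda>y. min 1 (y\<^sup>2))"
proof (rule integrableI_bounded)
  have "(\<integral>\<^sup>+x. ennreal (norm (min 1 (x\<^sup>2))) \<partial>\<nu>) = (\<integral>\<^sup>+x\<in>{0<..}. ennreal (min 1 (x\<^sup>2)) \<partial>\<nu>)"
    by (rule nn_integral_cong_AE, rule AE_mp[OF AE_pos]) auto
  then show "(\<integral>\<^sup>+x. ennreal (norm (min 1 (x\<^sup>2))) \<partial>\<nu>) < \<infinity>" using levy_integrable by simp
qed measurable

lemma integrable_\<nu>I:
  fixes h :: "real \<Rightarrow> 'b::{banach,second_countable_topology}"
  assumes [measurable]: "h \<in> borel_measurable borel"
    and h: "\<And>y. 0 < y \<Longrightarrow> norm (h y) \<le> K * min 1 (y\<^sup>2)"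
  shows "integrable \<nu> h"
proof (rule Bochner_Integration.integrable_bound)
  show "integrable \<nu> (\<lambda>y. K * min 1 (y\<^sup>2))" using integrable_min by simp
  show "AE y in \<nu>. norm (h y) \<le> norm (K * min 1 (y\<^sup>2))"
    using AE_pos by eventually_elim (use h in \<open>force intro: order_trans[OF _ abs_ge_self]\<close>)
qed measurable

lemma integrable_\<nu>_square_cutoff:
  fixes h :: "real \<Rightarrow> 'b::{banach,second_countable_topology}"
  assumes "h \<in> borel_measurable borel"
    and h: "\<And>y. 0 < y \<Longrightarrow> y < r \<Longrightarrow> norm (h y) \<le> K * y\<^sup>2" "\<And>y. r \<le> y \<Longrightarrow> h y = 0"
  shows "integrable \<nu> h"
proof (rule integrable_\<nu>I[where K = "\<bar>K\<bar> * max 1 (r\<^sup>2)"])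
  fix y :: real assume y: "0 < y"
  show "norm (h y) \<le> \<bar>K\<bar> * max 1 (r\<^sup>2) * min 1 (y\<^sup>2)"
  proof (cases "y < r")
    case True
    have "y\<^sup>2 \<le> r\<^sup>2" using y True by (intro power_mono) auto
    then have "y\<^sup>2 \<le> max 1 (r\<^sup>2) * min 1 (y\<^sup>2)"
      using mult_right_mono[of 1 "max 1 (r\<^sup>2)" "y\<^sup>2"] by (auto simp: min_def)
    then have "\<bar>K\<bar> * y\<^sup>2 \<le> \<bar>K\<bar> * (max 1 (r\<^sup>2) * min 1 (y\<^sup>2))" by (intro mult_left_mono) auto
    moreover have "K * y\<^sup>2 \<le> \<bar>K\<bar> * y\<^sup>2" by (intro mult_right_mono) auto
    ultimately show ?thesis using h(1)[OF y True] by (simp add: mult.assoc)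
  next
    case False
    then show ?thesis using h(2)[of y] by simp
  qed
qed fact

text \<open>
  Here \<open>laplace2\<close> is \<open>\<phi>''\<close>, \<open>re_psi\<close> is the real part of \<open>\<psi>\<close>, and \<open>\<Phi>\<close> agrees with the function \<open>Phi\<close> of the
  Laplace exponent on the nonnegative half line. By substitution
  \<open>profile x = \<integral>\<^bsub>(0,1)\<^esub> u\<^sup>2 n(x u) du\<close>, an average of the density over \<open>(0, x)\<close> that inherits its
  monotonicity up to constants.
\<close>

definition laplace2 :: "real \<Rightarrow> real" where "laplace2 l = (\<integral>y. y\<^sup>2 * exp (- (l * y)) \<partial>\<nu>)"
definition small_moment :: "real \<Rightarrow> real" where "small_moment r = (\<integral>y. y\<^sup>2 * indicator {..<r} y \<partial>\<nu>)"
definition tail :: "real \<Rightarrow> real" where "tail r = measure \<nu> {r..}"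
definition re_psi :: "real \<Rightarrow> real" where "re_psi \<xi> = (\<integral>y. 1 - cos (\<xi> * y) \<partial>\<nu>)"
definition \<Phi> :: "real \<Rightarrow> real" where "\<Phi> l = l\<^sup>2 * laplace2 l"
definition profile :: "real \<Rightarrow> real" where "profile x = small_moment x / x ^ 3"

lemma exp_moment_bound:
  fixes l y :: real
  assumes l: "0 < l" and y: "0 < y"
  shows "y\<^sup>2 * exp (- (l * y)) \<le> (1 + 2 / l\<^sup>2) * min 1 (y\<^sup>2)"
proof -
  have "(l * y) ^ 2 / 2 \<le> exp (l * y)" using exp_ge_power[of "l * y" 2] assms by simp
  then have "(l * y)\<^sup>2 * exp (- (l * y)) \<le> 2" by (simp add: exp_minus field_simps)
  then have "y\<^sup>2 * exp (- (l * y)) \<le> 2 / l\<^sup>2" using l by (simp add: field_simps)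
  moreover have "y\<^sup>2 * exp (- (l * y)) \<le> y\<^sup>2" using assms by (simp add: mult_left_le)
  moreover have "y\<^sup>2 \<le> (1 + 2 / l\<^sup>2) * y\<^sup>2" by (simp add: algebra_simps)
  ultimately show ?thesis by (auto simp: min_def)
qed

lemma integrable_laplace2: "0 < l \<Longrightarrow> integrable \<nu> (\<lambda>y. y\<^sup>2 * exp (- (l * y)))"
  using exp_moment_bound by (intro integrable_\<nu>I[where K = "1 + 2 / l\<^sup>2"]) auto

lemma integrable_small_moment: "integrable \<nu> (\<lambda>y. y\<^sup>2 * indicator {..<r} y)"
  by (rule integrable_\<nu>_square_cutoff[where r = r and K = 1]) auto

lemma laplace2_pos: assumes l: "0 < l" shows "0 < laplace2 l"
proof -
  have "0 \<le> laplace2 l" unfolding laplace2_def by (intro Bochner_Integration.integral_nonneg) auto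
  moreover have "laplace2 l \<noteq> 0"
  proof
    assume "laplace2 l = 0"
    then have "AE y in \<nu>. y\<^sup>2 * exp (- (l * y)) = 0"
      unfolding laplace2_def by (subst (asm) integral_nonneg_eq_0_iff_AE[OF integrable_laplace2[OF l]]) auto
    then have "AE y in \<nu>. False" using AE_pos by eventually_elim auto
    then have "emeasure \<nu> UNIV = 0" by (subst (asm) AE_iff_measurable[of UNIV]) auto
    then show False using nontrivial by simp
  qed
  ultimately show ?thesis by linarith
qed

lemma laplace2_antimono: "0 < l \<Longrightarrow> l \<le> \<mu> \<Longrightarrow> laplace2 \<mu> \<le> laplace2 l"
  unfolding laplace2_def
  by (rule integral_mono_AE[OF integrable_laplace2 integrable_laplace2])
     (use AE_pos in \<open>auto elim!: eventually_mono intro!: mult_left_mono mult_right_mono\<close>)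

lemma small_moment_nonneg: "0 \<le> small_moment r"
  unfolding small_moment_def by (intro Bochner_Integration.integral_nonneg) auto

lemma small_moment_mono: "r \<le> s \<Longrightarrow> small_moment r \<le> small_moment s"
  unfolding small_moment_def by (intro integral_mono integrable_small_moment) (auto split: split_indicator)

lemma integrable_tail: assumes "0 < r" shows "integrable \<nu> (indicator {r..} :: real \<Rightarrow> real)"
proof (rule integrable_\<nu>I[where K = "1 + 1 / r\<^sup>2"])
  fix y :: real assume "0 < y"
  have "1 \<le> (1 + 1 / r\<^sup>2) * min 1 (y\<^sup>2)" if "r \<le> y"
  proof -
    have "r\<^sup>2 \<le> y\<^sup>2" using that assms by (intro power_mono) auto
    then have "1 \<le> y\<^sup>2 / r\<^sup>2" using assms by simp
    then have "1 \<le> (1 + 1 / r\<^sup>2) * y\<^sup>2" by (simp add: algebra_simps add_increasing)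
    then show ?thesis by (auto simp: min_def)
  qed
  then show "norm (indicator {r..} y :: real) \<le> (1 + 1 / r\<^sup>2) * min 1 (y\<^sup>2)"
    by (auto split: split_indicator)
qed measurable

lemma emeasure_tail: "0 < r \<Longrightarrow> emeasure \<nu> {r..} = ennreal (tail r)"
  using integrable_tail[of r] unfolding tail_def
  by (subst emeasure_eq_ennreal_measure) (auto simp: integrable_indicator_iff)

lemma tail_nonneg: "0 \<le> tail r" by (simp add: tail_def)

lemma ennreal_small_moment: "ennreal (small_moment r) = (\<integral>\<^sup>+y. ennreal (n y * y\<^sup>2) * indicator {0<..<r} y \<partial>lborel)"
proof -
  have "ennreal (small_moment r) = (\<integral>\<^sup>+y. ennreal (y\<^sup>2 * indicator {..<r} y) \<partial>\<nu>)"
    unfolding small_moment_def by (rule nn_integral_eq_integral[symmetric, OF integrable_small_moment]) auto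
  also have "\<dots> = (\<integral>\<^sup>+y. ennreal (n y) * indicator {0<..} y * ennreal (y\<^sup>2 * indicator {..<r} y) \<partial>lborel)"
    by (rule nn_integral_\<nu>) measurable
  also have "\<dots> = (\<integral>\<^sup>+y. ennreal (n y * y\<^sup>2) * indicator {0<..<r} y \<partial>lborel)"
    by (intro nn_integral_cong) (auto split: split_indicator simp: ennreal_mult n_nonneg)
  finally show ?thesis .
qed

lemma nn_integral_square:
  assumes "0 \<le> K" "0 \<le> a" "a \<le> b"
  shows "(\<integral>\<^sup>+y. ennreal (K * y\<^sup>2) * indicator {a..b} y \<partial>lborel) = ennreal (K * (b ^ 3 - a ^ 3) / 3)"
proof -
  have "(\<integral>\<^sup>+y. ennreal (K * y\<^sup>2) * indicator {a..b} y \<partial>lborel) = K * b ^ 3 / 3 - K * a ^ 3 / 3"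
    by (rule nn_integral_FTC_Icc) (use assms in \<open>auto intro!: derivative_eq_intros simp: field_simps\<close>)
  then show ?thesis by (simp add: algebra_simps diff_divide_distrib)
qed

text \<open>
  On \<open>(0, x)\<close> the density is at least \<open>n x / C0\<close>.
\<close>

lemma density_le_profile: assumes x: "0 < x" shows "n x \<le> 3 * C0 * profile x"
proof -
  have "ennreal (n x / C0 * x ^ 3 / 3) = (\<integral>\<^sup>+y. ennreal (n x / C0 * y\<^sup>2) * indicator {0..x} y \<partial>lborel)"
    using nn_integral_square[of "n x / C0" 0 x] x n_nonneg C0 by simp
  also have "\<dots> \<le> (\<integral>\<^sup>+y. ennreal (n y * y\<^sup>2) * indicator {0<..<x} y \<partial>lborel)"
  proof (rule nn_integral_mono_AE)
    have "AE y in lborel. y \<noteq> 0 \<and> y \<noteq> x"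
      using AE_lborel_singleton[of "0::real"] AE_lborel_singleton[of x] by eventually_elim simp
    then show "AE y in lborel. ennreal (n x / C0 * y\<^sup>2) * indicator {0..x} y \<le> ennreal (n y * y\<^sup>2) * indicator {0<..<x} y"
    proof eventually_elim
      case (elim y)
      have "n x / C0 \<le> n y" if "0 < y" "y < x"
        using almost_monotone[of y x] that C0 by (simp add: divide_le_eq mult.commute)
      then have "n x / C0 * y\<^sup>2 \<le> n y * y\<^sup>2" if "0 < y" "y < x"
        using that by (intro mult_right_mono) auto
      then show ?case using elim
        by (auto split: split_indicator intro!: ennreal_leI)
    qed
  qed
  also have "\<dots> = ennreal (small_moment x)" by (rule ennreal_small_moment[symmetric])
  finally have "n x / C0 * x ^ 3 / 3 \<le> small_moment x" by (simp add: small_moment_nonneg)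
  then show ?thesis using x C0 by (simp add: profile_def field_simps)
qed

lemma profile_nonneg: "0 < x \<Longrightarrow> 0 \<le> profile x" by (simp add: profile_def small_moment_nonneg)

text \<open>
  Beyond \<open>x\<close> the density is at most \<open>C0 * n x\<close>, so the second moment grows there at most like the
  cube of the cut-off.
\<close>

lemma profile_almost_decreasing: assumes x: "0 < x" "x \<le> y" shows "profile y \<le> 3 * C0\<^sup>2 * profile x"
proof -
  have "ennreal (small_moment y) \<le> (\<integral>\<^sup>+s. ennreal (n s * s\<^sup>2) * indicator {0<..<x} s
      + ennreal (C0 * n x * s\<^sup>2) * indicator {x..y} s \<partial>lborel)"
    unfolding ennreal_small_moment
    using almost_monotone[of x] x
    by (intro nn_integral_mono) (auto split: split_indicator intro!: ennreal_leI mult_right_mono)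
  also have "\<dots> = ennreal (small_moment x) + ennreal (C0 * n x * (y ^ 3 - x ^ 3) / 3)"
    using x C0 n_nonneg by (subst nn_integral_add) (auto simp: nn_integral_square ennreal_small_moment[symmetric])
  also have "\<dots> = ennreal (small_moment x + C0 * n x * (y ^ 3 - x ^ 3) / 3)"
    using x C0 n_nonneg power_mono[of x y 3]
    by (subst ennreal_plus) (auto simp: small_moment_nonneg)
  finally have "small_moment y \<le> small_moment x + C0 * n x * (y ^ 3 - x ^ 3) / 3"
    using x C0 n_nonneg power_mono[of x y 3] small_moment_nonneg by (subst (asm) ennreal_le_iff) auto
  also have "\<dots> \<le> C0\<^sup>2 * small_moment x + C0 * (3 * C0 * profile x) * (y ^ 3 - x ^ 3) / 3"
  proof (intro add_mono divide_right_mono mult_right_mono mult_left_mono)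
    show "small_moment x \<le> C0\<^sup>2 * small_moment x" using mult_right_mono[of 1 "C0\<^sup>2" "small_moment x"] C0 small_moment_nonneg[of x] by simp
    show "n x \<le> 3 * C0 * profile x" using density_le_profile x by blast
    show "0 \<le> y ^ 3 - x ^ 3" using x power_mono[of x y 3] by simp
  qed (use C0 in auto)
  also have "\<dots> = C0\<^sup>2 * profile x * y ^ 3" using x by (simp add: profile_def field_simps power2_eq_square)
  finally have "small_moment y / y ^ 3 \<le> C0\<^sup>2 * profile x" using x by (simp add: divide_le_eq)
  also have "\<dots> \<le> 3 * C0\<^sup>2 * profile x" using C0 profile_nonneg[of x] x by (simp add: mult_right_mono)
  finally show ?thesis by (simp add: profile_def)
qed

lemma profile_half: "0 < x \<Longrightarrow> profile (x / 2) \<le> 8 * profile x"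
  using small_moment_mono[of "x / 2" x] by (simp add: profile_def power_divide divide_right_mono)

lemma small_moment_le_laplace2: assumes r: "0 < r" shows "small_moment r \<le> exp 1 * laplace2 (1 / r)"
proof -
  have "small_moment r \<le> (\<integral>y. exp 1 * (y\<^sup>2 * exp (- (1 / r * y))) \<partial>\<nu>)"
    unfolding small_moment_def
  proof (rule integral_mono[OF integrable_small_moment])
    show "integrable \<nu> (\<lambda>y. exp 1 * (y\<^sup>2 * exp (- (1 / r * y))))"
      using integrable_laplace2[of "1 / r"] r by simp
    fix y
    show "y\<^sup>2 * indicator {..<r} y \<le> exp 1 * (y\<^sup>2 * exp (- (1 / r * y)))"
    proof (cases "y < r")
      case True
      then have "1 \<le> exp (1 - 1 / r * y)" using r by (simp add: field_simps)
      then have "y\<^sup>2 * 1 \<le> y\<^sup>2 * exp (1 - 1 / r * y)" by (rule mult_left_mono) auto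
      then show ?thesis using True by (simp add: exp_diff exp_minus divide_inverse mult_ac)
    qed auto
  qed
  then show ?thesis by (simp add: laplace2_def)
qed

text \<open>
  The contribution of \<open>y \<ge> r\<close> to \<open>\<phi>''(1/r)\<close> is at most \<open>C0 * n r\<close> times
  \<open>\<integral>\<^bsub>[r,\<infinity>)\<^esub> y\<^sup>2 exp (- y/r) dy \<le> 24 r\<^sup>3\<close>, and \<open>n r * r\<^sup>3\<close> is again controlled by the moment below \<open>r\<close>.
\<close>

lemma laplace2_le_small_moment: assumes r: "0 < r" shows "laplace2 (1 / r) \<le> (1 + 72 * C0\<^sup>2) * small_moment r"
proof -
  have pt: "y\<^sup>2 * exp (- (1 / r * y)) \<le> 24 * r ^ 4 * y powr (- 1 - 1)" if y: "r \<le> y" for y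
  proof -
    have y0: "0 < y" using r y by simp
    have "(1 / r * y) ^ 4 / fact 4 \<le> exp (1 / r * y)" using r y0 by (intro exp_ge_power) auto
    then have "y ^ 4 * exp (- (1 / r * y)) \<le> 24 * r ^ 4"
      using r by (simp add: fact_numeral exp_minus field_simps)
    then have "y\<^sup>2 * exp (- (1 / r * y)) \<le> 24 * r ^ 4 / y\<^sup>2"
      using y0 by (simp add: field_simps flip: power_add)
    then show ?thesis using y0 by (simp add: powr_minus_divide)
  qed
  have "ennreal (laplace2 (1 / r)) = (\<integral>\<^sup>+y. ennreal (y\<^sup>2 * exp (- (1 / r * y))) \<partial>\<nu>)"
    unfolding laplace2_def using integrable_laplace2[of "1 / r"] r by (intro nn_integral_eq_integral[symmetric]) auto
  also have "\<dots> = (\<integral>\<^sup>+y. ennreal (n y) * indicator {0<..} y * ennreal (y\<^sup>2 * exp (- (1 / r * y))) \<partial>lborel)"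
    by (rule nn_integral_\<nu>) measurable
  also have "\<dots> \<le> (\<integral>\<^sup>+y. ennreal (n y * y\<^sup>2) * indicator {0<..<r} y
      + ennreal (C0 * n r * (24 * r ^ 4)) * (ennreal (y powr (- 1 - 1)) * indicator {r..} y) \<partial>lborel)"
  proof (rule nn_integral_mono)
    fix y
    consider "y \<le> 0" | "0 < y" "y < r" | "0 < y" "r \<le> y" by linarith
    then show "ennreal (n y) * indicator {0<..} y * ennreal (y\<^sup>2 * exp (- (1 / r * y)))
      \<le> ennreal (n y * y\<^sup>2) * indicator {0<..<r} y
      + ennreal (C0 * n r * (24 * r ^ 4)) * (ennreal (y powr (- 1 - 1)) * indicator {r..} y)"
    proof cases
      case 1
      then show ?thesis by simp
    next
      case 2
      then have "n y * (y\<^sup>2 * exp (- (1 / r * y))) \<le> n y * y\<^sup>2"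
        using n_nonneg r by (intro mult_left_mono mult_left_le) auto
      then show ?thesis using 2 n_nonneg by (simp add: ennreal_mult[symmetric] ennreal_leI)
    next
      case 3
      have "n y * (y\<^sup>2 * exp (- (1 / r * y))) \<le> (C0 * n r) * (24 * r ^ 4 * y powr (- 1 - 1))"
        using almost_monotone[of r y] r 3 C0 n_nonneg by (intro mult_mono pt) auto
      then show ?thesis using 3 n_nonneg C0 r by (simp add: ennreal_mult[symmetric] ennreal_leI mult_ac)
    qed
  qed
  also have "\<dots> = ennreal (small_moment r) + ennreal (C0 * n r * (24 * r ^ 4)) * ennreal (r powr - 1 / 1)"
    using nn_integral_powr_tail[OF r, of 1]
    by (subst nn_integral_add) (simp_all add: nn_integral_cmult ennreal_small_moment[symmetric])
  also have "\<dots> = ennreal (small_moment r + C0 * n r * (24 * r ^ 3))"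
    using r C0 n_nonneg small_moment_nonneg
    by (simp add: ennreal_mult[symmetric] ennreal_plus[symmetric] powr_minus_divide numeral_eq_Suc del: ennreal_plus)
  finally have "laplace2 (1 / r) \<le> small_moment r + C0 * n r * (24 * r ^ 3)"
    using r C0 n_nonneg small_moment_nonneg by (subst (asm) ennreal_le_iff) auto
  also have "\<dots> \<le> small_moment r + C0 * (3 * C0 * profile r) * (24 * r ^ 3)"
    using density_le_profile[OF r] C0 r by (intro add_mono mult_right_mono mult_left_mono) auto
  also have "\<dots> = (1 + 72 * C0\<^sup>2) * small_moment r"
    using r by (simp add: profile_def field_simps power2_eq_square)
  finally show ?thesis .
qed

end

section \<open>Lower scaling and the real part of the exponent\<close>

context monotone_levy
begin

definition c_psi :: real where "c_psi = 1 / (3 * (1 + 72 * C0\<^sup>2))"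

lemma c_psi: "0 < c_psi" "c_psi \<le> 1"
proof -
  have "0 \<le> C0\<^sup>2" by simp
  then have "1 \<le> 3 * (1 + 72 * C0\<^sup>2)" by simp
  moreover from this have "0 < 3 * (1 + 72 * C0\<^sup>2)" by linarith
  ultimately show "0 < c_psi" "c_psi \<le> 1" unfolding c_psi_def by (simp_all only: divide_le_eq_1_pos zero_less_divide_1_iff)
qed

lemma \<Phi>_pos: "0 < l \<Longrightarrow> 0 < \<Phi> l"
  by (simp add: \<Phi>_def laplace2_pos)

lemma \<Phi>_upper_scaling: "0 < l \<Longrightarrow> 1 \<le> u \<Longrightarrow> \<Phi> (u * l) \<le> u\<^sup>2 * \<Phi> l"
  using laplace2_antimono[of l "u * l"] by (simp add: \<Phi>_def power_mult_distrib mult_left_mono)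

lemma profile_le_\<Phi>: assumes x: "0 < x" shows "profile x \<le> exp 1 * (\<Phi> (1 / x) / x)"
proof -
  have "profile x \<le> exp 1 * laplace2 (1 / x) / x ^ 3"
    unfolding profile_def using small_moment_le_laplace2[OF x] x by (intro divide_right_mono) auto
  then show ?thesis using x by (simp add: \<Phi>_def power2_eq_square power3_eq_cube)
qed

lemma integrable_re_psi: "integrable \<nu> (\<lambda>y. 1 - cos (\<xi> * y))"
proof (rule integrable_\<nu>I[where K = "2 + \<xi>\<^sup>2 / 2"])
  fix y :: real
  have "1 - cos (\<xi> * y) \<le> (\<xi> * y)\<^sup>2 / 2" by (rule one_minus_cos_upper)
  also have "\<dots> \<le> (2 + \<xi>\<^sup>2 / 2) * y\<^sup>2" by (simp add: power_mult_distrib algebra_simps)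
  finally have "1 - cos (\<xi> * y) \<le> (2 + \<xi>\<^sup>2 / 2) * y\<^sup>2" .
  moreover have "1 - cos (\<xi> * y) \<le> 2 + \<xi>\<^sup>2 / 2"
    using cos_ge_minus_one[of "\<xi> * y"] zero_le_power2[of \<xi>] by linarith
  ultimately show "norm (1 - cos (\<xi> * y)) \<le> (2 + \<xi>\<^sup>2 / 2) * min 1 (y\<^sup>2)"
    by (simp add: min_def)
qed measurable

lemma re_psi_nonneg: "0 \<le> re_psi \<xi>"
  unfolding re_psi_def by (intro Bochner_Integration.integral_nonneg) auto

lemma re_psi_zero: "re_psi 0 = 0" by (simp add: re_psi_def)

lemma re_psi_minus: "re_psi (- \<xi>) = re_psi \<xi>" by (simp add: re_psi_def)

lemma re_psi_abs: "re_psi \<bar>\<xi>\<bar> = re_psi \<xi>" using re_psi_minus[of \<xi>] by (simp add: abs_if)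

text \<open>
  Only jumps below \<open>1 / \<bar>\<xi>\<bar>\<close> are used; there the cosine is quadratic.
\<close>

lemma re_psi_lower: assumes \<xi>: "\<xi> \<noteq> 0" shows "c_psi * \<Phi> \<bar>\<xi>\<bar> \<le> re_psi \<xi>"
proof -
  have "\<xi>\<^sup>2 / 3 * small_moment (1 / \<bar>\<xi>\<bar>) = (\<integral>y. \<xi>\<^sup>2 / 3 * (y\<^sup>2 * indicator {..<1 / \<bar>\<xi>\<bar>} y) \<partial>\<nu>)"
    by (simp add: small_moment_def)
  also have "\<dots> \<le> re_psi \<xi>"
    unfolding re_psi_def
  proof (rule integral_mono_AE)
    show "AE y in \<nu>. \<xi>\<^sup>2 / 3 * (y\<^sup>2 * indicator {..<1 / \<bar>\<xi>\<bar>} y) \<le> 1 - cos (\<xi> * y)"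
      using AE_pos
    proof eventually_elim
      case (elim y)
      have "(\<xi> * y)\<^sup>2 / 3 \<le> 1 - cos (\<xi> * y)" if "y < 1 / \<bar>\<xi>\<bar>"
        using that elim \<xi> by (intro one_minus_cos_lower) (simp add: abs_mult field_simps)
      then show ?case by (auto simp: power_mult_distrib split: split_indicator)
    qed
  qed (use integrable_small_moment integrable_re_psi in auto)
  finally have 1: "\<xi>\<^sup>2 / 3 * small_moment (1 / \<bar>\<xi>\<bar>) \<le> re_psi \<xi>" .
  have "laplace2 \<bar>\<xi>\<bar> / (1 + 72 * C0\<^sup>2) \<le> small_moment (1 / \<bar>\<xi>\<bar>)"
    using laplace2_le_small_moment[of "1 / \<bar>\<xi>\<bar>"] \<xi> by (simp add: divide_le_eq mult.commute add_pos_nonneg)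
  then have "\<xi>\<^sup>2 / 3 * (laplace2 \<bar>\<xi>\<bar> / (1 + 72 * C0\<^sup>2)) \<le> \<xi>\<^sup>2 / 3 * small_moment (1 / \<bar>\<xi>\<bar>)"
    by (intro mult_left_mono) auto
  moreover have "c_psi * \<Phi> \<bar>\<xi>\<bar> = \<xi>\<^sup>2 / 3 * (laplace2 \<bar>\<xi>\<bar> / (1 + 72 * C0\<^sup>2))"
    by (simp add: c_psi_def \<Phi>_def)
  ultimately show ?thesis using 1 by linarith
qed

lemma re_psi_upper: assumes \<rho>: "0 < \<rho>" and z: "\<bar>z\<bar> \<le> \<rho>" shows "re_psi z \<le> 2 * tail (1 / \<rho>) + exp 1 / 2 * \<Phi> \<rho>"
proof -
  have "re_psi z \<le> (\<integral>y. 2 * indicator {1 / \<rho>..} y + \<rho>\<^sup>2 / 2 * (y\<^sup>2 * indicator {..<1 / \<rho>} y) \<partial>\<nu>)"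
    unfolding re_psi_def
  proof (rule integral_mono[OF integrable_re_psi])
    show "integrable \<nu> (\<lambda>y. 2 * indicator {1 / \<rho>..} y + \<rho>\<^sup>2 / 2 * (y\<^sup>2 * indicator {..<1 / \<rho>} y))"
      using integrable_tail[of "1 / \<rho>"] integrable_small_moment \<rho> by auto
    fix y :: real
    have "1 - cos (z * y) \<le> 2" using cos_ge_minus_one[of "z * y"] by linarith
    moreover have "1 - cos (z * y) \<le> \<rho>\<^sup>2 / 2 * y\<^sup>2"
    proof -
      have "z\<^sup>2 \<le> \<rho>\<^sup>2" using z \<rho> by (simp add: abs_le_square_iff[symmetric])
      then have "z\<^sup>2 * y\<^sup>2 \<le> \<rho>\<^sup>2 * y\<^sup>2" by (rule mult_right_mono) auto
      then show ?thesis using one_minus_cos_upper[of "z * y"] by (simp add: power_mult_distrib)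
    qed
    ultimately show "1 - cos (z * y) \<le> 2 * indicator {1 / \<rho>..} y + \<rho>\<^sup>2 / 2 * (y\<^sup>2 * indicator {..<1 / \<rho>} y)"
      by (auto split: split_indicator)
  qed
  also have "\<dots> = 2 * tail (1 / \<rho>) + \<rho>\<^sup>2 / 2 * small_moment (1 / \<rho>)"
    using integrable_tail[of "1 / \<rho>"] integrable_small_moment \<rho> by (simp add: tail_def small_moment_def)
  also have "\<rho>\<^sup>2 / 2 * small_moment (1 / \<rho>) \<le> \<rho>\<^sup>2 / 2 * (exp 1 * laplace2 \<rho>)"
    using small_moment_le_laplace2[of "1 / \<rho>"] \<rho> by (intro mult_left_mono) auto
  finally show ?thesis by (simp add: \<Phi>_def mult_ac)
qed

text \<open>
  Between \<open>\<delta>\<close> and a point \<open>x1\<close> above \<open>x0\<close> the function \<open>\<Phi>\<close> lies between two positive constants, so lower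
  scaling above \<open>x0\<close> can be chained with this compact range. The case \<open>\<delta> = 0\<close> is admitted when scaling
  already holds on the whole half line.
\<close>

lemma scaling_extends_below:
  assumes c: "0 < c" and \<alpha>: "0 < \<alpha>" and x0: "0 \<le> x0"
    and laplace2_scaling: "\<And>u l. 1 \<le> u \<Longrightarrow> x0 < l \<Longrightarrow> c * u powr (\<alpha> - 2) * laplace2 l \<le> laplace2 (u * l)"
    and \<delta>: "0 < \<delta> \<or> (\<delta> = 0 \<and> x0 = 0)"
  shows "\<exists>c'>0. \<forall>l u. 0 < l \<longrightarrow> \<delta> \<le> l \<longrightarrow> 1 \<le> u \<longrightarrow> c' * u powr \<alpha> * \<Phi> l \<le> \<Phi> (u * l)"
proof -
  have above: "c * u powr \<alpha> * \<Phi> l \<le> \<Phi> (u * l)" if "1 \<le> u" "x0 < l" for u l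
  proof -
    have "(u * l)\<^sup>2 * (c * u powr (\<alpha> - 2) * laplace2 l) \<le> (u * l)\<^sup>2 * laplace2 (u * l)"
      using laplace2_scaling[OF that] by (intro mult_left_mono) auto
    moreover have "u\<^sup>2 * u powr (\<alpha> - 2) = u powr \<alpha>"
      using that by (simp add: powr_diff)
    then have "(u * l)\<^sup>2 * (c * u powr (\<alpha> - 2) * laplace2 l) = c * u powr \<alpha> * \<Phi> l"
      by (simp add: \<Phi>_def power_mult_distrib algebra_simps)
    ultimately show ?thesis by (simp add: \<Phi>_def)
  qed
  show ?thesis
  proof (cases "\<delta> = 0")
    case True
    then show ?thesis using above c \<delta> by (intro exI[of _ c]) auto
  next
    case False
    then have \<delta>: "0 < \<delta>" using \<delta> by auto
    define x1 where "x1 = x0 + \<delta>"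
    have x1: "x0 < x1" "0 < x1" "\<delta> \<le> x1" using \<delta> x0 by (auto simp: x1_def)
    define M where "M = (x1 / \<delta>) powr \<alpha> * (x1\<^sup>2 * laplace2 \<delta>)"
    have M: "0 < M" using x1 \<delta> by (simp add: M_def laplace2_pos)
    define c' where "c' = Min {c, \<delta>\<^sup>2 * laplace2 x1 / M, c * \<Phi> x1 / M}"
    have c': "0 < c'" "c' \<le> c" "c' * M \<le> \<delta>\<^sup>2 * laplace2 x1" "c' * M \<le> c * \<Phi> x1"
      using M c \<delta> x1 by (auto simp: c'_def laplace2_pos \<Phi>_pos simp flip: pos_le_divide_eq)
    have "c' * u powr \<alpha> * \<Phi> l \<le> \<Phi> (u * l)" if "0 < l" "\<delta> \<le> l" "1 \<le> u" for l u
    proof (cases "x0 < l")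
      case True
      have "c' * (u powr \<alpha> * \<Phi> l) \<le> c * (u powr \<alpha> * \<Phi> l)"
        using c' \<Phi>_pos[OF \<open>0 < l\<close>] by (intro mult_right_mono) auto
      then show ?thesis using above[OF \<open>1 \<le> u\<close> True] by simp
    next
      case l: False
      have \<Phi>l: "\<Phi> l \<le> x1\<^sup>2 * laplace2 \<delta>"
        unfolding \<Phi>_def using l x1 that \<delta> laplace2_antimono[of \<delta> l] laplace2_pos[of \<delta>] laplace2_pos[of l]
        by (intro mult_mono power_mono) auto
      show ?thesis
      proof (cases "u * l \<le> x1")
        case True
        have "u * \<delta> \<le> u * l" using that by (intro mult_left_mono) auto
        then have "u \<le> x1 / \<delta>" using True \<delta> by (simp add: le_divide_eq)
        then have "u powr \<alpha> * \<Phi> l \<le> M"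
          unfolding M_def using \<Phi>l \<Phi>_pos[of l] that \<alpha> by (intro mult_mono powr_mono2) auto
        then have "c' * (u powr \<alpha> * \<Phi> l) \<le> c' * M" using c' by (intro mult_left_mono) auto
        also have "\<dots> \<le> \<delta>\<^sup>2 * laplace2 x1" by (rule c')
        also have "\<dots> \<le> \<Phi> (u * l)"
          unfolding \<Phi>_def
        proof (intro mult_mono power_mono)
          show "\<delta> \<le> u * l" using that mult_mono[of 1 u \<delta> l] \<delta> by simp
          show "laplace2 x1 \<le> laplace2 (u * l)" using that True by (intro laplace2_antimono) auto
        qed (use \<delta> x1 laplace2_pos[of x1] in auto)
        finally show ?thesis by (simp add: mult.assoc)
      next
        case False
        define v where "v = u * l / x1"
        have v: "1 \<le> v" "v * x1 = u * l" using False x1 by (auto simp: v_def)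
        have "u * \<delta> / x1 \<le> v" using that x1 by (simp add: v_def divide_right_mono)
        then have uv: "u powr \<alpha> \<le> (x1 / \<delta>) powr \<alpha> * v powr \<alpha>"
          using that x1 \<delta> \<alpha> v
          by (simp add: powr_mult[symmetric]) (intro powr_mono2, auto simp: field_simps)
        have "c' * (u powr \<alpha> * \<Phi> l) \<le> c' * ((x1 / \<delta>) powr \<alpha> * v powr \<alpha> * (x1\<^sup>2 * laplace2 \<delta>))"
          using uv \<Phi>l c' \<Phi>_pos[of l] that by (intro mult_left_mono mult_mono) auto
        also have "\<dots> = c' * M * v powr \<alpha>" by (simp add: M_def)
        also have "\<dots> \<le> c * \<Phi> x1 * v powr \<alpha>" using c' by (intro mult_right_mono) auto
        also have "\<dots> \<le> \<Phi> (u * l)" using above[OF v(1) x1(1)] v(2) by (simp add: mult_ac)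
        finally show ?thesis by (simp add: mult.assoc)
      qed
    qed
    then show ?thesis using c' by blast
  qed
qed

end

text \<open>
  The value \<open>\<delta> = 0\<close> stands for scaling on the whole half line, and therefore positivity of \<open>l\<close> is
  required separately.
\<close>

locale scaled_levy = monotone_levy +
  fixes \<alpha> c' \<delta> :: real
  assumes \<alpha>: "0 < \<alpha>" and c': "0 < c'" and \<delta>: "0 \<le> \<delta>"
    and lower_scaling: "\<And>l u. 0 < l \<Longrightarrow> \<delta> \<le> l \<Longrightarrow> 1 \<le> u \<Longrightarrow> c' * u powr \<alpha> * \<Phi> l \<le> \<Phi> (u * l)"
begin

lemma \<Phi>_almost_increasing: assumes "0 < l" "\<delta> \<le> l" "l \<le> m" shows "c' * \<Phi> l \<le> \<Phi> m"
proof -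
  have "c' * 1 * \<Phi> l \<le> c' * (m / l) powr \<alpha> * \<Phi> l"
    using assms c' \<alpha> \<Phi>_pos[of l] by (intro mult_right_mono mult_left_mono ge_one_powr_ge_zero) auto
  also have "\<dots> \<le> \<Phi> m" using lower_scaling[of l "m / l"] assms by simp
  finally show ?thesis by simp
qed

text \<open>
  For \<open>1/\<rho> \<le> s \<le> 1/\<delta>\<close> the density at \<open>s\<close> is at most a multiple of \<open>\<Phi>(1/s)/s\<close>, and by scaling this is at most a
  multiple of \<open>\<Phi>(\<rho>) (s \<rho>)\<^sup>-\<^sup>\<alpha> / s\<close>, which is integrable at infinity because \<open>\<alpha> > 0\<close>. The mass beyond \<open>1/\<delta>\<close> is
  a constant, and \<open>\<Phi>\<close> is bounded below on \<open>[\<delta>,\<infinity>)\<close>.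
\<close>

lemma tail_le: "\<exists>C>0. \<forall>\<rho>>0. \<delta> \<le> \<rho> \<longrightarrow> tail (1 / \<rho>) \<le> C * \<Phi> \<rho>"
proof -
  define A where "A = 3 * C0 * exp 1 / (c' * \<alpha>)"
  define B where "B = (if \<delta> > 0 then tail (1 / \<delta>) / (c' * \<Phi> \<delta>) else 0)"
  have A: "0 < A" using C0 c' \<alpha> by (simp add: A_def)
  have B: "0 \<le> B" using c' \<Phi>_pos[of \<delta>]
    by (auto simp: B_def tail_nonneg intro!: divide_nonneg_pos mult_pos_pos)
  have "tail (1 / \<rho>) \<le> (A + B) * \<Phi> \<rho>" if \<rho>: "0 < \<rho>" "\<delta> \<le> \<rho>" for \<rho>
  proof -
    define S where "S = {s. 1 / \<rho> \<le> s \<and> s * \<delta> \<le> 1}"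
    have [measurable]: "S \<in> sets borel" unfolding S_def by measurable
    define K where "K = 3 * C0 * exp 1 * \<Phi> \<rho> * \<rho> powr - \<alpha> / c'"
    have K: "0 \<le> K" using C0 \<Phi>_pos[OF \<rho>(1)] c' by (simp add: K_def)
    have pt: "n s \<le> K * s powr (- 1 - \<alpha>)" if s: "s \<in> S" for s
    proof -
      have s0: "0 < s" "1 \<le> s * \<rho>" "\<delta> \<le> 1 / s"
        using s \<rho> less_le_trans[of 0 "1 / \<rho>" s] by (auto simp: S_def field_simps)
      have "c' * (s * \<rho>) powr \<alpha> * \<Phi> (1 / s) \<le> \<Phi> \<rho>"
        using lower_scaling[of "1 / s" "s * \<rho>"] s0 by simp
      then have "\<Phi> (1 / s) \<le> \<Phi> \<rho> / (c' * (s * \<rho>) powr \<alpha>)"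
        using c' s0 \<rho> by (simp add: le_divide_eq mult_ac)
      then have \<Phi>s: "\<Phi> (1 / s) \<le> \<Phi> \<rho> / c' * (s powr - \<alpha> * \<rho> powr - \<alpha>)"
        using s0 \<rho> by (simp add: powr_mult powr_minus field_simps)
      have "n s \<le> 3 * C0 * (exp 1 * (\<Phi> (1 / s) / s))"
        using density_le_profile[OF s0(1)] mult_left_mono[OF profile_le_\<Phi>[OF s0(1)], of "3 * C0"] C0 by linarith
      also have "\<dots> \<le> 3 * C0 * (exp 1 * (\<Phi> \<rho> / c' * (s powr - \<alpha> * \<rho> powr - \<alpha>) / s))"
        using \<Phi>s C0 s0 by (intro mult_left_mono divide_right_mono) auto
      also have "\<dots> = K * (s powr - \<alpha> * s powr - 1)"
        using s0 by (simp add: K_def powr_minus_divide mult_ac)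
      also have "s powr - \<alpha> * s powr - 1 = s powr (- 1 - \<alpha>)"
        unfolding powr_add[symmetric] by (rule arg_cong[of _ _ "\<lambda>a. s powr a"]) simp
      finally show ?thesis .
    qed
    have "emeasure \<nu> S = (\<integral>\<^sup>+s. ennreal (n s) * indicator {0<..} s * indicator S s \<partial>lborel)"
      by (subst nn_integral_indicator[symmetric], simp, subst nn_integral_\<nu>) auto
    also have "\<dots> \<le> (\<integral>\<^sup>+s. ennreal K * (ennreal (s powr (- 1 - \<alpha>)) * indicator {1 / \<rho>..} s) \<partial>lborel)"
      using pt K by (intro nn_integral_mono)
        (auto simp: S_def ennreal_mult[symmetric] intro!: ennreal_leI split: split_indicator)
    also have "\<dots> = ennreal K * ennreal ((1 / \<rho>) powr - \<alpha> / \<alpha>)"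
      using nn_integral_powr_tail[of "1 / \<rho>" \<alpha>] \<rho> \<alpha> by (simp add: nn_integral_cmult)
    also have "\<dots> = ennreal (A * \<Phi> \<rho>)"
    proof -
      have "\<rho> powr - \<alpha> * (1 / \<rho>) powr - \<alpha> = 1"
        using \<rho> by (simp add: powr_mult[symmetric])
      then have "K * ((1 / \<rho>) powr - \<alpha> / \<alpha>) = A * \<Phi> \<rho>"
        by (simp add: K_def A_def field_simps)
      then show ?thesis using K \<alpha> by (simp add: ennreal_mult[symmetric] del: times_divide_eq_right)
    qed
    finally have S: "emeasure \<nu> S \<le> ennreal (A * \<Phi> \<rho>)" .
    show ?thesis
    proof (cases "\<delta> > 0")
      case True
      have "c' * \<Phi> \<delta> \<le> \<Phi> \<rho>" using \<Phi>_almost_increasing[of \<delta> \<rho>] True \<rho> by simp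
      then have "tail (1 / \<delta>) / (c' * \<Phi> \<delta>) * (c' * \<Phi> \<delta>) \<le> B * \<Phi> \<rho>"
        using B True by (simp only: B_def if_True) (intro mult_left_mono, auto)
      then have tB: "tail (1 / \<delta>) \<le> B * \<Phi> \<rho>" using c' \<Phi>_pos[OF True] by simp
      have "ennreal (tail (1 / \<rho>)) = emeasure \<nu> {1 / \<rho>..}" using \<rho> by (simp add: emeasure_tail)
      also have "\<dots> \<le> emeasure \<nu> (S \<union> {1 / \<delta>..})"
        using True by (intro emeasure_mono) (auto simp: S_def field_simps)
      also have "\<dots> \<le> emeasure \<nu> S + emeasure \<nu> {1 / \<delta>..}" by (intro emeasure_subadditive) auto
      also have "\<dots> \<le> ennreal (A * \<Phi> \<rho>) + ennreal (B * \<Phi> \<rho>)"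
        using S tB True by (intro add_mono) (auto simp: emeasure_tail ennreal_leI)
      also have "\<dots> = ennreal ((A + B) * \<Phi> \<rho>)"
        using A B \<Phi>_pos[OF \<rho>(1)] by (simp add: distrib_right)
      finally show ?thesis using A B \<Phi>_pos[OF \<rho>(1)] by (subst (asm) ennreal_le_iff) auto
    next
      case False
      then have "\<delta> = 0" using \<delta> by simp
      then have "S = {1 / \<rho>..}" by (auto simp: S_def)
      then have "ennreal (tail (1 / \<rho>)) \<le> ennreal (A * \<Phi> \<rho>)" using S \<rho> by (simp add: emeasure_tail)
      then have "tail (1 / \<rho>) \<le> A * \<Phi> \<rho>"
        using A \<Phi>_pos[OF \<rho>(1)] by (subst (asm) ennreal_le_iff) auto
      moreover have "0 \<le> B * \<Phi> \<rho>" using B \<Phi>_pos[OF \<rho>(1)] by simp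
      ultimately show ?thesis by (simp add: distrib_right)
    qed
  qed
  then show ?thesis using A B by (intro exI[of _ "A + B"]) auto
qed

lemma re_psi_le_\<Phi>: "\<exists>C>0. \<forall>\<rho>>0. \<delta> \<le> \<rho> \<longrightarrow> (\<forall>z. \<bar>z\<bar> \<le> \<rho> \<longrightarrow> re_psi z \<le> C * \<Phi> \<rho>)"
proof -
  obtain C where C: "0 < C" "\<And>\<rho>. 0 < \<rho> \<Longrightarrow> \<delta> \<le> \<rho> \<Longrightarrow> tail (1 / \<rho>) \<le> C * \<Phi> \<rho>"
    using tail_le by blast
  have "re_psi z \<le> (2 * C + exp 1 / 2) * \<Phi> \<rho>" if "0 < \<rho>" "\<delta> \<le> \<rho>" "\<bar>z\<bar> \<le> \<rho>" for \<rho> z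
    using re_psi_upper[OF that(1,3)] C(2)[OF that(1,2)] by (simp add: algebra_simps)
  then show ?thesis using C(1) by (intro exI[of _ "2 * C + exp 1 / 2"]) (auto intro!: add_pos_pos)
qed

lemma \<Phi>_at_top: "\<exists>L>0. \<forall>l\<ge>L. s < \<Phi> l"
proof -
  define l0 where "l0 = \<delta> + 1"
  have l0: "0 < l0" "\<delta> \<le> l0" using \<delta> by (auto simp: l0_def)
  define K where "K = c' * \<Phi> l0"
  have K: "0 < K" using c' \<Phi>_pos[OF l0(1)] by (simp add: K_def)
  define u0 where "u0 = max 1 ((\<bar>s\<bar> / K + 1) powr (1 / \<alpha>))"
  have "s < \<Phi> l" if "u0 * l0 \<le> l" for l
  proof -
    define u where "u = l / l0"
    have "u0 \<le> u" using that l0 by (simp add: u_def le_divide_eq)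
    moreover have "1 \<le> u0" by (simp add: u0_def)
    ultimately have u: "u0 \<le> u" "1 \<le> u" by auto
    have "\<bar>s\<bar> / K + 1 = ((\<bar>s\<bar> / K + 1) powr (1 / \<alpha>)) powr \<alpha>"
      using \<alpha> K by (simp add: powr_powr)
    also have "\<dots> \<le> u powr \<alpha>" using u \<alpha> by (intro powr_mono2) (auto simp: u0_def)
    finally have "(\<bar>s\<bar> / K + 1) * K \<le> u powr \<alpha> * K" using K by (intro mult_right_mono) auto
    then have "\<bar>s\<bar> + K \<le> u powr \<alpha> * K" using K by (simp add: distrib_right)
    also have "\<dots> \<le> \<Phi> l"
      using lower_scaling[OF l0 u(2)] l0 by (simp add: K_def u_def mult_ac)
    finally show ?thesis using K by linarith
  qed
  moreover have "0 < u0 * l0" using l0 by (simp add: u0_def less_max_iff_disj)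
  ultimately show ?thesis by blast
qed

text \<open>
  For \<open>\<bar>\<xi>\<bar> \<ge> \<rho>\<close> scaling gives \<open>t * re_psi \<xi> \<ge> \<kappa> * \<bar>\<xi> / \<rho>\<bar> powr \<alpha>\<close>; the factor \<open>exp \<kappa>\<close> extends
  the resulting bound to \<open>\<bar>\<xi>\<bar> < \<rho>\<close>.
\<close>

lemma exp_re_psi_bound:
  assumes k: "0 < k"
  shows "\<exists>B>0. \<forall>t \<rho>. 0 < t \<longrightarrow> 0 < \<rho> \<longrightarrow> \<delta> \<le> \<rho> \<longrightarrow> k \<le> t * \<Phi> \<rho> \<longrightarrow>
           (\<forall>\<xi>. (1 + \<bar>\<xi> / \<rho>\<bar> ^ 3) * exp (- (t * re_psi \<xi>)) \<le> B / (1 + (\<xi> / \<rho>)\<^sup>2))"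
proof -
  define \<kappa> where "\<kappa> = c_psi * c' * k"
  have \<kappa>: "0 < \<kappa>" using c_psi c' k by (simp add: \<kappa>_def)
  obtain B where B: "0 < B" "\<And>u::real. (1 + \<bar>u\<bar> ^ 3) * exp (- (\<kappa> * \<bar>u\<bar> powr \<alpha>)) \<le> B / (1 + u\<^sup>2)"
    using stretched_exponential_bound[OF \<alpha> \<kappa>] by blast
  have "(1 + \<bar>\<xi> / \<rho>\<bar> ^ 3) * exp (- (t * re_psi \<xi>)) \<le> (exp \<kappa> * B) / (1 + (\<xi> / \<rho>)\<^sup>2)"
    if t: "0 < t" and \<rho>: "0 < \<rho>" "\<delta> \<le> \<rho>" and tk: "k \<le> t * \<Phi> \<rho>" for t \<rho> \<xi>
  proof -
    define u where "u = \<xi> / \<rho>"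
    have "\<kappa> * \<bar>u\<bar> powr \<alpha> - \<kappa> \<le> t * re_psi \<xi>"
    proof (cases "\<bar>u\<bar> \<le> 1")
      case True
      then have "\<bar>u\<bar> powr \<alpha> \<le> 1" using \<alpha> by (intro powr_le1) auto
      then have "\<kappa> * \<bar>u\<bar> powr \<alpha> \<le> \<kappa> * 1" using \<kappa> by (intro mult_left_mono) auto
      moreover have "0 \<le> t * re_psi \<xi>" using t re_psi_nonneg by simp
      ultimately show ?thesis by linarith
    next
      case False
      then have \<xi>: "\<xi> \<noteq> 0" "\<bar>u\<bar> * \<rho> = \<bar>\<xi>\<bar>" using \<rho> by (auto simp: u_def)
      have "\<kappa> * \<bar>u\<bar> powr \<alpha> = c_psi * (c' * \<bar>u\<bar> powr \<alpha> * k)" by (simp add: \<kappa>_def)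
      also have "\<dots> \<le> c_psi * (c' * \<bar>u\<bar> powr \<alpha> * (t * \<Phi> \<rho>))"
        using tk c_psi c' by (intro mult_left_mono) auto
      also have "\<dots> = t * c_psi * (c' * \<bar>u\<bar> powr \<alpha> * \<Phi> \<rho>)" by simp
      also have "\<dots> \<le> t * c_psi * \<Phi> (\<bar>u\<bar> * \<rho>)"
        using lower_scaling[OF \<rho>, of "\<bar>u\<bar>"] False t c_psi by (intro mult_left_mono) auto
      also have "\<dots> \<le> t * re_psi \<xi>" using re_psi_lower[OF \<xi>(1)] \<xi>(2) t by (simp add: mult.assoc)
      finally show ?thesis using \<kappa> by linarith
    qed
    then have "exp (- (t * re_psi \<xi>)) \<le> exp \<kappa> * exp (- (\<kappa> * \<bar>u\<bar> powr \<alpha>))"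
      by (simp add: exp_add[symmetric])
    then have "(1 + \<bar>u\<bar> ^ 3) * exp (- (t * re_psi \<xi>)) \<le> (1 + \<bar>u\<bar> ^ 3) * (exp \<kappa> * exp (- (\<kappa> * \<bar>u\<bar> powr \<alpha>)))"
      by (intro mult_left_mono) auto
    also have "\<dots> \<le> exp \<kappa> * (B / (1 + u\<^sup>2))" using mult_left_mono[OF B(2)[of u], of "exp \<kappa>"] by (simp add: mult.left_commute)
    finally show ?thesis by (simp add: u_def)
  qed
  then show ?thesis using B by (intro exI[of _ "exp \<kappa> * B"]) auto
qed

end

section \<open>The Laplace exponent\<close>

lemma exp_remainder_bound: "\<bar>exp v - 1 - v\<bar> \<le> v\<^sup>2 * exp \<bar>v\<bar>" for v :: real
proof -
  have "1 - v \<le> exp (- v)" using exp_ge_add_one_self[of "-v"] by simp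
  then have "(1 - v) * exp v \<le> exp (- v) * exp v" by (intro mult_right_mono) auto
  then have e: "exp v - 1 \<le> v * exp v" by (simp add: exp_minus algebra_simps)
  have "exp v - 1 - v \<le> v * (exp v - 1)" using e by (simp add: algebra_simps)
  also have "\<dots> \<le> v\<^sup>2 * exp \<bar>v\<bar>"
  proof (cases "0 \<le> v")
    case True
    then show ?thesis using e mult_left_mono[OF e, of v] by (simp add: power2_eq_square mult.assoc)
  next
    case False
    have "v * (exp v - 1) = (- v) * (1 - exp v)" by (simp add: algebra_simps)
    also have "\<dots> \<le> (- v) * (- v)"
    proof (rule mult_left_mono)
      show "1 - exp v \<le> - v" using exp_ge_add_one_self[of v] by linarith
    qed (use False in simp)
    also have "\<dots> \<le> v\<^sup>2 * exp \<bar>v\<bar>" using mult_left_mono[of 1 "exp \<bar>v\<bar>" "v\<^sup>2"] by (simp add: power2_eq_square)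
    finally show ?thesis .
  qed
  finally show ?thesis using exp_ge_add_one_self[of v] by linarith
qed

context monotone_levy
begin

lemma set_integral_\<nu>:
  fixes h :: "real \<Rightarrow> 'b::{banach,second_countable_topology}"
  assumes [measurable]: "h \<in> borel_measurable borel"
  shows "(LINT y:{0<..}|\<nu>. h y) = (\<integral>y. h y \<partial>\<nu>)"
  unfolding set_lebesgue_integral_def
  by (rule integral_cong_AE) (use AE_pos in \<open>auto elim!: eventually_mono\<close>)

lemma exp_taylor_remainder:
  fixes l h y :: real
  assumes l: "0 < l" and h: "\<bar>h\<bar> < l / 2" and y: "0 < y"
  shows "\<bar>exp (- ((l + h) * y)) - exp (- (l * y)) + h * y * exp (- (l * y))\<bar> \<le> h\<^sup>2 * (y\<^sup>2 * exp (- (l / 2 * y)))"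
proof -
  have "exp (- ((l + h) * y)) - exp (- (l * y)) + h * y * exp (- (l * y))
      = exp (- (l * y)) * (exp (- (h * y)) - 1 - (- (h * y)))"
    by (simp add: algebra_simps exp_diff exp_minus exp_add divide_inverse)
  then have "\<bar>exp (- ((l + h) * y)) - exp (- (l * y)) + h * y * exp (- (l * y))\<bar>
      = exp (- (l * y)) * \<bar>exp (- (h * y)) - 1 - (- (h * y))\<bar>"
    by (simp add: abs_mult)
  also have "\<dots> \<le> exp (- (l * y)) * ((- (h * y))\<^sup>2 * exp \<bar>- (h * y)\<bar>)"
    by (intro mult_left_mono exp_remainder_bound) auto
  also have "\<dots> = h\<^sup>2 * (y\<^sup>2 * (exp (- (l * y)) * exp (\<bar>h\<bar> * y)))"
    using y by (simp add: power_mult_distrib abs_mult mult_ac)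
  also have "exp (- (l * y)) * exp (\<bar>h\<bar> * y) = exp (- (l * y) + \<bar>h\<bar> * y)" by (rule exp_add[symmetric])
  also have "h\<^sup>2 * (y\<^sup>2 * exp (- (l * y) + \<bar>h\<bar> * y)) \<le> h\<^sup>2 * (y\<^sup>2 * exp (- (l / 2 * y)))"
  proof (intro mult_left_mono)
    have "\<bar>h\<bar> * y \<le> l / 2 * y" using h y by (intro mult_right_mono) auto
    then show "exp (- (l * y) + \<bar>h\<bar> * y) \<le> exp (- (l / 2 * y))" by simp
  qed auto
  finally show ?thesis .
qed

text \<open>
  The integrand of the Laplace exponent and its derivative in \<open>l\<close>.
\<close>

definition phi_kernel :: "real \<Rightarrow> real \<Rightarrow> real" where "phi_kernel l y = exp (- (l * y)) - 1 + l * y * indicator {..<1} y"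
definition phi_kernel1 :: "real \<Rightarrow> real \<Rightarrow> real" where "phi_kernel1 l y = - y * exp (- (l * y)) + y * indicator {..<1} y"

lemma phi_kernel_measurable [measurable]: "phi_kernel l \<in> borel_measurable borel" "phi_kernel1 l \<in> borel_measurable borel"
  unfolding phi_kernel_def phi_kernel1_def by measurable

lemma phi_kernel_bound: assumes "0 \<le> l" "0 < y" shows "\<bar>phi_kernel l y\<bar> \<le> (1 + l\<^sup>2 * exp l) * min 1 (y\<^sup>2)"
proof (cases "y < 1")
  case True
  have "\<bar>phi_kernel l y\<bar> \<le> (- (l * y))\<^sup>2 * exp \<bar>- (l * y)\<bar>"
    using exp_remainder_bound[of "- (l * y)"] True by (simp add: phi_kernel_def)
  also have "\<dots> \<le> (l\<^sup>2 * y\<^sup>2) * exp l"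
    using assms True mult_left_mono[of y 1 l] by (intro mult_mono) (auto simp: power_mult_distrib abs_mult)
  also have "\<dots> \<le> (1 + l\<^sup>2 * exp l) * y\<^sup>2" by (simp add: algebra_simps)
  finally show ?thesis using True assms by (simp add: min_absorb2 power_le_one)
next
  case False
  have "exp (- (l * y)) \<le> 1" using assms by simp
  then have "\<bar>phi_kernel l y\<bar> \<le> 1" using False by (simp add: phi_kernel_def)
  also have "\<dots> \<le> (1 + l\<^sup>2 * exp l) * 1" by simp
  finally show ?thesis using False one_le_power[of y 2] by (simp add: min_def)
qed

lemma integrable_phi_kernel: "0 \<le> l \<Longrightarrow> integrable \<nu> (phi_kernel l)"
  using phi_kernel_bound by (intro integrable_\<nu>I[where K = "1 + l\<^sup>2 * exp l"]) auto

lemma integrable_phi_kernel1: assumes l: "0 < l" shows "integrable \<nu> (phi_kernel1 l)"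
proof (rule integrable_\<nu>I[where K = "l + 1 / l"])
  fix y :: real assume y: "0 < y"
  have e: "1 - l * y \<le> exp (- (l * y))" using exp_ge_add_one_self[of "- (l * y)"] by simp
  show "norm (phi_kernel1 l y) \<le> (l + 1 / l) * min 1 (y\<^sup>2)"
  proof (cases "y < 1")
    case True
    have "norm (phi_kernel1 l y) = y * (1 - exp (- (l * y)))"
      using True y l by (simp add: phi_kernel1_def algebra_simps abs_if mult_le_cancel_left1 not_less)
    also have "\<dots> \<le> y * (l * y)" using e y by (intro mult_left_mono) auto
    also have "\<dots> \<le> (l + 1 / l) * y\<^sup>2" using l by (simp add: algebra_simps power2_eq_square)
    finally show ?thesis using True y by (simp add: min_absorb2 power_le_one)
  next
    case False
    have "1 + l * y \<le> exp (l * y)" by (rule exp_ge_add_one_self)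
    then have "l * y \<le> exp (l * y)" by linarith
    then have "l * y * exp (- (l * y)) \<le> 1" by (simp add: exp_minus field_simps)
    then have "y * exp (- (l * y)) \<le> 1 / l" using l by (simp add: field_simps)
    also have "\<dots> \<le> (l + 1 / l) * 1" using l by simp
    finally show ?thesis using False y one_le_power[of y 2] by (simp add: phi_kernel1_def min_def)
  qed
qed measurable

definition phi_deriv :: "real \<Rightarrow> real \<Rightarrow> real" where "phi_deriv b l = - b + (\<integral>y. phi_kernel1 l y \<partial>\<nu>)"

lemma levy_phi_eq: "levy_phi 0 b \<nu> l = - b * l + (\<integral>y. phi_kernel l y \<partial>\<nu>)"
proof -
  have "(LINT x:{0<..}|\<nu>. phi_kernel l x) = (\<integral>y. phi_kernel l y \<partial>\<nu>)" by (rule set_integral_\<nu>) measurable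
  then show ?thesis by (simp add: levy_phi_def phi_kernel_def)
qed

lemma levy_phi_deriv: assumes l: "0 < l" shows "(levy_phi 0 b \<nu> has_real_derivative phi_deriv b l) (at l)"
proof -
  have "((\<lambda>z. \<integral>y. phi_kernel z y \<partial>\<nu>) has_vector_derivative (\<integral>y. phi_kernel1 l y \<partial>\<nu>)) (at l)"
  proof (rule has_vector_derivative_integral[where d = "l / 2" and w = "\<lambda>y. y\<^sup>2 * exp (- (l / 2 * y))"])
    fix h :: real assume h: "\<bar>h\<bar> < l / 2"
    show "AE y in \<nu>. norm (phi_kernel (l + h) y - phi_kernel l y - h *\<^sub>R phi_kernel1 l y) \<le> h\<^sup>2 * (y\<^sup>2 * exp (- (l / 2 * y)))"
      using AE_pos
    proof eventually_elim
      case (elim y)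
      have "phi_kernel (l + h) y - phi_kernel l y - h *\<^sub>R phi_kernel1 l y
          = exp (- ((l + h) * y)) - exp (- (l * y)) + h * y * exp (- (l * y))"
        by (simp add: phi_kernel_def phi_kernel1_def algebra_simps)
      then show ?case using exp_taylor_remainder[OF l h elim] by simp
    qed
    show "integrable \<nu> (phi_kernel z)" if "\<bar>z - l\<bar> < l / 2" for z
      by (rule integrable_phi_kernel) (use that l in linarith)
  qed (use l integrable_laplace2[of "l / 2"] in \<open>auto intro!: integrable_phi_kernel1\<close>)
  then have "((\<lambda>z. \<integral>y. phi_kernel z y \<partial>\<nu>) has_real_derivative (\<integral>y. phi_kernel1 l y \<partial>\<nu>)) (at l)"
    by (simp add: has_real_derivative_iff_has_vector_derivative)
  then have "((\<lambda>z. - b * z + (\<integral>y. phi_kernel z y \<partial>\<nu>)) has_real_derivative phi_deriv b l) (at l)"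
    by (auto intro!: derivative_eq_intros simp: phi_deriv_def)
  then show ?thesis by (simp only: levy_phi_eq[abs_def])
qed

lemma phi_deriv_deriv: assumes l: "0 < l" shows "(phi_deriv b has_real_derivative laplace2 l) (at l)"
proof -
  have "((\<lambda>z. \<integral>y. phi_kernel1 z y \<partial>\<nu>) has_vector_derivative (\<integral>y. y\<^sup>2 * exp (- (l * y)) \<partial>\<nu>)) (at l)"
  proof (rule has_vector_derivative_integral[where d = "l / 2" and w = "\<lambda>y. 4 / l * (y\<^sup>2 * exp (- (l / 4 * y)))"])
    fix h :: real assume h: "\<bar>h\<bar> < l / 2"
    show "AE y in \<nu>. norm (phi_kernel1 (l + h) y - phi_kernel1 l y - h *\<^sub>R (y\<^sup>2 * exp (- (l * y)))) \<le> h\<^sup>2 * (4 / l * (y\<^sup>2 * exp (- (l / 4 * y))))"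
      using AE_pos
    proof eventually_elim
      case (elim y)
      have "phi_kernel1 (l + h) y - phi_kernel1 l y - h *\<^sub>R (y\<^sup>2 * exp (- (l * y)))
          = - y * (exp (- ((l + h) * y)) - exp (- (l * y)) + h * y * exp (- (l * y)))"
        by (simp add: phi_kernel1_def algebra_simps power2_eq_square)
      then have "norm (phi_kernel1 (l + h) y - phi_kernel1 l y - h *\<^sub>R (y\<^sup>2 * exp (- (l * y))))
          = y * \<bar>exp (- ((l + h) * y)) - exp (- (l * y)) + h * y * exp (- (l * y))\<bar>"
        using elim by (simp add: abs_mult)
      also have "\<dots> \<le> y * (h\<^sup>2 * (y\<^sup>2 * exp (- (l / 2 * y))))"
        using exp_taylor_remainder[OF l h elim] elim by (intro mult_left_mono) auto
      also have "\<dots> = h\<^sup>2 * ((y * exp (- (l / 4 * y))) * (y\<^sup>2 * exp (- (l / 4 * y))))"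
        by (simp add: mult_ac exp_add[symmetric])
      also have "\<dots> \<le> h\<^sup>2 * (4 / l * (y\<^sup>2 * exp (- (l / 4 * y))))"
      proof (intro mult_left_mono mult_right_mono)
        have "1 + l / 4 * y \<le> exp (l / 4 * y)" by (rule exp_ge_add_one_self)
        then have "l / 4 * y * exp (- (l / 4 * y)) \<le> 1" by (simp add: exp_minus field_simps)
        then show "y * exp (- (l / 4 * y)) \<le> 4 / l" using l by (simp add: field_simps)
      qed auto
      finally show ?case .
    qed
    show "integrable \<nu> (phi_kernel1 z)" if "\<bar>z - l\<bar> < l / 2" for z
      by (rule integrable_phi_kernel1) (use that l in linarith)
  qed (use l integrable_laplace2[of "l / 4"] in \<open>auto intro!: integrable_laplace2\<close>)
  then have "((\<lambda>z. \<integral>y. phi_kernel1 z y \<partial>\<nu>) has_real_derivative laplace2 l) (at l)"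
    by (simp add: has_real_derivative_iff_has_vector_derivative laplace2_def)
  then have "((\<lambda>z. - b + (\<integral>y. phi_kernel1 z y \<partial>\<nu>)) has_real_derivative laplace2 l) (at l)"
    by (auto intro!: derivative_eq_intros)
  then show ?thesis by (simp only: phi_deriv_def[abs_def])
qed

lemma deriv_levy_phi: "0 < l \<Longrightarrow> deriv (levy_phi 0 b \<nu>) l = phi_deriv b l"
  by (rule DERIV_imp_deriv[OF levy_phi_deriv])

lemma deriv2_levy_phi: assumes l: "0 < l" shows "deriv (deriv (levy_phi 0 b \<nu>)) l = laplace2 l"
proof (rule DERIV_imp_deriv)
  show "(deriv (levy_phi 0 b \<nu>) has_real_derivative laplace2 l) (at l)"
    by (rule DERIV_cong_ev[THEN iffD1, OF refl _ refl phi_deriv_deriv[OF l, of b]])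
       (use l in \<open>auto simp: deriv_levy_phi eventually_nhds intro!: exI[of _ "{0<..}"]\<close>)
qed

lemma Phi_levy_phi: "0 \<le> l \<Longrightarrow> Phi (levy_phi 0 b \<nu>) l = \<Phi> l"
  by (cases "l = 0") (auto simp: Phi_def \<Phi>_def deriv2_levy_phi)

text \<open>
  If \<open>\<phi>'(l) \<le> 0\<close> then \<open>- \<phi>(l) \<ge> l \<phi>'(l) - \<phi>(l)\<close>, and the integrand of the right-hand side is
  \<open>1 - (1 + l y) exp (- l y)\<close>, which is at least \<open>(l y)\<^sup>2 exp (- l y) / 2\<close>.
\<close>

lemma levy_phi_le_if_deriv_nonpos:
  assumes l: "0 < l" and d: "phi_deriv b l \<le> 0"
  shows "\<Phi> l \<le> - 2 * levy_phi 0 b \<nu> l"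
proof -
  have "(\<integral>y. l\<^sup>2 / 2 * (y\<^sup>2 * exp (- (l * y))) \<partial>\<nu>) \<le> (\<integral>y. l * phi_kernel1 l y - phi_kernel l y \<partial>\<nu>)"
  proof (rule integral_mono_AE)
    show "AE y in \<nu>. l\<^sup>2 / 2 * (y\<^sup>2 * exp (- (l * y))) \<le> l * phi_kernel1 l y - phi_kernel l y"
      using AE_pos
    proof eventually_elim
      case (elim y)
      have "1 + l * y + (l * y)\<^sup>2 / 2 \<le> exp (l * y)" using l elim by (intro exp_ge_quadratic) auto
      then have "(1 + l * y + (l * y)\<^sup>2 / 2) * exp (- (l * y)) \<le> exp (l * y) * exp (- (l * y))"
        by (rule mult_right_mono) auto
      then have "(1 + l * y + (l * y)\<^sup>2 / 2) * exp (- (l * y)) \<le> 1" by (simp add: exp_minus)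
      then show ?case by (simp add: phi_kernel_def phi_kernel1_def algebra_simps power_mult_distrib)
    qed
  qed (use l integrable_laplace2[OF l] integrable_phi_kernel[of l] integrable_phi_kernel1[OF l] in auto)
  then have "l\<^sup>2 / 2 * laplace2 l \<le> l * (\<integral>y. phi_kernel1 l y \<partial>\<nu>) - (\<integral>y. phi_kernel l y \<partial>\<nu>)"
    using l integrable_phi_kernel[of l] integrable_phi_kernel1[OF l] by (simp add: laplace2_def)
  also have "\<dots> = l * phi_deriv b l - levy_phi 0 b \<nu> l" by (simp add: phi_deriv_def levy_phi_eq algebra_simps)
  also have "\<dots> \<le> - levy_phi 0 b \<nu> l" using l d by (simp add: mult_nonneg_nonpos)
  finally show ?thesis by (simp add: \<Phi>_def)
qed

lemma levy_phi_tendsto_zero: "(levy_phi 0 b \<nu> \<longlongrightarrow> 0) (at_right 0)"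
proof -
  have "((\<lambda>l. \<integral>y. phi_kernel l y \<partial>\<nu>) \<longlongrightarrow> (\<integral>y. 0 \<partial>\<nu>)) (at_right 0)"
  proof (rule tendsto_at_right_sequentially[where b = 1])
    fix S :: "nat \<Rightarrow> real" assume S: "\<And>m. 0 < S m" "\<And>m. S m < 1" "S \<longlonglongrightarrow> 0"
    show "(\<lambda>m. \<integral>y. phi_kernel (S m) y \<partial>\<nu>) \<longlonglongrightarrow> (\<integral>y. 0 \<partial>\<nu>)"
    proof (rule integral_dominated_convergence[where w = "\<lambda>y. (1 + exp 1) * min 1 (y\<^sup>2)"])
      show "integrable \<nu> (\<lambda>y. (1 + exp 1) * min 1 (y\<^sup>2))" using integrable_min by simp
      show "AE y in \<nu>. (\<lambda>m. phi_kernel (S m) y) \<longlonglongrightarrow> 0"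
      proof (rule AE_I2)
        fix y :: real
        have "(\<lambda>m. exp (- (S m * y)) - 1 + S m * y * indicator {..<1} y) \<longlonglongrightarrow> exp (- (0 * y)) - 1 + 0 * y * indicator {..<1} y"
          using S(3) by (intro tendsto_intros)
        then show "(\<lambda>m. phi_kernel (S m) y) \<longlonglongrightarrow> 0" by (simp add: phi_kernel_def)
      qed
      show "AE y in \<nu>. norm (phi_kernel (S m) y) \<le> (1 + exp 1) * min 1 (y\<^sup>2)" for m
        using AE_pos
      proof eventually_elim
        case (elim y)
        have "\<bar>phi_kernel (S m) y\<bar> \<le> (1 + (S m)\<^sup>2 * exp (S m)) * min 1 (y\<^sup>2)"
          using phi_kernel_bound[of "S m" y] S(1)[of m] elim by simp
        also have "\<dots> \<le> (1 + 1 * exp 1) * min 1 (y\<^sup>2)"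
          using S(1,2)[of m] by (intro mult_right_mono add_mono mult_mono) (auto simp: power_le_one)
        finally show ?case by simp
      qed
    qed measurable
  qed auto
  then have "((\<lambda>l. - b * l + (\<integral>y. phi_kernel l y \<partial>\<nu>)) \<longlongrightarrow> - b * 0 + 0) (at_right 0)"
    by (intro tendsto_intros) simp_all
  then show ?thesis by (simp add: levy_phi_eq[abs_def])
qed

text \<open>
  Taylor's formula at a point \<open>s\<close> that tends to \<open>0\<close>, where \<open>\<phi>\<close> vanishes: the linear term is
  nonnegative, and \<open>\<phi>''\<close> is decreasing.
\<close>

lemma levy_phi_ge_if_deriv_pos:
  assumes l: "0 < l" and d: "\<And>s. 0 < s \<Longrightarrow> 0 < phi_deriv b s"
  shows "\<Phi> l \<le> 2 * levy_phi 0 b \<nu> l"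
proof -
  have ev: "\<forall>\<^sub>F s in at_right 0. levy_phi 0 b \<nu> s + (l - s)\<^sup>2 / 2 * laplace2 l \<le> levy_phi 0 b \<nu> l"
  proof (rule eventually_mono[OF eventually_at_right_real[OF l]])
    fix s assume "s \<in> {0<..<l}"
    then have s: "0 < s \<and> s < l" by simp
    \<comment> \<open>the family of derivatives that Taylor's theorem expects\<close>
    define D where "D m = (if m = 0 then levy_phi 0 b \<nu> else if m = Suc 0 then phi_deriv b else laplace2)" for m :: nat
    have "\<exists>t. s < t \<and> t < l \<and> levy_phi 0 b \<nu> l = (\<Sum>m<2. D m s / fact m * (l - s) ^ m) + D 2 t / fact 2 * (l - s) ^ 2"
    proof (rule Taylor_up[where a = s and b = l])
      show "\<forall>m t. m < 2 \<and> s \<le> t \<and> t \<le> l \<longrightarrow> (D m has_real_derivative D (Suc m) t) (at t)"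
        using s by (auto simp: D_def less_2_cases_iff intro!: levy_phi_deriv phi_deriv_deriv)
    qed (use s in \<open>auto simp: D_def\<close>)
    then obtain t where t: "s < t" "t < l"
      "levy_phi 0 b \<nu> l = levy_phi 0 b \<nu> s + phi_deriv b s * (l - s) + laplace2 t / 2 * (l - s)\<^sup>2"
      by (auto simp: D_def numeral_2_eq_2)
    have "0 \<le> phi_deriv b s * (l - s)" using d[of s] s by simp
    moreover have "laplace2 l / 2 * (l - s)\<^sup>2 \<le> laplace2 t / 2 * (l - s)\<^sup>2"
      using laplace2_antimono[of t l] t s by (intro mult_right_mono) auto
    ultimately show "levy_phi 0 b \<nu> s + (l - s)\<^sup>2 / 2 * laplace2 l \<le> levy_phi 0 b \<nu> l"
      using t(3) by (simp add: mult.commute)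
  qed
  have "((\<lambda>s. levy_phi 0 b \<nu> s + (l - s)\<^sup>2 / 2 * laplace2 l) \<longlongrightarrow> 0 + (l - 0)\<^sup>2 / 2 * laplace2 l) (at_right 0)"
    by (intro tendsto_intros levy_phi_tendsto_zero) auto
  from tendsto_upperbound[OF this ev] show ?thesis by (simp add: \<Phi>_def)
qed

text \<open>
  Either \<open>\<phi>'(l) \<le> 0\<close>, or \<open>l \<ge> \<theta>\<^sub>1\<close> with \<open>\<phi>'(l) > 0\<close>. In the second case \<open>\<theta>\<^sub>1 > 0\<close> would force \<open>l = x0 = \<theta>\<^sub>1\<close>,
  while continuity of \<open>\<phi>'\<close> puts points below \<open>l\<close> into the set whose infimum is \<open>\<theta>\<^sub>1\<close>. Hence \<open>\<theta>\<^sub>1 = 0\<close> and, \<open>\<phi>'\<close> being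
  increasing, \<open>\<phi>' > 0\<close> throughout.
\<close>

lemma \<Phi>_le_levy_phi:
  assumes l: "0 < l" "l \<le> x0" and th: "0 < theta1 (levy_phi 0 b \<nu>) \<Longrightarrow> x0 \<le> theta1 (levy_phi 0 b \<nu>)"
  shows "\<Phi> l \<le> 2 * \<bar>levy_phi 0 b \<nu> l\<bar>"
proof (cases "phi_deriv b l \<le> 0")
  case True
  then show ?thesis using levy_phi_le_if_deriv_nonpos[OF l(1) True] by linarith
next
  case False
  define T where "T = {s. 0 < s \<and> 0 < deriv (levy_phi 0 b \<nu>) s}"
  have lT: "l \<in> T" using False l by (simp add: T_def deriv_levy_phi)
  have bdd: "bdd_below T" by (rule bdd_belowI[of _ 0]) (auto simp: T_def)
  have th_eq: "theta1 (levy_phi 0 b \<nu>) = Inf T" by (simp add: theta1_def T_def)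
  have below: "\<exists>s\<in>T. s < z" if z: "0 < z" for z
  proof (rule ccontr)
    assume none: "\<not> (\<exists>s\<in>T. s < z)"
    then have "z \<le> Inf T" using lT by (intro cInf_greatest) auto
    then have "0 < theta1 (levy_phi 0 b \<nu>)" using z th_eq by simp
    then have x0: "l \<le> Inf T" using th th_eq l by simp
    have "isCont (phi_deriv b) l" using phi_deriv_deriv[OF l(1)] by (rule DERIV_isCont)
    then obtain d where d: "0 < d" "\<And>y. \<bar>y - l\<bar> < d \<Longrightarrow> \<bar>phi_deriv b y - phi_deriv b l\<bar> < phi_deriv b l"
      using False unfolding continuous_at_eps_delta dist_real_def by (metis not_le)
    define h where "h = min d l / 2"
    have h: "0 < h" "h < d" "h < l" using d(1) l by (auto simp: h_def min_def)
    then have "0 < phi_deriv b (l - h)" using d(2)[of "l - h"] by simp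
    then have "l - h \<in> T" using h by (simp add: T_def deriv_levy_phi)
    then have "Inf T \<le> l - h" using bdd by (rule cInf_lower)
    then show False using x0 h by simp
  qed
  have "0 < phi_deriv b s" if s: "0 < s" for s
  proof -
    obtain z where z: "z \<in> T" "z < s" using below[OF s] by blast
    then have z': "0 < z" "0 < phi_deriv b z" by (auto simp: T_def deriv_levy_phi)
    have "phi_deriv b z \<le> phi_deriv b s"
    proof (rule DERIV_nonneg_imp_nondecreasing[where f = "phi_deriv b"])
      fix x assume "z \<le> x" "x \<le> s"
      then show "\<exists>y. (phi_deriv b has_real_derivative y) (at x) \<and> 0 \<le> y"
        using z' phi_deriv_deriv[of x b] laplace2_pos[of x] by (intro exI[of _ "laplace2 x"]) auto
    qed (use z in simp)
    then show ?thesis using z' by simp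
  qed
  from levy_phi_ge_if_deriv_pos[OF l(1) this] show ?thesis by linarith
qed

end

section \<open>Small jumps\<close>

text \<open>
  Three integrations by parts for \<open>exp q\<close>. The bounds on the derivatives of \<open>q\<close> scale like powers of the
  length \<open>r\<close>, so each derivative of \<open>exp q\<close> costs a factor \<open>r\<close> and at most a cubic polynomial in \<open>\<bar>\<xi> * r\<bar>\<close>. Three
  derivatives are what matches the cube in the profile \<open>U(x)/x\<^sup>3\<close>.
\<close>

lemma fourier_int_exp_decay:
  fixes q q1 q2 q3 :: "real \<Rightarrow> complex"
  assumes r: "0 < r" and a: "0 \<le> a"
    and q: "\<And>\<xi>. (q has_vector_derivative q1 \<xi>) (at \<xi>)"
    and q1: "\<And>\<xi>. (q1 has_vector_derivative q2 \<xi>) (at \<xi>)"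
    and q2: "\<And>\<xi>. (q2 has_vector_derivative q3 \<xi>) (at \<xi>)" and q3: "continuous_on UNIV q3"
    and b1: "\<And>\<xi>. norm (q1 \<xi>) \<le> a * r\<^sup>2 * \<bar>\<xi>\<bar>" and b2: "\<And>\<xi>. norm (q2 \<xi>) \<le> a * r\<^sup>2"
    and b3: "\<And>\<xi>. norm (q3 \<xi>) \<le> a * r ^ 3"
    and f: "\<And>\<xi>. (1 + \<bar>\<xi> * r\<bar> ^ 3) * norm (exp (q \<xi>)) \<le> B / (1 + (\<xi> * r)\<^sup>2)"
  shows "integrable lborel (\<lambda>\<xi>. exp (q \<xi>))"
    and "norm (fourier_int (\<lambda>\<xi>. exp (q \<xi>)) x) \<le> B * pi / r"
    and "\<bar>x\<bar> ^ 3 * norm (fourier_int (\<lambda>\<xi>. exp (q \<xi>)) x) \<le> (a + 3 * a\<^sup>2 + a ^ 3) * B * pi * r\<^sup>2"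
proof -
  define f0 where "f0 \<xi> = exp (q \<xi>)" for \<xi>
  define f1 where "f1 \<xi> = q1 \<xi> * f0 \<xi>" for \<xi>
  define f2 where "f2 \<xi> = (q2 \<xi> + q1 \<xi> ^ 2) * f0 \<xi>" for \<xi>
  define f3 where "f3 \<xi> = (q3 \<xi> + 3 * q1 \<xi> * q2 \<xi> + q1 \<xi> ^ 3) * f0 \<xi>" for \<xi>
  have d0: "(f0 has_vector_derivative f1 \<xi>) (at \<xi>)" for \<xi>
    using field_vector_diff_chain_at[OF q[of \<xi>] DERIV_exp] by (simp add: f0_def[abs_def] f1_def o_def mult.commute)
  have d1: "(f1 has_vector_derivative f2 \<xi>) (at \<xi>)" for \<xi>
    using has_vector_derivative_mult[OF q1[of \<xi>] d0[of \<xi>]]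
    by (simp add: f1_def[abs_def] f2_def f0_def algebra_simps power2_eq_square)
  have d2: "(f2 has_vector_derivative f3 \<xi>) (at \<xi>)" for \<xi>
  proof -
    have "((\<lambda>\<xi>. q2 \<xi> + q1 \<xi> * q1 \<xi>) has_vector_derivative (q3 \<xi> + (q1 \<xi> * q2 \<xi> + q2 \<xi> * q1 \<xi>))) (at \<xi>)"
      by (intro has_vector_derivative_add has_vector_derivative_mult q2 q1)
    from has_vector_derivative_mult[OF this d0[of \<xi>]] show ?thesis
      by (simp add: f2_def[abs_def] f3_def f1_def power2_eq_square power3_eq_cube algebra_simps)
  qed
  have c: "continuous_on UNIV q1" "continuous_on UNIV q2" "continuous_on UNIV f0" "continuous_on UNIV f1" "continuous_on UNIV f2"
    using q1 q2 d0 d1 d2 by (auto intro!: continuous_at_imp_continuous_on has_vector_derivative_continuous)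
  have c3: "continuous_on UNIV f3" unfolding f3_def by (intro continuous_intros c q3)
  have bd: "norm (h \<xi> * f0 \<xi>) \<le> K * B / (1 + (\<xi> * r)\<^sup>2)"
    if h: "norm (h \<xi>) \<le> K * (1 + \<bar>\<xi> * r\<bar> ^ 3)" and K: "0 \<le> K" for h :: "real \<Rightarrow> complex" and K \<xi>
  proof -
    have "norm (h \<xi> * f0 \<xi>) \<le> K * (1 + \<bar>\<xi> * r\<bar> ^ 3) * norm (f0 \<xi>)"
      unfolding norm_mult by (intro mult_right_mono h) auto
    also have "\<dots> \<le> K * (B / (1 + (\<xi> * r)\<^sup>2))"
      using mult_left_mono[OF f[of \<xi>] K] by (simp add: f0_def mult.assoc)
    finally show ?thesis by simp
  qed
  have u1: "u \<le> 1 + u ^ 3" "u\<^sup>2 \<le> 1 + u ^ 3" "1 \<le> 1 + u ^ 3" "u ^ 3 \<le> 1 + u ^ 3" if "0 \<le> u" for u :: real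
  proof -
    show "u \<le> 1 + u ^ 3"
      using that power_increasing[of 1 3 u] by (cases "u \<le> 1") (auto simp: add_increasing2)
    show "u\<^sup>2 \<le> 1 + u ^ 3"
    proof (cases "u \<le> 1")
      case True
      then show ?thesis using that by (simp add: power_le_one add_increasing2)
    next
      case False
      then have "u\<^sup>2 \<le> u ^ 3" by (intro power_increasing) auto
      then show ?thesis by linarith
    qed
  qed (use that in auto)
  have n1: "norm (q1 \<xi>) \<le> a * r * \<bar>\<xi> * r\<bar>" for \<xi>
    using b1[of \<xi>] r by (simp add: abs_mult power2_eq_square mult_ac)
  have bf0: "norm (f0 \<xi>) \<le> B / (1 + (\<xi> * r)\<^sup>2)" for \<xi>
    using bd[of "\<lambda>_. 1" \<xi> 1] by simp
  have bf1: "norm (f1 \<xi>) \<le> (a * r) * B / (1 + (\<xi> * r)\<^sup>2)" for \<xi>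
    unfolding f1_def
  proof (rule bd)
    show "norm (q1 \<xi>) \<le> a * r * (1 + \<bar>\<xi> * r\<bar> ^ 3)"
      using n1[of \<xi>] mult_left_mono[OF u1(1)[of "\<bar>\<xi> * r\<bar>"], of "a * r"] a r by force
  qed (use a r in simp)
  have bf2: "norm (f2 \<xi>) \<le> ((a + a\<^sup>2) * r\<^sup>2) * B / (1 + (\<xi> * r)\<^sup>2)" for \<xi>
    unfolding f2_def
  proof (rule bd)
    let ?u = "\<bar>\<xi> * r\<bar>"
    have "norm (q2 \<xi> + q1 \<xi> ^ 2) \<le> a * r\<^sup>2 + (a * r * ?u) ^ 2"
      using b2 n1 by (intro norm_triangle_mono) (auto simp: norm_power intro!: power_mono)
    also have "\<dots> = a * r\<^sup>2 * 1 + a\<^sup>2 * r\<^sup>2 * ?u\<^sup>2" by (simp add: power_mult_distrib)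
    also have "\<dots> \<le> a * r\<^sup>2 * (1 + ?u ^ 3) + a\<^sup>2 * r\<^sup>2 * (1 + ?u ^ 3)"
      using a u1[of ?u] by (intro add_mono mult_left_mono) auto
    finally show "norm (q2 \<xi> + q1 \<xi> ^ 2) \<le> (a + a\<^sup>2) * r\<^sup>2 * (1 + ?u ^ 3)" by (simp add: algebra_simps)
  qed (use a in simp)
  have bf3: "norm (f3 \<xi>) \<le> ((a + 3 * a\<^sup>2 + a ^ 3) * r ^ 3) * B / (1 + (\<xi> * r)\<^sup>2)" for \<xi>
    unfolding f3_def
  proof (rule bd)
    let ?u = "\<bar>\<xi> * r\<bar>"
    have "norm (q3 \<xi> + 3 * q1 \<xi> * q2 \<xi> + q1 \<xi> ^ 3) \<le> a * r ^ 3 + 3 * (a * r * ?u) * (a * r\<^sup>2) + (a * r * ?u) ^ 3"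
    proof (intro norm_triangle_mono b3)
      have "norm (q1 \<xi>) * norm (q2 \<xi>) \<le> (a * r * ?u) * (a * r\<^sup>2)"
        using n1 b2 a r by (intro mult_mono) auto
      then show "norm (3 * q1 \<xi> * q2 \<xi>) \<le> 3 * (a * r * ?u) * (a * r\<^sup>2)" by (simp add: norm_mult)
      show "norm (q1 \<xi> ^ 3) \<le> (a * r * ?u) ^ 3"
        unfolding norm_power by (rule power_mono[OF n1]) simp
    qed
    also have "\<dots> = a * r ^ 3 * 1 + 3 * a\<^sup>2 * r ^ 3 * ?u + a ^ 3 * r ^ 3 * ?u ^ 3"
      by (simp only: power_mult_distrib) (simp add: power2_eq_square power3_eq_cube)
    also have "\<dots> \<le> a * r ^ 3 * (1 + ?u ^ 3) + 3 * a\<^sup>2 * r ^ 3 * (1 + ?u ^ 3) + a ^ 3 * r ^ 3 * (1 + ?u ^ 3)"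
      using a r u1[of ?u] by (intro add_mono mult_left_mono) auto
    finally show "norm (q3 \<xi> + 3 * q1 \<xi> * q2 \<xi> + q1 \<xi> ^ 3) \<le> (a + 3 * a\<^sup>2 + a ^ 3) * r ^ 3 * (1 + ?u ^ 3)"
      by (simp add: algebra_simps)
  qed (use a r in simp)
  note ms = borel_measurable_continuous_onI
  show "integrable lborel (\<lambda>\<xi>. exp (q \<xi>))"
    using cauchy_dominated_integrable(1)[OF r ms[OF c(3)] bf0] by (simp add: f0_def[abs_def])
  show "norm (fourier_int (\<lambda>\<xi>. exp (q \<xi>)) x) \<le> B * pi / r"
    using order_trans[OF norm_fourier_int_le cauchy_dominated_integrable(2)[OF r ms[OF c(3)] bf0]]
    by (simp add: f0_def[abs_def])
  have "fourier_int f3 x = \<i> * x * (\<i> * x * (\<i> * x * fourier_int f0 x))"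
    using fourier_int_derivative[OF r d0 c(4) bf0 bf1] fourier_int_derivative[OF r d1 c(5) bf1 bf2]
      fourier_int_derivative[OF r d2 c3 bf2 bf3] by simp
  then have "\<bar>x\<bar> ^ 3 * norm (fourier_int f0 x) = norm (fourier_int f3 x)"
    by (simp add: norm_mult power3_eq_cube)
  also have "\<dots> \<le> ((a + 3 * a\<^sup>2 + a ^ 3) * r ^ 3) * B * pi / r"
    using order_trans[OF norm_fourier_int_le cauchy_dominated_integrable(2)[OF r ms[OF c3] bf3]] by simp
  also have "\<dots> = (a + 3 * a\<^sup>2 + a ^ 3) * B * pi * r\<^sup>2"
    using r by (simp add: power3_eq_cube power2_eq_square)
  finally show "\<bar>x\<bar> ^ 3 * norm (fourier_int (\<lambda>\<xi>. exp (q \<xi>)) x) \<le> (a + 3 * a\<^sup>2 + a ^ 3) * B * pi * r\<^sup>2"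
    by (simp add: f0_def[abs_def])
qed

lemma iexp_remainder: "norm (iexp (\<xi> + h) - iexp \<xi> - \<i> * h * iexp \<xi>) \<le> h\<^sup>2 / 2"
proof -
  have "iexp (\<xi> + h) - iexp \<xi> - \<i> * h * iexp \<xi> = iexp \<xi> * (iexp h - (1 + \<i> * h))"
    by (simp add: algebra_simps exp_add)
  also have "norm \<dots> = norm (iexp h - (1 + \<i> * h))" by (simp add: norm_mult)
  also have "\<dots> \<le> h\<^sup>2 / 2" using iexp_approx1[of h 1] by (simp add: numeral_2_eq_2)
  finally show ?thesis .
qed

lemma norm_iexp_minus_one: "norm (iexp u - 1) \<le> \<bar>u\<bar>"
  using iexp_approx1[of u 0] by simp

lemma norm_iexp_compensated: "norm (iexp u - 1 - \<i> * u) \<le> u\<^sup>2 / 2"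
  using iexp_approx1[of u 1] by (simp add: numeral_2_eq_2 diff_diff_eq)

context monotone_levy
begin

text \<open>
  The compensated exponent of the jumps below \<open>r\<close> and its formal derivatives in \<open>\<xi>\<close>; the fourth
  one serves only to make the third continuous.
\<close>

definition small_part :: "real \<Rightarrow> real \<Rightarrow> complex" where
  "small_part r \<xi> = (\<integral>y. (iexp (\<xi> * y) - 1 - \<i> * (\<xi> * y)) * indicator {..<r} y \<partial>\<nu>)"
definition small_part1 :: "real \<Rightarrow> real \<Rightarrow> complex" where
  "small_part1 r \<xi> = (\<integral>y. \<i> * y * (iexp (\<xi> * y) - 1) * indicator {..<r} y \<partial>\<nu>)"
definition small_part2 :: "real \<Rightarrow> real \<Rightarrow> complex" where
  "small_part2 r \<xi> = (\<integral>y. - (y\<^sup>2) * iexp (\<xi> * y) * indicator {..<r} y \<partial>\<nu>)"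
definition small_part3 :: "real \<Rightarrow> real \<Rightarrow> complex" where
  "small_part3 r \<xi> = (\<integral>y. - \<i> * y ^ 3 * iexp (\<xi> * y) * indicator {..<r} y \<partial>\<nu>)"
definition small_part4 :: "real \<Rightarrow> real \<Rightarrow> complex" where
  "small_part4 r \<xi> = (\<integral>y. y ^ 4 * iexp (\<xi> * y) * indicator {..<r} y \<partial>\<nu>)"

lemma small_jump_pointwise:
  fixes \<xi> y :: real
  assumes y: "0 < y" "y < r"
  shows "norm (iexp (\<xi> * y) - 1 - \<i> * (\<xi> * y)) \<le> \<xi>\<^sup>2 / 2 * y\<^sup>2"
    and "norm (\<i> * y * (iexp (\<xi> * y) - 1)) \<le> \<bar>\<xi>\<bar> * y\<^sup>2"
    and "norm (- \<i> * y ^ 3 * iexp (\<xi> * y)) \<le> r * y\<^sup>2"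
    and "norm (y ^ 4 * iexp (\<xi> * y)) \<le> r\<^sup>2 * y\<^sup>2"
proof -
  show "norm (iexp (\<xi> * y) - 1 - \<i> * (\<xi> * y)) \<le> \<xi>\<^sup>2 / 2 * y\<^sup>2"
    using norm_iexp_compensated[of "\<xi> * y"] by (simp add: power_mult_distrib)
  have "y * norm (iexp (\<xi> * y) - 1) \<le> y * (\<bar>\<xi>\<bar> * y)"
    using norm_iexp_minus_one[of "\<xi> * y"] y by (intro mult_left_mono) (auto simp: abs_mult)
  then show "norm (\<i> * y * (iexp (\<xi> * y) - 1)) \<le> \<bar>\<xi>\<bar> * y\<^sup>2"
    using y by (simp add: norm_mult power2_eq_square mult_ac)
  have "y * y\<^sup>2 \<le> r * y\<^sup>2" using y by (intro mult_right_mono) auto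
  then show "norm (- \<i> * y ^ 3 * iexp (\<xi> * y)) \<le> r * y\<^sup>2"
    using y by (simp add: norm_mult norm_power power3_eq_cube power2_eq_square)
  have "y\<^sup>2 * y\<^sup>2 \<le> r\<^sup>2 * y\<^sup>2" using y by (intro mult_right_mono power_mono) auto
  then show "norm (y ^ 4 * iexp (\<xi> * y)) \<le> r\<^sup>2 * y\<^sup>2"
    using y by (simp add: norm_mult norm_power flip: power_add)
qed

lemma integrable_small:
  "integrable \<nu> (\<lambda>y. (iexp (\<xi> * y) - 1 - \<i> * (\<xi> * y)) * indicator {..<r} y)"
  "integrable \<nu> (\<lambda>y. \<i> * y * (iexp (\<xi> * y) - 1) * indicator {..<r} y)"
  "integrable \<nu> (\<lambda>y. - (y\<^sup>2) * iexp (\<xi> * y) * indicator {..<r} y)"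
  "integrable \<nu> (\<lambda>y. - \<i> * y ^ 3 * iexp (\<xi> * y) * indicator {..<r} y)"
  "integrable \<nu> (\<lambda>y. y ^ 4 * iexp (\<xi> * y) * indicator {..<r} y)"
proof -
  show "integrable \<nu> (\<lambda>y. (iexp (\<xi> * y) - 1 - \<i> * (\<xi> * y)) * indicator {..<r} y)"
    by (rule integrable_\<nu>_square_cutoff[where r = r and K = "\<xi>\<^sup>2 / 2"]) (use small_jump_pointwise(1) in auto)
  show "integrable \<nu> (\<lambda>y. \<i> * y * (iexp (\<xi> * y) - 1) * indicator {..<r} y)"
    by (rule integrable_\<nu>_square_cutoff[where r = r and K = "\<bar>\<xi>\<bar>"]) (use small_jump_pointwise(2) in auto)
  show "integrable \<nu> (\<lambda>y. - (y\<^sup>2) * iexp (\<xi> * y) * indicator {..<r} y)"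
    by (rule integrable_\<nu>_square_cutoff[where r = r and K = 1]) (auto simp: norm_mult norm_power)
  show "integrable \<nu> (\<lambda>y. - \<i> * y ^ 3 * iexp (\<xi> * y) * indicator {..<r} y)"
    by (rule integrable_\<nu>_square_cutoff[where r = r and K = r]) (use small_jump_pointwise(3) in auto)
  show "integrable \<nu> (\<lambda>y. y ^ 4 * iexp (\<xi> * y) * indicator {..<r} y)"
    by (rule integrable_\<nu>_square_cutoff[where r = r and K = "r\<^sup>2"]) (use small_jump_pointwise(4) in auto)
qed

text \<open>
  The integrands of \<open>small_part\<close> and its derivatives all differ from their linearisation by a
  factor \<open>w\<close> times the same second order remainder of the exponential.
\<close>

lemma small_jump_derivative:
  fixes k k' :: "real \<Rightarrow> real \<Rightarrow> complex" and w :: "real \<Rightarrow> complex"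
  assumes k: "\<And>\<xi>. integrable \<nu> (\<lambda>y. k \<xi> y * indicator {..<r} y)" "integrable \<nu> (\<lambda>y. k' \<xi> y * indicator {..<r} y)"
    and w: "w \<in> borel_measurable borel" "\<And>y. 0 < y \<Longrightarrow> y < r \<Longrightarrow> norm (w y) \<le> K"
    and rem: "\<And>h y. k (\<xi> + h) y - k \<xi> y - h * k' \<xi> y
        = w y * (iexp (\<xi> * y + h * y) - iexp (\<xi> * y) - \<i> * (h * y) * iexp (\<xi> * y))"
  shows "((\<lambda>z. \<integral>y. k z y * indicator {..<r} y \<partial>\<nu>) has_vector_derivative (\<integral>y. k' \<xi> y * indicator {..<r} y \<partial>\<nu>)) (at \<xi>)"
proof (rule has_vector_derivative_integral[where d = 1 and w = "\<lambda>y. K / 2 * (y\<^sup>2 * indicator {..<r} y)"])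
  fix h :: real
  show "AE y in \<nu>. norm (k (\<xi> + h) y * indicator {..<r} y - k \<xi> y * indicator {..<r} y - h *\<^sub>R (k' \<xi> y * indicator {..<r} y))
      \<le> h\<^sup>2 * (K / 2 * (y\<^sup>2 * indicator {..<r} y))"
    using AE_pos
  proof eventually_elim
    case (elim y)
    show ?case
    proof (cases "y < r")
      case True
      have "norm (w y * (iexp (\<xi> * y + h * y) - iexp (\<xi> * y) - \<i> * (h * y) * iexp (\<xi> * y))) \<le> K * ((h * y)\<^sup>2 / 2)"
        unfolding norm_mult
        using iexp_remainder[of "\<xi> * y" "h * y"] order_trans[OF norm_ge_zero w(2)[OF elim True]]
        by (intro mult_mono w(2) elim True) auto
      then show ?thesis using True rem[of h y] by (simp add: power_mult_distrib scaleR_conv_of_real mult_ac)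
    qed simp
  qed
qed (use k integrable_small_moment in auto)

lemma small_part_derivatives:
  "(small_part r has_vector_derivative small_part1 r \<xi>) (at \<xi>)"
  "(small_part1 r has_vector_derivative small_part2 r \<xi>) (at \<xi>)"
  "(small_part2 r has_vector_derivative small_part3 r \<xi>) (at \<xi>)"
  "(small_part3 r has_vector_derivative small_part4 r \<xi>) (at \<xi>)"
proof -
  show "(small_part r has_vector_derivative small_part1 r \<xi>) (at \<xi>)"
    unfolding small_part_def[abs_def] small_part1_def
    by (rule small_jump_derivative[where w = "\<lambda>_. 1" and K = 1], rule integrable_small(1), rule integrable_small(2))
       (auto simp: algebra_simps)
  show "(small_part1 r has_vector_derivative small_part2 r \<xi>) (at \<xi>)"
    unfolding small_part1_def[abs_def] small_part2_def
    by (rule small_jump_derivative[where w = "\<lambda>y. \<i> * y" and K = r], rule integrable_small(2), rule integrable_small(3))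
       (auto simp: algebra_simps norm_mult power2_eq_square)
  show "(small_part2 r has_vector_derivative small_part3 r \<xi>) (at \<xi>)"
    unfolding small_part2_def[abs_def] small_part3_def
    by (rule small_jump_derivative[where w = "\<lambda>y. - (y\<^sup>2)" and K = "r\<^sup>2"], rule integrable_small(3), rule integrable_small(4))
       (auto simp: algebra_simps norm_mult norm_power power2_eq_square power3_eq_cube intro!: mult_mono)
  show "(small_part3 r has_vector_derivative small_part4 r \<xi>) (at \<xi>)"
    unfolding small_part3_def[abs_def] small_part4_def
    by (rule small_jump_derivative[where w = "\<lambda>y. - \<i> * y ^ 3" and K = "r ^ 3"], rule integrable_small(4), rule integrable_small(5))
       (auto simp: algebra_simps norm_mult norm_power power3_eq_cube power4_eq_xxxx intro!: mult_mono)
qed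

lemma norm_small_integral_le:
  fixes k :: "real \<Rightarrow> complex"
  assumes "integrable \<nu> (\<lambda>y. k y * indicator {..<r} y)" "\<And>y. 0 < y \<Longrightarrow> y < r \<Longrightarrow> norm (k y) \<le> K * y\<^sup>2"
  shows "norm (\<integral>y. k y * indicator {..<r} y \<partial>\<nu>) \<le> K * small_moment r"
proof -
  have "norm (\<integral>y. k y * indicator {..<r} y \<partial>\<nu>) \<le> (\<integral>y. norm (k y * indicator {..<r} y) \<partial>\<nu>)"
    by (rule integral_norm_bound)
  also have "\<dots> \<le> (\<integral>y. K * (y\<^sup>2 * indicator {..<r} y) \<partial>\<nu>)"
  proof (rule integral_mono_AE)
    show "AE y in \<nu>. norm (k y * indicator {..<r} y) \<le> K * (y\<^sup>2 * indicator {..<r} y)"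
      using AE_pos by eventually_elim (use assms(2) in \<open>auto split: split_indicator\<close>)
  qed (use assms(1) integrable_small_moment in auto)
  also have "\<dots> = K * small_moment r" by (simp add: small_moment_def)
  finally show ?thesis .
qed

lemma small_part_bounds:
  "norm (small_part1 r \<xi>) \<le> \<bar>\<xi>\<bar> * small_moment r" "norm (small_part2 r \<xi>) \<le> small_moment r" "norm (small_part3 r \<xi>) \<le> r * small_moment r"
proof -
  show "norm (small_part1 r \<xi>) \<le> \<bar>\<xi>\<bar> * small_moment r"
    unfolding small_part1_def by (rule norm_small_integral_le[OF integrable_small(2) small_jump_pointwise(2)])
  show "norm (small_part2 r \<xi>) \<le> small_moment r"
    using norm_small_integral_le[OF integrable_small(3), where K = 1] unfolding small_part2_def by (simp add: norm_mult norm_power)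
  show "norm (small_part3 r \<xi>) \<le> r * small_moment r"
    unfolding small_part3_def by (rule norm_small_integral_le[OF integrable_small(4) small_jump_pointwise(3)])
qed

text \<open>
  Dropping the jumps above \<open>r\<close> lowers \<open>re_psi\<close> by at most twice their mass.
\<close>

lemma Re_small_part_le: assumes r: "0 < r" shows "Re (small_part r \<xi>) \<le> - re_psi \<xi> + 2 * tail r"
proof -
  have "Re (small_part r \<xi>) = (\<integral>y. Re ((iexp (\<xi> * y) - 1 - \<i> * (\<xi> * y)) * indicator {..<r} y) \<partial>\<nu>)"
    unfolding small_part_def by (rule integral_Re[symmetric, OF integrable_small(1)])
  also have "\<dots> \<le> (\<integral>y. - (1 - cos (\<xi> * y)) + 2 * indicator {r..} y \<partial>\<nu>)"
  proof (rule integral_mono)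
    show "integrable \<nu> (\<lambda>y. Re ((iexp (\<xi> * y) - 1 - \<i> * (\<xi> * y)) * indicator {..<r} y))"
      by (rule integrable_Re[OF integrable_small(1)])
    show "integrable \<nu> (\<lambda>y. - (1 - cos (\<xi> * y)) + 2 * indicator {r..} y)"
      using integrable_re_psi integrable_tail[OF r] by (intro Bochner_Integration.integrable_add integrable_minus) auto
    fix y :: real
    have c: "0 \<le> 1 + cos (\<xi> * y)" using cos_ge_minus_one[of "\<xi> * y"] by linarith
    show "Re ((iexp (\<xi> * y) - 1 - \<i> * (\<xi> * y)) * indicator {..<r} y) \<le> - (1 - cos (\<xi> * y)) + 2 * indicator {r..} y"
      by (auto simp: Re_exp c split: split_indicator)
  qed
  also have "\<dots> = - re_psi \<xi> + 2 * tail r"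
    using integrable_re_psi[of \<xi>] integrable_tail[OF r] unfolding re_psi_def
    by (subst Bochner_Integration.integral_add) (auto simp: tail_def simp del: minus_diff_eq)
  finally show ?thesis .
qed

end

section \<open>Decomposition of the exponent and kernel estimate\<close>

context monotone_levy
begin

text \<open>
  The Fourier transform of the restriction of \<open>\<nu>\<close> to \<open>[r,\<infinity>)\<close>.
\<close>

definition large_part :: "real \<Rightarrow> real \<Rightarrow> complex" where
  "large_part r \<xi> = (\<integral>y. iexp (\<xi> * y) * indicator {r..} y \<partial>\<nu>)"

lemma integrable_large_part: assumes r: "0 < r" shows "integrable \<nu> (\<lambda>y. iexp (\<xi> * y) * indicator {r..} y)"
  by (rule Bochner_Integration.integrable_bound[OF integrable_tail[OF r]]) (auto simp: norm_mult split: split_indicator)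

lemma integrable_drift_correction:
  assumes r: "0 < r" shows "integrable \<nu> (\<lambda>y. y * (indicator {..<r} y - indicator {..<1} y) :: real)"
proof (rule Bochner_Integration.integrable_bound)
  show "integrable \<nu> (\<lambda>y. max r 1 * indicator {min r 1..} y)"
    using integrable_tail[of "min r 1"] r by simp
  show "AE y in \<nu>. norm (y * (indicator {..<r} y - indicator {..<1} y)) \<le> norm (max r 1 * indicator {min r 1..} y)"
    using AE_pos by eventually_elim (use r in \<open>auto split: split_indicator\<close>)
qed measurable

lemma integrable_compensated: "integrable \<nu> (\<lambda>y. iexp (\<xi> * y) - 1 - \<i> * of_real (\<xi> * y * indicator {..<1} y))"
proof (rule integrable_\<nu>I[where K = "2 + \<xi>\<^sup>2 / 2"])
  fix y :: real assume y: "0 < y"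
  show "norm (iexp (\<xi> * y) - 1 - \<i> * of_real (\<xi> * y * indicator {..<1} y)) \<le> (2 + \<xi>\<^sup>2 / 2) * min 1 (y\<^sup>2)"
  proof (cases "y < 1")
    case True
    have "norm (iexp (\<xi> * y) - 1 - \<i> * (\<xi> * y)) \<le> \<xi>\<^sup>2 / 2 * y\<^sup>2"
      using norm_iexp_compensated[of "\<xi> * y"] by (simp add: power_mult_distrib)
    also have "\<dots> \<le> (2 + \<xi>\<^sup>2 / 2) * y\<^sup>2" by (intro mult_right_mono) auto
    finally show ?thesis using True y by (simp add: min_absorb2 power_le_one)
  next
    case False
    have "norm (iexp (\<xi> * y) - 1) \<le> 1 + 1" using norm_triangle_ineq4[of "iexp (\<xi> * y)" 1] by simp
    also have "\<dots> \<le> (2 + \<xi>\<^sup>2 / 2) * 1" by simp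
    finally show ?thesis using False one_le_power[of y 2] by (simp add: min_absorb1)
  qed
qed measurable

lemma levy_psi_integral:
  "levy_psi 0 b \<nu> \<xi> = - (\<i> * of_real (\<xi> * b)) - (\<integral>y. iexp (\<xi> * y) - 1 - \<i> * of_real (\<xi> * y * indicator {..<1} y) \<partial>\<nu>)"
proof -
  have "(LINT x:{0<..}|\<nu>. iexp (\<xi> * x) - 1 - \<i> * of_real (\<xi> * x * indicator {..<1} x))
      = (\<integral>y. iexp (\<xi> * y) - 1 - \<i> * of_real (\<xi> * y * indicator {..<1} y) \<partial>\<nu>)"
    by (rule set_integral_\<nu>) measurable
  then show ?thesis by (simp add: levy_psi_def)
qed

lemma Re_levy_psi: "Re (levy_psi 0 b \<nu> \<xi>) = re_psi \<xi>"
proof -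
  have "Re (\<integral>y. iexp (\<xi> * y) - 1 - \<i> * of_real (\<xi> * y * indicator {..<1} y) \<partial>\<nu>)
      = (\<integral>y. Re (iexp (\<xi> * y) - 1 - \<i> * of_real (\<xi> * y * indicator {..<1} y)) \<partial>\<nu>)"
    by (rule integral_Re[symmetric, OF integrable_compensated])
  also have "\<dots> = (\<integral>y. - (1 - cos (\<xi> * y)) \<partial>\<nu>)" by (simp add: Re_exp)
  also have "\<dots> = - re_psi \<xi>" unfolding re_psi_def by (rule Bochner_Integration.integral_minus)
  finally show ?thesis by (simp add: levy_psi_integral)
qed

lemma levy_drift_eq: "levy_drift b \<nu> r = b + (\<integral>y. y * (indicator {..<r} y - indicator {..<1} y) \<partial>\<nu>)"
  unfolding levy_drift_def by (subst set_integral_\<nu>) auto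

lemma levy_psi_decomposition:
  assumes r: "0 < r"
  shows "- levy_psi 0 b \<nu> \<xi> = \<i> * \<xi> * levy_drift b \<nu> r + small_part r \<xi> + large_part r \<xi> - tail r"
proof -
  let ?c = "\<lambda>y::real. y * (indicator {..<r} y - indicator {..<1} y) :: real"
  have "(\<integral>y. iexp (\<xi> * y) - 1 - \<i> * of_real (\<xi> * y * indicator {..<1} y) \<partial>\<nu>)
      = (\<integral>y. (iexp (\<xi> * y) - 1 - \<i> * (\<xi> * y)) * indicator {..<r} y + iexp (\<xi> * y) * indicator {r..} y
           - complex_of_real (indicator {r..} y) + \<i> * \<xi> * complex_of_real (?c y) \<partial>\<nu>)"
    by (intro Bochner_Integration.integral_cong) (auto split: split_indicator simp: algebra_simps)
  also have "\<dots> = small_part r \<xi> + large_part r \<xi> - complex_of_real (tail r) + \<i> * \<xi> * complex_of_real (\<integral>y. ?c y \<partial>\<nu>)"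
  proof -
    note i = integrable_of_real[OF integrable_tail[OF r], where 'a = complex]
      integrable_mult_right[OF integrable_of_real[OF integrable_drift_correction[OF r]], of "\<i> * \<xi>"]
    have "(\<integral>y. complex_of_real (indicator {r..} y) \<partial>\<nu>) = tail r"
      unfolding integral_complex_of_real by (simp add: tail_def)
    moreover have "(\<integral>y. \<i> * \<xi> * complex_of_real (?c y) \<partial>\<nu>) = \<i> * \<xi> * complex_of_real (\<integral>y. ?c y \<partial>\<nu>)"
      by (simp only: integral_mult_right_zero integral_complex_of_real)
    ultimately show ?thesis
      using integrable_small(1)[of \<xi> r] integrable_large_part[OF r, of \<xi>] i by (simp add: small_part_def large_part_def del: of_real_mult)
  qed
  finally show ?thesis by (simp add: levy_psi_integral levy_drift_eq algebra_simps)
qed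

lemma large_part_lborel:
  assumes r: "0 < r"
  shows "t * large_part r \<xi> = (CLBINT y. iexp (\<xi> * y) * complex_of_real (t * (n y * indicator {r..} y)))"
proof -
  have \<nu>: "\<nu> = density lborel (\<lambda>y. ennreal (n y * indicator {0<..} y))"
    unfolding \<nu>_density by (intro density_cong) (auto split: split_indicator)
  have "large_part r \<xi> = (CLBINT y. (n y * indicator {0<..} y) *\<^sub>R (iexp (\<xi> * y) * indicator {r..} y))"
    unfolding large_part_def by (subst \<nu>, rule integral_density) (auto simp: n_nonneg)
  also have "\<dots> = (CLBINT y. iexp (\<xi> * y) * complex_of_real (n y * indicator {r..} y))"
    using r by (intro Bochner_Integration.integral_cong) (auto simp: scaleR_conv_of_real split: split_indicator)
  finally have "t * large_part r \<xi> = (CLBINT y. t * (iexp (\<xi> * y) * complex_of_real (n y * indicator {r..} y)))" by simp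
  then show ?thesis by (simp add: mult_ac)
qed

lemma tail_density:
  assumes r: "0 < r"
  shows "has_bochner_integral lborel (\<lambda>y. n y * indicator {r..} y) (tail r)"
proof (rule has_bochner_integral_nn_integral)
  have "ennreal (tail r) = (\<integral>\<^sup>+y. indicator {r..} y \<partial>\<nu>)" using r by (simp add: emeasure_tail)
  also have "\<dots> = (\<integral>\<^sup>+y. ennreal (n y) * indicator {0<..} y * indicator {r..} y \<partial>lborel)"
    by (rule nn_integral_\<nu>) measurable
  also have "\<dots> = (\<integral>\<^sup>+y. ennreal (n y * indicator {r..} y) \<partial>lborel)"
    using r by (intro nn_integral_cong) (auto split: split_indicator)
  finally show "(\<integral>\<^sup>+y. ennreal (n y * indicator {r..} y) \<partial>lborel) = ennreal (tail r)" ..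
qed (auto simp: n_nonneg tail_nonneg)

end

context scaled_levy
begin

text \<open>
  The exponent splits as drift plus small jumps plus large jumps. The small jumps provide the
  function \<open>f\<close> of \<open>compound_poisson_fourier_bound\<close>, the large ones the kernel \<open>k\<close>, and the drift is removed by
  the shift of the argument. The constant \<open>A\<close> depends on \<open>t\<close> and \<open>\<rho>\<close> only through the two bounds on \<open>t * \<Phi> \<rho>\<close>.
\<close>

lemma kernel_estimate:
  assumes k: "0 < klo" "0 < khi"
  shows "\<exists>A>0. \<forall>b t \<rho>. 0 < t \<longrightarrow> 0 < \<rho> \<longrightarrow> \<delta> \<le> \<rho> \<longrightarrow> klo \<le> t * \<Phi> \<rho> \<longrightarrow> t * \<Phi> \<rho> \<le> khi \<longrightarrow>
    (\<forall>x. norm (fourier_int (\<lambda>\<xi>. exp (- (t * levy_psi 0 b \<nu> \<xi>))) x) \<le> A * \<rho>) \<and>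
    (\<forall>x. x \<noteq> 0 \<longrightarrow> norm (fourier_int (\<lambda>\<xi>. exp (- (t * levy_psi 0 b \<nu> \<xi>))) (x + t * levy_drift b \<nu> (1 / \<rho>))) \<le> A * (t * profile \<bar>x\<bar>))"
proof -
  obtain B where B: "0 < B" "\<And>t \<rho> \<xi>. 0 < t \<Longrightarrow> 0 < \<rho> \<Longrightarrow> \<delta> \<le> \<rho> \<Longrightarrow> klo \<le> t * \<Phi> \<rho> \<Longrightarrow>
       (1 + \<bar>\<xi> / \<rho>\<bar> ^ 3) * exp (- (t * re_psi \<xi>)) \<le> B / (1 + (\<xi> / \<rho>)\<^sup>2)"
    using exp_re_psi_bound[OF k(1)] by metis
  obtain C where C: "0 < C" "\<And>\<rho>. 0 < \<rho> \<Longrightarrow> \<delta> \<le> \<rho> \<Longrightarrow> tail (1 / \<rho>) \<le> C * \<Phi> \<rho>"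
    using tail_le by blast
  define m where "m = C * khi"
  define a where "a = exp 1 * khi"
  define k' where "k' = klo / (1 + 72 * C0\<^sup>2)"
  define B1 where "B1 = exp (2 * m) * B"
  \<comment> \<open>\<open>B1\<close> dominates the small jump factor, \<open>A3\<close> its third derivative; \<open>D\<close>, \<open>E\<close>, \<open>I\<close> are the constants of the convolution lemma\<close>
  define A3 where "A3 = (a + 3 * a\<^sup>2 + a ^ 3) * B1 * pi"
  define D where "D = (A3 + 3 * C0\<^sup>2 * (B1 * pi)) / k'"
  define I where "I = 2 * (B1 * pi + A3) * pi"
  define E where "E = 24 * C0\<^sup>2"
  define A where "A = B * pi + (D + E * I) * exp (1 + m + m * E)"
  have pos: "0 < m" "0 < a" "0 < k'" "0 < B1" "0 < E"
    using C(1) k B(1) C0 by (auto simp: m_def a_def k'_def B1_def E_def intro!: divide_pos_pos add_pos_nonneg)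
  have A3: "0 < A3" using pos by (auto simp: A3_def intro!: mult_pos_pos add_pos_pos)
  have DI: "0 \<le> D" "0 \<le> I" using pos A3 C0 by (auto simp: D_def I_def intro!: divide_nonneg_pos add_nonneg_nonneg)
  have A: "0 < A" "B * pi \<le> A" "(D + E * I) * exp (1 + m + m * E) \<le> A"
    using B(1) DI pos by (auto simp: A_def add_pos_nonneg)
  show ?thesis
  proof (intro exI[of _ A] conjI A(1) allI impI)
    fix b t \<rho> :: real
    assume t: "0 < t" and \<rho>: "0 < \<rho>" "\<delta> \<le> \<rho>" and tk: "klo \<le> t * \<Phi> \<rho>" "t * \<Phi> \<rho> \<le> khi"
    let ?\<chi> = "\<lambda>\<xi>. exp (- (t * levy_psi 0 b \<nu> \<xi>))"
    \<comment> \<open>jumps are called small below \<open>r\<close>\<close>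
    define r where "r = 1 / \<rho>"
    have r: "0 < r" "\<rho> = 1 / r" using \<rho> by (auto simp: r_def)
    have tail_m: "t * tail r \<le> m"
    proof -
      have "t * tail r \<le> t * (C * \<Phi> \<rho>)" using C(2)[OF \<rho>] t by (intro mult_left_mono) (auto simp: r_def)
      also have "\<dots> = C * (t * \<Phi> \<rho>)" by simp
      also have "\<dots> \<le> m" unfolding m_def using tk C(1) by (intro mult_left_mono) auto
      finally show ?thesis .
    qed
    have \<Phi>r: "\<Phi> \<rho> * r\<^sup>2 = laplace2 \<rho>" using r by (simp add: \<Phi>_def power_divide)
    have tU: "t * small_moment r \<le> a * r\<^sup>2"
    proof -
      have "t * small_moment r \<le> t * (exp 1 * laplace2 \<rho>)" using small_moment_le_laplace2[OF r(1)] t r by (intro mult_left_mono) auto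
      also have "\<dots> = exp 1 * (t * \<Phi> \<rho>) * r\<^sup>2" unfolding \<Phi>r[symmetric] by simp
      also have "\<dots> \<le> exp 1 * khi * r\<^sup>2" using tk by (intro mult_right_mono mult_left_mono) auto
      finally show ?thesis by (simp add: a_def)
    qed
    have tU': "k' * r\<^sup>2 \<le> t * small_moment r"
    proof -
      have p: "0 < 1 + 72 * C0\<^sup>2" by (intro add_pos_nonneg) auto
      have "klo * r\<^sup>2 \<le> t * \<Phi> \<rho> * r\<^sup>2" using tk by (intro mult_right_mono) auto
      also have "\<dots> = t * laplace2 \<rho>" using \<Phi>r by (simp add: mult.assoc)
      also have "\<dots> \<le> t * ((1 + 72 * C0\<^sup>2) * small_moment r)" using laplace2_le_small_moment[OF r(1)] t r by (intro mult_left_mono) auto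
      finally show ?thesis using p by (simp add: k'_def divide_le_eq mult_ac)
    qed
    define f where "f \<xi> = exp (t * small_part r \<xi>)" for \<xi>
    have fB: "(1 + \<bar>\<xi> * r\<bar> ^ 3) * norm (exp (t * small_part r \<xi>)) \<le> B1 / (1 + (\<xi> * r)\<^sup>2)" for \<xi>
    proof -
      have "t * Re (small_part r \<xi>) \<le> t * (- re_psi \<xi> + 2 * tail r)" using Re_small_part_le[OF r(1)] t by (intro mult_left_mono) auto
      also have "\<dots> = - (t * re_psi \<xi>) + 2 * (t * tail r)" by (simp add: algebra_simps)
      also have "\<dots> \<le> - (t * re_psi \<xi>) + 2 * m" using tail_m by simp
      finally have "exp (t * Re (small_part r \<xi>)) \<le> exp (2 * m) * exp (- (t * re_psi \<xi>))"
        by (simp add: exp_add[symmetric])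
      then have "(1 + \<bar>\<xi> * r\<bar> ^ 3) * exp (t * Re (small_part r \<xi>)) \<le> (1 + \<bar>\<xi> * r\<bar> ^ 3) * (exp (2 * m) * exp (- (t * re_psi \<xi>)))"
        by (intro mult_left_mono) auto
      also have "\<dots> = exp (2 * m) * ((1 + \<bar>\<xi> / \<rho>\<bar> ^ 3) * exp (- (t * re_psi \<xi>)))" using r by simp
      also have "\<dots> \<le> exp (2 * m) * (B / (1 + (\<xi> / \<rho>)\<^sup>2))"
        by (intro mult_left_mono B(2) t \<rho> tk) auto
      finally show ?thesis using r by (simp add: B1_def norm_exp_eq_Re)
    qed
    have ts: "((\<lambda>\<xi>. t * h \<xi>) has_vector_derivative (t * h')) (at \<xi>)" if "(h has_vector_derivative h') (at \<xi>)"
      for h :: "real \<Rightarrow> complex" and h' :: complex and \<xi>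
      by (rule has_vector_derivative_mult_right[OF that])
    have c3: "continuous_on UNIV (\<lambda>\<xi>. complex_of_real t * small_part3 r \<xi>)"
      using small_part_derivatives(4) by (intro continuous_intros continuous_at_imp_continuous_on)
        (auto intro: has_vector_derivative_continuous)
    have b1: "norm (t * small_part1 r \<xi>) \<le> a * r\<^sup>2 * \<bar>\<xi>\<bar>" for \<xi>
    proof -
      have "t * norm (small_part1 r \<xi>) \<le> t * (\<bar>\<xi>\<bar> * small_moment r)" using small_part_bounds(1) t by (intro mult_left_mono) auto
      also have "\<dots> \<le> \<bar>\<xi>\<bar> * (a * r\<^sup>2)" using mult_left_mono[OF tU, of "\<bar>\<xi>\<bar>"] by (simp add: mult_ac)
      finally show ?thesis using t by (simp add: norm_mult mult_ac)
    qed
    have b2: "norm (t * small_part2 r \<xi>) \<le> a * r\<^sup>2" for \<xi>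
    proof -
      have "t * norm (small_part2 r \<xi>) \<le> t * small_moment r" using small_part_bounds(2) t by (intro mult_left_mono) auto
      also note tU
      finally show ?thesis using t by (simp add: norm_mult)
    qed
    have b3: "norm (t * small_part3 r \<xi>) \<le> a * r ^ 3" for \<xi>
    proof -
      have "t * norm (small_part3 r \<xi>) \<le> t * (r * small_moment r)" using small_part_bounds(3) t by (intro mult_left_mono) auto
      also have "\<dots> = r * (t * small_moment r)" by simp
      also have "\<dots> \<le> r * (a * r\<^sup>2)" using tU r by (intro mult_left_mono) auto
      finally show ?thesis using t by (simp add: norm_mult power3_eq_cube power2_eq_square mult_ac)
    qed
    note decay = fourier_int_exp_decay[OF r(1) less_imp_le[OF pos(2)] ts[OF small_part_derivatives(1)] ts[OF small_part_derivatives(2)]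
        ts[OF small_part_derivatives(3)] c3 b1 b2 b3 fB, folded f_def]
    have f_int: "integrable lborel f" using decay(1) by (simp add: f_def[abs_def])
    have Q0: "norm (fourier_int f x) \<le> B1 * pi / r" "\<bar>x\<bar> ^ 3 * norm (fourier_int f x) \<le> A3 * r\<^sup>2" for x
      using decay(2,3)[of x] by (simp_all add: f_def[abs_def] A3_def)
    \<comment> \<open>beyond \<open>r\<close> the cubic decay applies, below \<open>r\<close> the uniform bound; in both cases \<open>k' * r\<^sup>2\<close> is at most \<open>t\<close> times the moment below \<open>r\<close>\<close>
    have Q0_H: "norm (fourier_int f x) \<le> D * (t * profile \<bar>x\<bar>)" if x: "x \<noteq> 0" for x
    proof (cases "r \<le> \<bar>x\<bar>")
      case True
      have x3: "0 < \<bar>x\<bar> ^ 3" using x by simp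
      have "norm (fourier_int f x) \<le> A3 * r\<^sup>2 / \<bar>x\<bar> ^ 3"
        using Q0(2)[of x] x3 by (simp add: le_divide_eq mult.commute)
      also have "\<dots> = A3 / k' * (k' * r\<^sup>2 / \<bar>x\<bar> ^ 3)" using pos by simp
      also have "\<dots> \<le> D * (t * profile \<bar>x\<bar>)"
      proof (rule mult_mono)
        show "A3 / k' \<le> D" unfolding D_def using pos C0 by (intro divide_right_mono) auto
        have "k' * r\<^sup>2 \<le> t * small_moment \<bar>x\<bar>" by (rule order_trans[OF tU' mult_left_mono[OF small_moment_mono[OF True] less_imp_le[OF t]]])
        then have "k' * r\<^sup>2 / \<bar>x\<bar> ^ 3 \<le> t * small_moment \<bar>x\<bar> / \<bar>x\<bar> ^ 3" by (rule divide_right_mono) simp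
        then show "k' * r\<^sup>2 / \<bar>x\<bar> ^ 3 \<le> t * profile \<bar>x\<bar>" by (simp add: profile_def)
      qed (use DI pos in auto)
      finally show ?thesis .
    next
      case False
      have "k' / r = k' * r\<^sup>2 / r ^ 3" using r by (simp add: power2_eq_square power3_eq_cube)
      also have "\<dots> \<le> t * small_moment r / r ^ 3" using tU' r by (intro divide_right_mono) auto
      also have "\<dots> = t * profile r" by (simp add: profile_def)
      also have "\<dots> \<le> t * (3 * C0\<^sup>2 * profile \<bar>x\<bar>)" using False x t by (intro mult_left_mono profile_almost_decreasing) auto
      finally have kr: "k' / r \<le> 3 * C0\<^sup>2 * (t * profile \<bar>x\<bar>)" by (simp only: mult_ac)
      have "norm (fourier_int f x) \<le> B1 * pi / k' * (k' / r)" using Q0(1)[of x] pos by simp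
      also have "\<dots> \<le> B1 * pi / k' * (3 * C0\<^sup>2 * (t * profile \<bar>x\<bar>))"
        using kr pos by (intro mult_left_mono) auto
      also have "\<dots> = (3 * C0\<^sup>2 * (B1 * pi)) / k' * (t * profile \<bar>x\<bar>)" by simp
      also have "\<dots> \<le> D * (t * profile \<bar>x\<bar>)"
        unfolding D_def using A3 pos t profile_nonneg[of "\<bar>x\<bar>"] x
        by (intro mult_right_mono divide_right_mono) auto
      finally show ?thesis .
    qed
    \<comment> \<open>the two bounds combine to \<open>min 1 (v\<^sup>-\<^sup>3) \<le> 2 / (1 + v\<^sup>2)\<close> with \<open>v = \<bar>x\<bar> / r\<close>\<close>
    have Q0_I: "(\<integral>\<^sup>+x. norm (fourier_int f x) \<partial>lborel) \<le> ennreal I"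
    proof -
      let ?K = "2 * (B1 * pi + A3) / r"
      have [measurable]: "f \<in> borel_measurable borel" using f_int by auto
      have "norm (fourier_int f x) \<le> ?K / (1 + (x * (1 / r))\<^sup>2)" for x
      proof -
        define v where "v = \<bar>x\<bar> / r"
        have v: "0 \<le> v" "\<bar>x\<bar> = v * r" using r by (auto simp: v_def)
        have "v ^ 3 * norm (fourier_int f x) * r ^ 3 \<le> A3 * r\<^sup>2"
          using Q0(2)[of x] v(2) by (simp add: power_mult_distrib mult_ac)
        then have q3: "v ^ 3 * norm (fourier_int f x) \<le> A3 / r"
          using r by (simp add: field_simps power2_eq_square power3_eq_cube)
        have "norm (fourier_int f x) * (1 + v\<^sup>2) \<le> norm (fourier_int f x) * (2 + 2 * v ^ 3)"
        proof (intro mult_left_mono)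
          show "1 + v\<^sup>2 \<le> 2 + 2 * v ^ 3"
          proof (cases "v \<le> 1")
            case True
            then have "v\<^sup>2 \<le> 1" "0 \<le> v ^ 3" using v by (auto simp: power_le_one)
            then show ?thesis by linarith
          next
            case False
            then have "v\<^sup>2 \<le> v ^ 3" "0 \<le> v ^ 3" using v by (auto intro!: power_increasing)
            then show ?thesis by linarith
          qed
        qed simp
        also have "\<dots> = 2 * norm (fourier_int f x) + 2 * (v ^ 3 * norm (fourier_int f x))" by (simp add: algebra_simps)
        also have "\<dots> \<le> 2 * (B1 * pi / r) + 2 * (A3 / r)" using Q0(1)[of x] q3 by linarith
        also have "\<dots> = ?K" by (simp add: add_divide_distrib)
        finally have "norm (fourier_int f x) * (1 + v\<^sup>2) \<le> ?K" .
        moreover have "0 < 1 + v\<^sup>2" by (intro add_pos_nonneg) auto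
        ultimately have "norm (fourier_int f x) \<le> ?K / (1 + v\<^sup>2)"
          by (simp only: pos_le_divide_eq)
        moreover have "v\<^sup>2 = (x * (1 / r))\<^sup>2" by (simp add: v_def power_divide)
        ultimately show ?thesis by simp
      qed
      note dom = cauchy_dominated_integrable[OF _ fourier_int_measurable this]
      have "(\<integral>\<^sup>+x. norm (fourier_int f x) \<partial>lborel) = ennreal (\<integral>x. norm (fourier_int f x) \<partial>lborel)"
        using dom(1) r by (intro nn_integral_eq_integral integrable_norm) auto
      also have "\<dots> \<le> ennreal I"
        using dom(2) r by (intro ennreal_leI) (simp add: I_def)
      finally show ?thesis .
    qed
    show "norm (fourier_int ?\<chi> x) \<le> A * \<rho>" for x
    proof -
      have n\<chi>: "norm (?\<chi> \<xi>) = exp (- (t * re_psi \<xi>))" for \<xi> by (simp add: norm_exp_eq_Re Re_levy_psi)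
      have \<chi>B: "norm (?\<chi> \<xi>) \<le> B / (1 + (\<xi> * r)\<^sup>2)" for \<xi>
      proof -
        have "1 * exp (- (t * re_psi \<xi>)) \<le> (1 + \<bar>\<xi> / \<rho>\<bar> ^ 3) * exp (- (t * re_psi \<xi>))"
          by (intro mult_right_mono) (use \<rho> in auto)
        also have "\<dots> \<le> B / (1 + (\<xi> / \<rho>)\<^sup>2)" by (intro B(2) t \<rho> tk)
        finally show ?thesis unfolding n\<chi> using r by simp
      qed
      \<comment> \<open>the Bochner integral of a non-integrable function is zero, so both cases satisfy the bound\<close>
      show ?thesis
      proof (cases "integrable lborel ?\<chi>")
        case True
        have "norm (fourier_int ?\<chi> x) \<le> (\<integral>\<xi>. norm (?\<chi> \<xi>) \<partial>lborel)" by (rule norm_fourier_int_le)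
        also have "\<dots> \<le> B * pi / r"
          by (rule cauchy_dominated_integrable(2)[OF r(1) _ \<chi>B]) (use borel_measurable_integrable[OF True] in simp)
        also have "\<dots> = B * pi * \<rho>" using r by simp
        also have "\<dots> \<le> A * \<rho>" using A \<rho> by (intro mult_right_mono) auto
        finally show ?thesis .
      next
        case False
        have "\<not> integrable lborel (\<lambda>\<xi>. iexp (- (\<xi> * x)) * ?\<chi> \<xi>)"
        proof
          assume i: "integrable lborel (\<lambda>\<xi>. iexp (- (\<xi> * x)) * ?\<chi> \<xi>)"
          have "integrable lborel (\<lambda>\<xi>. iexp (\<xi> * x) * (iexp (- (\<xi> * x)) * ?\<chi> \<xi>))"
            by (rule Bochner_Integration.integrable_bound[OF i]) (use i in \<open>auto simp: norm_mult\<close>)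
          then show False using False by (simp add: mult.assoc[symmetric] exp_add[symmetric])
        qed
        then show ?thesis using A \<rho> by (simp add: fourier_int_def not_integrable_integral_eq)
      qed
    qed
    fix x :: real assume x: "x \<noteq> 0"
    define k where "k y = t * (n y * indicator {r..} y)" for y
    have kI: "integrable lborel k" "(\<integral>y. k y \<partial>lborel) \<le> m"
      using tail_density[OF r(1)] tail_m unfolding k_def has_bochner_integral_iff by auto
    have dens: "k y \<le> E * (t * profile z)" if z: "0 < z" "z / 2 \<le> y" for y z
    proof -
      have "n y \<le> C0 * n (z / 2)" using z by (intro almost_monotone) auto
      also have "\<dots> \<le> C0 * (3 * C0 * profile (z / 2))" using z C0 density_le_profile[of "z / 2"] by (intro mult_left_mono) auto
      also have "\<dots> \<le> C0 * (3 * C0 * (8 * profile z))" using z C0 profile_half[of z] by (intro mult_left_mono) auto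
      also have "\<dots> = E * profile z" by (simp add: E_def power2_eq_square)
      finally have "t * n y \<le> t * (E * profile z)" using t by (intro mult_left_mono) auto
      moreover have "k y \<le> t * n y" using t n_nonneg[of y] by (auto simp: k_def split: split_indicator)
      ultimately have "k y \<le> t * (E * profile z)" by linarith
      then show ?thesis by (simp only: mult.left_commute)
    qed
    have HE: "t * profile y \<le> E * (t * profile z)" if z: "0 < z" "z / 2 \<le> y" for y z
    proof -
      have "profile y \<le> 3 * C0\<^sup>2 * profile (z / 2)" using z by (intro profile_almost_decreasing) auto
      also have "\<dots> \<le> 3 * C0\<^sup>2 * (8 * profile z)" using z profile_half[of z] by (intro mult_left_mono) auto
      also have "\<dots> = E * profile z" by (simp add: E_def)
      finally have "t * profile y \<le> t * (E * profile z)" using t by (intro mult_left_mono) auto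
      then show ?thesis by (simp only: mult.left_commute)
    qed
    have main: "norm (fourier_int (\<lambda>\<xi>. f \<xi> * exp (CLBINT y. iexp (\<xi> * y) * k y)) x)
        \<le> (D + E * I) * exp (1 + m + m * E) * (t * profile \<bar>x\<bar>)"
    proof (rule compound_poisson_fourier_bound[where H = "\<lambda>z. t * profile z"])
      show "0 \<le> k y" for y using t n_nonneg by (simp add: k_def)
      show "k y = 0" if "y \<le> 0" for y using that r by (simp add: k_def)
      show "0 \<le> t * profile z" if "0 < z" for z using that t profile_nonneg by simp
    qed (use f_int kI dens HE DI pos Q0_H Q0_I x in auto)
    have split: "iexp (- (\<xi> * (x + t * levy_drift b \<nu> r))) * ?\<chi> \<xi>
        = of_real (exp (- (t * tail r))) * (iexp (- (\<xi> * x)) * (f \<xi> * exp (CLBINT y. iexp (\<xi> * y) * k y)))" for \<xi>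
    proof -
      have "- (t * levy_psi 0 b \<nu> \<xi>) = t * (- levy_psi 0 b \<nu> \<xi>)" by simp
      also have "\<dots> = \<i> * (\<xi> * (t * levy_drift b \<nu> r)) + t * small_part r \<xi> + t * large_part r \<xi> - t * tail r"
        unfolding levy_psi_decomposition[OF r(1)] by (simp add: algebra_simps)
      also have "t * large_part r \<xi> = (CLBINT y. iexp (\<xi> * y) * k y)"
        unfolding k_def by (rule large_part_lborel[OF r(1)])
      finally have "?\<chi> \<xi> = exp (\<i> * (\<xi> * (t * levy_drift b \<nu> r)) + t * small_part r \<xi> + (CLBINT y. iexp (\<xi> * y) * k y) - t * tail r)"
        by simp
      then have "iexp (- (\<xi> * (x + t * levy_drift b \<nu> r))) * ?\<chi> \<xi>
        = exp (- (\<i> * (\<xi> * (x + t * levy_drift b \<nu> r))) + (\<i> * (\<xi> * (t * levy_drift b \<nu> r)) + t * small_part r \<xi> + (CLBINT y. iexp (\<xi> * y) * k y) - t * tail r))"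
        by (simp only: exp_add[symmetric]) simp
      also have "\<dots> = exp (- (t * tail r) + (- (\<i> * (\<xi> * x)) + (t * small_part r \<xi> + (CLBINT y. iexp (\<xi> * y) * k y))))"
        by (intro arg_cong[of _ _ exp]) (simp add: algebra_simps)
      also have "\<dots> = of_real (exp (- (t * tail r))) * (iexp (- (\<xi> * x)) * (f \<xi> * exp (CLBINT y. iexp (\<xi> * y) * k y)))"
        unfolding exp_add f_def by (simp add: exp_of_real[symmetric])
      finally show ?thesis .
    qed
    have "fourier_int ?\<chi> (x + t * levy_drift b \<nu> r)
        = of_real (exp (- (t * tail r))) * fourier_int (\<lambda>\<xi>. f \<xi> * exp (CLBINT y. iexp (\<xi> * y) * k y)) x"
      unfolding fourier_int_def split by (rule integral_mult_right_zero)
    then have "norm (fourier_int ?\<chi> (x + t * levy_drift b \<nu> r))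
        = exp (- (t * tail r)) * norm (fourier_int (\<lambda>\<xi>. f \<xi> * exp (CLBINT y. iexp (\<xi> * y) * k y)) x)"
      by (simp add: norm_mult)
    also have "\<dots> \<le> 1 * norm (fourier_int (\<lambda>\<xi>. f \<xi> * exp (CLBINT y. iexp (\<xi> * y) * k y)) x)"
      using t tail_nonneg by (intro mult_right_mono) auto
    also have "\<dots> \<le> (D + E * I) * exp (1 + m + m * E) * (t * profile \<bar>x\<bar>)" using main by simp
    also have "\<dots> \<le> A * (t * profile \<bar>x\<bar>)"
      using A t profile_nonneg[of "\<bar>x\<bar>"] x by (intro mult_right_mono) auto
    finally show "norm (fourier_int ?\<chi> (x + t * levy_drift b \<nu> (1 / \<rho>))) \<le> A * (t * profile \<bar>x\<bar>)"
      by (simp add: r_def)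
  qed
qed

end

section \<open>Generalised inverses and the density bound\<close>

context monotone_levy
begin

lemma isCont_laplace2: assumes l: "0 < l" shows "isCont laplace2 l"
proof -
  have "isCont (\<lambda>z. laplace2 (max z (l / 2))) l"
    unfolding continuous_at_sequentially comp_def
  proof safe
    fix S :: "nat \<Rightarrow> real" assume S: "S \<longlonglongrightarrow> l"
    show "(\<lambda>m. laplace2 (max (S m) (l / 2))) \<longlonglongrightarrow> laplace2 (max l (l / 2))"
      unfolding laplace2_def
    proof (rule integral_dominated_convergence[where w = "\<lambda>y. y\<^sup>2 * exp (- (l / 2 * y))"])
      show "integrable \<nu> (\<lambda>y. y\<^sup>2 * exp (- (l / 2 * y)))" using integrable_laplace2[of "l / 2"] l by simp
      show "AE y in \<nu>. (\<lambda>m. y\<^sup>2 * exp (- (max (S m) (l / 2) * y))) \<longlonglongrightarrow> y\<^sup>2 * exp (- (max l (l / 2) * y))"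
        by (intro AE_I2 tendsto_intros S)
      show "AE y in \<nu>. norm (y\<^sup>2 * exp (- (max (S m) (l / 2) * y))) \<le> y\<^sup>2 * exp (- (l / 2 * y))" for m
        using AE_pos by eventually_elim (auto intro!: mult_left_mono mult_right_mono)
    qed measurable
  qed
  moreover have "\<forall>\<^sub>F z in nhds l. laplace2 (max z (l / 2)) = laplace2 z"
    using l by (auto simp: eventually_nhds intro!: exI[of _ "{l / 2<..}"])
  ultimately show ?thesis using isCont_cong by fast
qed

text \<open>
  Continuity at the origin comes from \<open>c_psi * \<Phi> \<le> re_psi\<close>, as \<open>re_psi\<close> is continuous and vanishes there.
\<close>

lemma continuous_on_\<Phi>:
  assumes cont: "continuous_on UNIV re_psi"
  shows "continuous_on {0..} \<Phi>"
  unfolding continuous_on_eq_continuous_within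
proof
  fix l :: real assume "l \<in> {0..}"
  then consider "l = 0" | "0 < l" by force
  then show "continuous (at l within {0..}) \<Phi>"
  proof cases
    case 1
    have "isCont re_psi 0" using cont by (simp add: continuous_on_eq_continuous_at)
    then have "(re_psi \<longlongrightarrow> 0) (at 0 within {0..})"
      using re_psi_zero by (auto simp: isCont_def intro: tendsto_within_subset)
    then have "((\<lambda>z. re_psi z / c_psi) \<longlongrightarrow> 0 / c_psi) (at 0 within {0..})" using c_psi by (intro tendsto_intros) auto
    then have lim: "((\<lambda>z. re_psi z / c_psi) \<longlongrightarrow> 0) (at 0 within {0..})" by simp
    have "(\<Phi> \<longlongrightarrow> 0) (at 0 within {0..})"
    proof (rule Lim_null_comparison[OF _ lim])
      show "\<forall>\<^sub>F z in at 0 within {0..}. norm (\<Phi> z) \<le> re_psi z / c_psi"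
        unfolding eventually_at
      proof (intro exI[of _ 1] conjI ballI impI)
        fix z :: real assume "z \<in> {0..}" "z \<noteq> 0 \<and> dist z 0 < 1"
        then have "0 < z" by auto
        then show "norm (\<Phi> z) \<le> re_psi z / c_psi"
          using re_psi_lower[of z] \<Phi>_pos[of z] c_psi by (simp add: le_divide_eq mult.commute)
      qed simp
    qed
    then show ?thesis using 1 by (simp add: continuous_within \<Phi>_def)
  next
    case 2
    have "isCont \<Phi> l"
      unfolding \<Phi>_def[abs_def] using isCont_laplace2[OF 2] by (intro continuous_intros) auto
    then show ?thesis by (rule continuous_at_imp_continuous_at_within)
  qed
qed

lemma bdd_above_re_psi: "bdd_above (re_psi ` {z. \<bar>z\<bar> \<le> r})"
proof (cases "0 < r")
  case True
  then show ?thesis using re_psi_upper[OF True] by (auto intro!: bdd_aboveI)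
next
  case False
  then have "{z::real. \<bar>z\<bar> \<le> r} \<subseteq> {0}" by auto
  then have "re_psi ` {z. \<bar>z\<bar> \<le> r} \<subseteq> {re_psi 0}" by auto
  then show ?thesis by (rule bdd_above_mono[rotated]) simp
qed

lemma psi_star_eq: "psi_star (levy_psi 0 b \<nu>) r = (SUP z\<in>{z. \<bar>z\<bar> \<le> r}. re_psi z)"
  by (simp add: psi_star_def Re_levy_psi)

lemma re_psi_le_psi_star: "\<bar>z\<bar> \<le> r \<Longrightarrow> re_psi z \<le> psi_star (levy_psi 0 b \<nu>) r"
  unfolding psi_star_eq by (rule cSUP_upper[OF _ bdd_above_re_psi]) simp

lemma psi_star_le: "0 \<le> r \<Longrightarrow> (\<And>z. \<bar>z\<bar> \<le> r \<Longrightarrow> re_psi z \<le> K) \<Longrightarrow> psi_star (levy_psi 0 b \<nu>) r \<le> K"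
  unfolding psi_star_eq by (rule cSUP_least) (auto intro: exI[of _ 0])

lemma Phi_star_eq: "Phi_star (levy_phi 0 b \<nu>) r = (SUP s\<in>{0<..r}. \<Phi> s)"
  unfolding Phi_star_def by (intro SUP_cong) (auto simp: Phi_levy_phi)

lemma \<Phi>_le_Phi_star: assumes "0 < l" "l \<le> r" shows "\<Phi> l \<le> Phi_star (levy_phi 0 b \<nu>) r"
  unfolding Phi_star_eq
proof (rule cSUP_upper)
  have "\<Phi> s \<le> (2 * tail (1 / r) + exp 1 / 2 * \<Phi> r) / c_psi" if "0 < s" "s \<le> r" for s
    using re_psi_lower[of s] re_psi_upper[of r s] that c_psi by (simp add: le_divide_eq mult.commute)
  then show "bdd_above (\<Phi> ` {0<..r})" by (auto intro!: bdd_aboveI)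
qed (use assms in auto)

lemma Phi_star_le: "0 < r \<Longrightarrow> (\<And>l. 0 < l \<Longrightarrow> l \<le> r \<Longrightarrow> \<Phi> l \<le> K) \<Longrightarrow> Phi_star (levy_phi 0 b \<nu>) r \<le> K"
  unfolding Phi_star_eq by (rule cSUP_least) auto

end

context scaled_levy
begin

text \<open>
  The level \<open>s\<close> is \<open>1/t\<close> and \<open>K\<close> is \<open>\<Phi>(x0)\<close>. The smallness of \<open>re_psi\<close> on \<open>[-\<delta>,\<delta>]\<close> forces every solution
  of \<open>\<psi>\<^sup>*(r) = s\<close>, and likewise the first point where \<open>\<Phi>\<close> reaches \<open>s\<close>, to lie above \<open>\<delta>\<close>, where \<open>\<psi>\<^sup>*\<close> and \<open>\<Phi>\<close> are
  comparable. The supremum of the solutions is within a factor two of one of them, which is enough by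
  the scaling of \<open>\<Phi>\<close> from both sides.
\<close>

lemma inverse_scale:
  assumes cont: "continuous_on UNIV re_psi" and K: "0 \<le> K" and low: "\<And>z. \<bar>z\<bar> \<le> \<delta> \<Longrightarrow> re_psi z \<le> c_psi * K"
  shows "\<exists>klo>0. \<exists>khi>0. \<exists>kc>0. \<forall>b s. K < s \<longrightarrow>
    0 < psi_inv (levy_psi 0 b \<nu>) s \<and> \<delta> \<le> psi_inv (levy_psi 0 b \<nu>) s \<and>
    klo * s \<le> \<Phi> (psi_inv (levy_psi 0 b \<nu>) s) \<and> \<Phi> (psi_inv (levy_psi 0 b \<nu>) s) \<le> khi * s \<and>
    psi_inv (levy_psi 0 b \<nu>) s \<le> kc * Phi_inv (levy_phi 0 b \<nu>) s"
proof -
  obtain C where C: "0 < C" "\<And>\<rho> z. 0 < \<rho> \<Longrightarrow> \<delta> \<le> \<rho> \<Longrightarrow> \<bar>z\<bar> \<le> \<rho> \<Longrightarrow> re_psi z \<le> C * \<Phi> \<rho>"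
    using re_psi_le_\<Phi> by blast
  define klo where "klo = c' / C"
  define khi where "khi = 4 / c_psi"
  define kc where "kc = max 1 ((khi / c') powr (1 / \<alpha>))"
  have pos: "0 < klo" "0 < khi" "0 < kc" using C(1) c' c_psi by (auto simp: klo_def khi_def kc_def less_max_iff_disj)
  have main: "0 < psi_inv (levy_psi 0 b \<nu>) s \<and> \<delta> \<le> psi_inv (levy_psi 0 b \<nu>) s \<and>
    klo * s \<le> \<Phi> (psi_inv (levy_psi 0 b \<nu>) s) \<and> \<Phi> (psi_inv (levy_psi 0 b \<nu>) s) \<le> khi * s \<and>
    psi_inv (levy_psi 0 b \<nu>) s \<le> kc * Phi_inv (levy_phi 0 b \<nu>) s" if sK: "K < s" for b s
  proof -
    let ?\<psi> = "levy_psi 0 b \<nu>" and ?\<phi> = "levy_phi 0 b \<nu>"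
    have s: "0 < s" using K sK by simp
    have c_psiK: "c_psi * K \<le> K" using c_psi K by (simp add: mult_left_le_one_le)
    obtain L where L: "0 < L" "\<And>l. L \<le> l \<Longrightarrow> s / c_psi < \<Phi> l" using \<Phi>_at_top by blast
    have sc: "s \<le> s / c_psi" using s c_psi by (simp add: le_divide_eq mult_left_le)
    have gL: "s < c_psi * \<Phi> l" if "L \<le> l" for l
      using L(2)[OF that] c_psi by (simp add: divide_less_eq mult.commute)
    define S where "S = {r. 0 < r \<and> psi_star ?\<psi> r = s}"
    obtain r1 where r1: "0 < r1" "re_psi r1 = s" "\<And>x. 0 \<le> x \<Longrightarrow> x \<le> r1 \<Longrightarrow> re_psi x \<le> s"
    proof (rule first_hitting[of re_psi s L])
      show "continuous_on {0..} re_psi" using cont by (rule continuous_on_subset) auto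
      show "s \<le> re_psi L" using gL[of L] re_psi_lower[of L] L(1) by simp
    qed (use s L re_psi_zero in auto)
    have "psi_star ?\<psi> r1 = s"
    proof (rule antisym)
      show "psi_star ?\<psi> r1 \<le> s"
        using r1(1,3) re_psi_abs by (intro psi_star_le) (auto, metis abs_ge_zero)
      show "s \<le> psi_star ?\<psi> r1" using re_psi_le_psi_star[of r1 r1 b] r1 by simp
    qed
    then have r1S: "r1 \<in> S" using r1 by (simp add: S_def)
    have S: "\<delta> \<le> r" "c_psi * \<Phi> r \<le> s" "s \<le> C * \<Phi> r" "r \<le> L" "0 < r" if "r \<in> S" for r
    proof -
      have r: "0 < r" "psi_star ?\<psi> r = s" using that by (auto simp: S_def)
      show r\<delta>: "\<delta> \<le> r"
      proof (rule ccontr)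
        assume "\<not> \<delta> \<le> r"
        then have "psi_star ?\<psi> r \<le> c_psi * K" using r by (intro psi_star_le low) auto
        then show False using r sK c_psiK by simp
      qed
      show u: "c_psi * \<Phi> r \<le> s" using re_psi_lower[of r] re_psi_le_psi_star[of r r b] r by simp
      show "s \<le> C * \<Phi> r" unfolding r(2)[symmetric] using r r\<delta> by (intro psi_star_le C(2)) auto
      show "r \<le> L" using gL[of r] u by (cases "r \<le> L") auto
      show "0 < r" by (rule r)
    qed
    have bdd: "bdd_above S" using S(4) by (auto intro!: bdd_aboveI)
    define \<rho> where "\<rho> = psi_inv ?\<psi> s"
    have \<rho>: "\<rho> = Sup S" by (simp add: \<rho>_def psi_inv_def S_def)
    have upper: "r \<le> \<rho>" if "r \<in> S" for r unfolding \<rho> using that bdd by (rule cSup_upper)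
    have \<rho>0: "0 < \<rho>" "\<delta> \<le> \<rho>" using upper[OF r1S] r1 S(1)[OF r1S] by auto
    have "\<rho> / 2 < Sup S" using \<rho>0 \<rho> by simp
    then obtain r where r: "r \<in> S" "\<rho> / 2 < r" using less_cSupD[of S] r1S by blast
    have r\<rho>: "r \<le> \<rho>" using upper r by simp
    note Sr = S[OF r(1)]
    have lo: "klo * s \<le> \<Phi> \<rho>"
    proof -
      have "klo * s \<le> klo * (C * \<Phi> r)" using Sr(3) pos by (intro mult_left_mono) auto
      also have "\<dots> = c' * \<Phi> r" using C(1) by (simp add: klo_def)
      also have "\<dots> \<le> \<Phi> \<rho>" by (rule \<Phi>_almost_increasing[OF Sr(5) Sr(1) r\<rho>])
      finally show ?thesis .
    qed
    have hi: "\<Phi> \<rho> \<le> khi * s"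
    proof -
      have "\<Phi> \<rho> = \<Phi> (\<rho> / r * r)" using Sr(5) by simp
      also have "\<dots> \<le> (\<rho> / r)\<^sup>2 * \<Phi> r" using Sr(5) r\<rho> by (intro \<Phi>_upper_scaling) auto
      also have "\<dots> \<le> 2\<^sup>2 * (s / c_psi)"
        using Sr r \<rho>0 c_psi \<Phi>_pos[OF Sr(5)] by (intro mult_mono power_mono) (auto simp: field_simps)
      finally show ?thesis by (simp add: khi_def)
    qed
    \<comment> \<open>a single solution of \<open>\<Phi>\<^sup>*(r) = s\<close> bounds the generalised inverse from below\<close>
    obtain r2 where r2: "0 < r2" "\<Phi> r2 = s" "\<And>x. 0 \<le> x \<Longrightarrow> x \<le> r2 \<Longrightarrow> \<Phi> x \<le> s"
    proof (rule first_hitting[of \<Phi> s L])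
      show "continuous_on {0..} \<Phi>" by (rule continuous_on_\<Phi>[OF cont])
      show "s \<le> \<Phi> L" using L(2)[of L] sc by simp
    qed (use s L in \<open>auto simp: \<Phi>_def\<close>)
    have "Phi_star ?\<phi> r2 = s"
    proof (rule antisym)
      show "Phi_star ?\<phi> r2 \<le> s" using r2 by (intro Phi_star_le) auto
      show "s \<le> Phi_star ?\<phi> r2" using \<Phi>_le_Phi_star[of r2 r2 b] r2 by simp
    qed
    moreover have "r \<le> L" if "0 < r" "Phi_star ?\<phi> r = s" for r
    proof (rule ccontr)
      assume "\<not> r \<le> L"
      then have "s / c_psi < \<Phi> r" using L(2)[of r] by simp
      then show False using \<Phi>_le_Phi_star[of r r b] that sc by simp
    qed
    ultimately have inv: "r2 \<le> Phi_inv ?\<phi> s"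
      unfolding Phi_inv_def using r2 by (intro cSup_upper bdd_aboveI[of _ L]) auto
    have r2\<delta>: "\<delta> \<le> r2"
    proof (rule ccontr)
      assume "\<not> \<delta> \<le> r2"
      then have "c_psi * \<Phi> r2 \<le> c_psi * K" using re_psi_lower[of r2] low[of r2] r2(1) by simp
      then show False using r2(2) sK c_psi by simp
    qed
    have "\<rho> \<le> kc * r2"
    proof (cases "\<rho> \<le> r2")
      case True
      moreover have "1 * r2 \<le> kc * r2" using r2(1) by (intro mult_right_mono) (auto simp: kc_def)
      ultimately show ?thesis by linarith
    next
      case False
      define u where "u = \<rho> / r2"
      have u: "1 \<le> u" "\<rho> = u * r2" using False r2(1) by (auto simp: u_def)
      have "c' * u powr \<alpha> * s \<le> khi * s"
        using lower_scaling[OF r2(1) r2\<delta> u(1)] r2(2) u(2) hi by simp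
      then have "u powr \<alpha> \<le> khi / c'" using s c' by (simp add: le_divide_eq mult.commute)
      then have "(u powr \<alpha>) powr (1 / \<alpha>) \<le> (khi / c') powr (1 / \<alpha>)" using \<alpha> by (intro powr_mono2) auto
      then have "u \<le> kc" using \<alpha> u by (simp add: powr_powr kc_def)
      then show ?thesis unfolding u(2) using r2(1) by (intro mult_right_mono) auto
    qed
    also have "\<dots> \<le> kc * Phi_inv ?\<phi> s" using inv pos by (intro mult_left_mono) auto
    finally show ?thesis using \<rho>0 lo hi unfolding \<rho>_def by blast
  qed
  show ?thesis using pos main by blast
qed

lemma char_integrable:
  assumes t: "0 < t" and m: "h \<in> borel_measurable borel" and h: "\<And>\<xi>. norm (h \<xi>) = exp (- (t * re_psi \<xi>))"
  shows "integrable lborel (h :: real \<Rightarrow> complex)"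
proof -
  define \<rho> where "\<rho> = \<delta> + 1"
  have \<rho>: "0 < \<rho>" "\<delta> \<le> \<rho>" using \<delta> by (auto simp: \<rho>_def)
  have "0 < t * \<Phi> \<rho>" using t \<Phi>_pos \<rho> by simp
  from exp_re_psi_bound[OF this] obtain B where
    B: "\<And>\<xi>. (1 + \<bar>\<xi> / \<rho>\<bar> ^ 3) * exp (- (t * re_psi \<xi>)) \<le> B / (1 + (\<xi> / \<rho>)\<^sup>2)"
    using t \<rho> by blast
  have dom: "norm (h \<xi>) \<le> B / (1 + (\<xi> * (1 / \<rho>))\<^sup>2)" for \<xi>
  proof -
    have "1 * exp (- (t * re_psi \<xi>)) \<le> (1 + \<bar>\<xi> / \<rho>\<bar> ^ 3) * exp (- (t * re_psi \<xi>))"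
      by (intro mult_right_mono) (use \<rho> in auto)
    also note B[of \<xi>]
    finally show ?thesis unfolding h by simp
  qed
  show ?thesis by (rule cauchy_dominated_integrable(1)[OF _ m dom]) (use \<rho> in simp)
qed

end

text \<open>
  This links the profile to \<open>\<eta>\<close>: for \<open>y < 1/x0\<close> through \<open>\<Phi> \<le> \<Phi>\<^sup>*\<close>, and for \<open>y \<ge> 1/x0\<close> through \<open>\<Phi> \<le> 2 |\<phi>|\<close>,
  where the normalising constant of \<open>\<eta>\<close> is a fixed positive number.
\<close>

lemma (in monotone_levy) eta_bound:
  assumes x0: "0 \<le> x0"
    and th: "0 < theta1 (levy_phi 0 b \<nu>) \<Longrightarrow> 0 < x0 \<Longrightarrow> x0 \<le> theta1 (levy_phi 0 b \<nu>)"
  shows "\<exists>C>0. \<forall>y>0. ennreal (profile y) \<le> ennreal C * eta (levy_phi 0 b \<nu>) x0 y"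
proof -
  let ?\<phi> = "levy_phi 0 b \<nu>"
  define A where "A = Phi_star ?\<phi> x0 / \<bar>?\<phi> x0\<bar>"
  define C where "C = exp 1 * (1 + 2 / \<bar>A\<bar>)"
  have C: "0 < C" "exp 1 \<le> C" by (auto simp: C_def add_pos_nonneg)
  have "ennreal (profile y) \<le> ennreal C * eta ?\<phi> x0 y" if y: "0 < y" for y
  proof (cases "ennreal y < 1 / ennreal x0")
    case True
    have "profile y \<le> exp 1 * (\<Phi> (1 / y) / y)" by (rule profile_le_\<Phi>[OF y])
    also have "\<dots> \<le> C * (Phi_star ?\<phi> (1 / y) / y)"
      using C \<Phi>_le_Phi_star[of "1 / y" "1 / y" b] y \<Phi>_pos[of "1 / y"]
      by (intro mult_mono divide_right_mono) auto
    finally have "ennreal (profile y) \<le> ennreal (C * (Phi_star ?\<phi> (1 / y) / y))" by (rule ennreal_leI)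
    also have "\<dots> = ennreal C * ennreal (Phi_star ?\<phi> (1 / y) / y)" using C by (intro ennreal_mult') simp
    also have "\<dots> = ennreal C * eta ?\<phi> x0 y" using True y by (simp add: eta_def)
    finally show ?thesis .
  next
    case False
    have x0p: "0 < x0"
    proof (rule ccontr)
      assume "\<not> 0 < x0"
      then have "x0 = 0" using x0 by simp
      then show False using False by (simp add: ennreal_divide_zero less_top[symmetric])
    qed
    then have "1 / ennreal x0 = ennreal (1 / x0)" by (simp add: divide_ennreal flip: ennreal_1)
    then have "1 / x0 \<le> y" using False y by (simp add: not_less)
    then have yx: "1 / y \<le> x0" using x0p y by (simp add: field_simps)
    have "\<Phi> x0 \<le> 2 * \<bar>?\<phi> x0\<bar>" using \<Phi>_le_levy_phi[OF x0p order_refl] th x0p by blast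
    then have "0 < \<bar>?\<phi> x0\<bar>" using \<Phi>_pos[OF x0p] by linarith
    then have A: "0 < A" unfolding A_def
      using \<Phi>_le_Phi_star[of x0 x0 b] \<Phi>_pos[OF x0p] x0p by (intro divide_pos_pos) auto
    have "profile y \<le> exp 1 * (\<Phi> (1 / y) / y)" by (rule profile_le_\<Phi>[OF y])
    also have "\<dots> \<le> exp 1 * (2 * \<bar>?\<phi> (1 / y)\<bar> / y)"
      using \<Phi>_le_levy_phi[OF _ yx, of b] th x0p y by (intro mult_left_mono divide_right_mono) auto
    also have "\<dots> = (exp 1 * (2 / A)) * (A * (\<bar>?\<phi> (1 / y)\<bar> / y))" using A by simp
    also have "\<dots> \<le> C * (A * (\<bar>?\<phi> (1 / y)\<bar> / y))"
      using A y by (intro mult_right_mono) (auto simp: C_def distrib_left)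
    finally have "ennreal (profile y) \<le> ennreal (C * (A * (\<bar>?\<phi> (1 / y)\<bar> / y)))" by (rule ennreal_leI)
    also have "\<dots> = ennreal C * ennreal (A * (\<bar>?\<phi> (1 / y)\<bar> / y))" using C by (intro ennreal_mult') simp
    also have "\<dots> = ennreal C * eta ?\<phi> x0 y" using False y by (simp add: eta_def A_def)
    finally show ?thesis .
  qed
  then show ?thesis using C by blast
qed

theorem theorem4p8:
  fixes M :: "'a measure" and X :: "real \<Rightarrow> 'a \<Rightarrow> real"
    and \<sigma> b \<alpha> c x0 :: real and \<nu> :: "real measure"
  assumes "spectrally_positive_levy_process M X"
    and "has_levy_triplet M X \<sigma> b \<nu>"
    and "unbounded_variation \<sigma> \<nu>"
    and "\<sigma> = 0"
    and "0 < c" "c \<le> 1" "0 \<le> x0" "0 < \<alpha>"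
    and "deriv (deriv (levy_phi \<sigma> b \<nu>)) \<in> WLSC (\<alpha> - 2) c x0"
    and "theta1 (levy_phi \<sigma> b \<nu>) > 0 \<Longrightarrow> x0 > 0 \<Longrightarrow> x0 \<le> theta1 (levy_phi \<sigma> b \<nu>)"
    and "has_almost_monotone_density \<nu>"
  shows "\<exists>p :: real \<Rightarrow> real \<Rightarrow> real.
     (\<forall>t>0. distributed M lborel (X t) (\<lambda>x. ennreal (p t x)) \<and>
            (\<forall>x. 0 \<le> p t x) \<and> continuous_on UNIV (p t)) \<and>
     (\<exists>C>0. \<forall>t x. 0 < t \<longrightarrow> ennreal t < 1 / ennreal (Phi (levy_phi \<sigma> b \<nu>) x0) \<longrightarrow>
        ennreal (p t (x + t * levy_drift b \<nu> (1 / psi_inv (levy_psi \<sigma> b \<nu>) (1 / t))))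
          \<le> ennreal C * min (ennreal (Phi_inv (levy_phi \<sigma> b \<nu>) (1 / t)))
                            (ennreal t * eta (levy_phi \<sigma> b \<nu>) x0 \<bar>x\<bar>))"
proof -
  note \<sigma> = \<open>\<sigma> = 0\<close>
  obtain n C0 where n: "n \<in> borel_measurable borel" "\<And>x. 0 \<le> n x"
    "\<nu> = density lborel (\<lambda>x. ennreal (n x) * indicator {0<..} x)" "1 \<le> C0"
    "\<And>x y. 0 < x \<Longrightarrow> x \<le> y \<Longrightarrow> n y \<le> C0 * n x"
    using assms(11) unfolding has_almost_monotone_density_def by blast
  have plm: "positive_levy_measure \<nu>"
    and chr: "\<And>t \<xi>. 0 \<le> t \<Longrightarrow> char (distr M borel (X t)) \<xi> = exp (- (of_real t * levy_psi 0 b \<nu> \<xi>))"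
    using assms(2) \<sigma> unfolding has_levy_triplet_def by auto
  interpret monotone_levy \<nu> n C0
  proof
    show "(\<integral>\<^sup>+x\<in>{0<..}. ennreal (min 1 (x\<^sup>2)) \<partial>\<nu>) < \<infinity>"
      using plm by (simp add: positive_levy_measure_def)
    show "emeasure \<nu> UNIV \<noteq> 0"
    proof
      assume "emeasure \<nu> UNIV = 0"
      then have "AE x in \<nu>. False" using n(3) by (subst AE_iff_measurable[of UNIV]) auto
      then have "(\<integral>\<^sup>+x\<in>{0<..<1}. ennreal x \<partial>\<nu>) = (\<integral>\<^sup>+x. 0 \<partial>\<nu>)" by (intro nn_integral_cong_AE) auto
      then show False using assms(3) \<sigma> by (simp add: unbounded_variation_def)
    qed
  qed (use n in auto)
  have "levy_process M X" using assms(1) by (simp add: spectrally_positive_levy_process_def)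
  then interpret M: prob_space M by (simp add: levy_process_def)
  have X [measurable]: "X t \<in> borel_measurable M" if "0 \<le> t" for t
    using \<open>levy_process M X\<close> that by (simp add: levy_process_def)
  have rd: "real_distribution (distr M borel (X t))" if "0 \<le> t" for t
    using M.real_distribution_distr X[OF that] by blast
  have nchr: "norm (char (distr M borel (X t)) \<xi>) = exp (- (t * re_psi \<xi>))" if "0 \<le> t" for t \<xi>
    by (simp add: chr[OF that] norm_exp_eq_Re Re_levy_psi)
  have re_psi_cont: "continuous_on UNIV re_psi"
  proof -
    interpret D: real_distribution "distr M borel (X 1)" by (rule rd) simp
    have "continuous_on UNIV (\<lambda>\<xi>. - ln (norm (char (distr M borel (X 1)) \<xi>)))"
      using D.isCont_char nchr[of 1] by (intro continuous_intros continuous_at_imp_continuous_on) auto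
    then show ?thesis using nchr[of 1] by simp
  qed
  have laplace2_scaling: "c * u powr (\<alpha> - 2) * laplace2 l \<le> laplace2 (u * l)" if "1 \<le> u" "x0 < l" for u l
  proof -
    have "c * u powr (\<alpha> - 2) * deriv (deriv (levy_phi 0 b \<nu>)) l \<le> deriv (deriv (levy_phi 0 b \<nu>)) (u * l)"
      using assms(9) that \<sigma> unfolding WLSC_def by blast
    then show ?thesis using that \<open>0 \<le> x0\<close> by (simp add: deriv2_levy_phi)
  qed
  define K where "K = \<Phi> x0"
  have K: "0 \<le> K" "Phi (levy_phi 0 b \<nu>) x0 = K"
    using \<Phi>_pos[of x0] \<open>0 \<le> x0\<close> by (cases "x0 = 0", auto simp: K_def \<Phi>_def Phi_levy_phi)
  obtain \<delta> where \<delta>_bounds: "0 \<le> \<delta>" "0 < \<delta> \<or> (\<delta> = 0 \<and> x0 = 0)" "\<And>z. \<bar>z\<bar> \<le> \<delta> \<Longrightarrow> re_psi z \<le> c_psi * K"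
  proof (cases "x0 = 0")
    case True
    then show thesis using that[of 0] re_psi_zero K c_psi by simp
  next
    case False
    then have e: "0 < c_psi * K" using c_psi \<Phi>_pos[of x0] \<open>0 \<le> x0\<close> by (simp add: K_def)
    have "isCont re_psi 0" using re_psi_cont by (simp add: continuous_on_eq_continuous_at)
    then obtain d where d: "0 < d" "\<And>z. \<bar>z\<bar> < d \<Longrightarrow> \<bar>re_psi z\<bar> < c_psi * K"
      using e re_psi_zero unfolding continuous_at_eps_delta dist_real_def by (metis diff_zero)
    have "re_psi z \<le> c_psi * K" if "\<bar>z\<bar> \<le> d / 2" for z using d(2)[of z] that d(1) by auto
    then show thesis using that[of "d / 2"] d(1) by simp
  qed
  obtain c' where c': "0 < c'" "\<And>l u. 0 < l \<Longrightarrow> \<delta> \<le> l \<Longrightarrow> 1 \<le> u \<Longrightarrow> c' * u powr \<alpha> * \<Phi> l \<le> \<Phi> (u * l)"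
    using scaling_extends_below[OF \<open>0 < c\<close> \<open>0 < \<alpha>\<close> \<open>0 \<le> x0\<close> laplace2_scaling \<delta>_bounds(2)] by blast
  \<comment> \<open>from here on every estimate takes place above the scale \<open>\<delta>\<close>\<close>
  interpret scaled_levy \<nu> n C0 \<alpha> c' \<delta>
    by unfold_locales (use \<open>0 < \<alpha>\<close> c' \<delta>_bounds in auto)
  define p where "p t x = Re (fourier_int (char (distr M borel (X t))) x) / (2 * pi)" for t x
  have dens: "distributed M lborel (X t) (\<lambda>x. ennreal (p t x)) \<and> (\<forall>x. 0 \<le> p t x) \<and> continuous_on UNIV (p t)"
    if t: "0 < t" for t
  proof -
    interpret D: real_distribution "distr M borel (X t)" by (rule rd) (use t in simp)
    have "integrable lborel (char (distr M borel (X t)))"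
      using t nchr[of t] by (intro char_integrable[OF t]) auto
    from D.fourier_inversion_density[OF this]
    have c: "continuous_on UNIV (p t)" "\<And>x. 0 \<le> p t x" "distr M borel (X t) = density lborel (\<lambda>x. ennreal (p t x))"
      by (simp_all add: p_def[abs_def])
    have "distr M lborel (X t) = distr M borel (X t)" by (rule distr_cong) auto
    then show ?thesis
      using c X[of t] t borel_measurable_continuous_onI[OF c(1)] by (simp add: distributed_def)
  qed
  obtain klo khi kc where ks: "0 < klo" "0 < khi" "0 < kc"
    and inv: "\<And>s. K < s \<Longrightarrow> 0 < psi_inv (levy_psi 0 b \<nu>) s \<and> \<delta> \<le> psi_inv (levy_psi 0 b \<nu>) s \<and>
    klo * s \<le> \<Phi> (psi_inv (levy_psi 0 b \<nu>) s) \<and> \<Phi> (psi_inv (levy_psi 0 b \<nu>) s) \<le> khi * s \<and>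
    psi_inv (levy_psi 0 b \<nu>) s \<le> kc * Phi_inv (levy_phi 0 b \<nu>) s"
    using inverse_scale[OF re_psi_cont K(1) \<delta>_bounds(3)] by blast
  obtain A where A: "0 < A" and est: "\<And>t \<rho>. 0 < t \<Longrightarrow> 0 < \<rho> \<Longrightarrow> \<delta> \<le> \<rho> \<Longrightarrow> klo \<le> t * \<Phi> \<rho> \<Longrightarrow> t * \<Phi> \<rho> \<le> khi \<Longrightarrow>
    (\<forall>x. norm (fourier_int (\<lambda>\<xi>. exp (- (t * levy_psi 0 b \<nu> \<xi>))) x) \<le> A * \<rho>) \<and>
    (\<forall>x. x \<noteq> 0 \<longrightarrow> norm (fourier_int (\<lambda>\<xi>. exp (- (t * levy_psi 0 b \<nu> \<xi>))) (x + t * levy_drift b \<nu> (1 / \<rho>))) \<le> A * (t * profile \<bar>x\<bar>))"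
    using kernel_estimate[OF ks(1,2)] by blast
  obtain Ce where Ce: "0 < Ce" "\<And>y. 0 < y \<Longrightarrow> ennreal (profile y) \<le> ennreal Ce * eta (levy_phi 0 b \<nu>) x0 y"
    using eta_bound[OF \<open>0 \<le> x0\<close>, of b] assms(10) \<sigma> by blast
  define C where "C = A * kc + A * Ce"
  have C: "0 < C" "A * kc \<le> C" "A * Ce \<le> C" using A ks Ce(1) by (auto simp: C_def add_pos_pos)
  have bound: "ennreal (p t (x + t * levy_drift b \<nu> (1 / psi_inv (levy_psi 0 b \<nu>) (1 / t))))
          \<le> ennreal C * min (ennreal (Phi_inv (levy_phi 0 b \<nu>) (1 / t))) (ennreal t * eta (levy_phi 0 b \<nu>) x0 \<bar>x\<bar>)"
    if t: "0 < t" and tK: "ennreal t < 1 / ennreal K" for t x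
  proof -
    have "K < 1 / t"
    proof (cases "K = 0")
      case False
      then have "0 < K" using K by simp
      then have "1 / ennreal K = ennreal (1 / K)" by (simp add: divide_ennreal flip: ennreal_1)
      then have "t < 1 / K" using tK t by (simp add: ennreal_less_iff)
      then show ?thesis using t \<open>0 < K\<close> by (simp add: field_simps)
    qed (use t in simp)
    note i = inv[OF this]
    define \<rho> where "\<rho> = psi_inv (levy_psi 0 b \<nu>) (1 / t)"
    have \<rho>: "0 < \<rho>" "\<delta> \<le> \<rho>" "klo \<le> t * \<Phi> \<rho>" "t * \<Phi> \<rho> \<le> khi" "\<rho> \<le> kc * Phi_inv (levy_phi 0 b \<nu>) (1 / t)"
      using i t by (auto simp: \<rho>_def field_simps)
    let ?z = "x + t * levy_drift b \<nu> (1 / \<rho>)"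
    have char_eq: "char (distr M borel (X t)) = (\<lambda>\<xi>. exp (- (t * levy_psi 0 b \<nu> \<xi>)))"
      using chr[of t] t by auto
    have p_le: "p t z \<le> norm (fourier_int (\<lambda>\<xi>. exp (- (t * levy_psi 0 b \<nu> \<xi>))) z)" for z
    proof -
      let ?w = "fourier_int (\<lambda>\<xi>. exp (- (t * levy_psi 0 b \<nu> \<xi>))) z"
      have "Re ?w / (2 * pi) \<le> norm ?w / (2 * pi)" by (intro divide_right_mono complex_Re_le_cmod) auto
      also have "\<dots> \<le> norm ?w / 1" using pi_gt3 by (intro divide_left_mono) auto
      finally show ?thesis by (simp add: p_def char_eq)
    qed
    note e = est[OF t \<rho>(1,2,3,4)]
    have on: "ennreal (p t ?z) \<le> ennreal C * ennreal (Phi_inv (levy_phi 0 b \<nu>) (1 / t))"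
    proof -
      have Pi: "0 \<le> Phi_inv (levy_phi 0 b \<nu>) (1 / t)" using \<rho>(1,5) ks(3)
        by (smt (verit) mult_nonneg_nonpos)
      have "p t ?z \<le> A * \<rho>" using p_le[of ?z] e by (meson order_trans)
      also have "\<dots> \<le> A * (kc * Phi_inv (levy_phi 0 b \<nu>) (1 / t))" using \<rho>(5) A by (intro mult_left_mono) auto
      also have "\<dots> = A * kc * Phi_inv (levy_phi 0 b \<nu>) (1 / t)" by simp
      also have "\<dots> \<le> C * Phi_inv (levy_phi 0 b \<nu>) (1 / t)" using C Pi by (intro mult_right_mono) auto
      finally show ?thesis using C Pi by (simp add: ennreal_mult[symmetric] ennreal_leI)
    qed
    have off: "ennreal (p t ?z) \<le> ennreal C * (ennreal t * eta (levy_phi 0 b \<nu>) x0 \<bar>x\<bar>)"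
    proof (cases "x = 0")
      case True
      then show ?thesis using C t by (simp add: eta_def ennreal_mult_top)
    next
      case False
      then have x: "0 < \<bar>x\<bar>" by simp
      have "p t ?z \<le> A * (t * profile \<bar>x\<bar>)" using p_le[of ?z] e False by (meson order_trans)
      then have "ennreal (p t ?z) \<le> ennreal (A * (t * profile \<bar>x\<bar>))" by (rule ennreal_leI)
      also have "\<dots> = ennreal A * (ennreal t * ennreal (profile \<bar>x\<bar>))"
        using A t profile_nonneg[OF x] by (simp add: ennreal_mult)
      also have "\<dots> \<le> ennreal A * (ennreal t * (ennreal Ce * eta (levy_phi 0 b \<nu>) x0 \<bar>x\<bar>))"
        by (intro mult_left_mono Ce(2)[OF x]) auto
      also have "\<dots> = ennreal (A * Ce) * (ennreal t * eta (levy_phi 0 b \<nu>) x0 \<bar>x\<bar>)"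
        using A Ce(1) by (simp add: ennreal_mult mult_ac)
      also have "\<dots> \<le> ennreal C * (ennreal t * eta (levy_phi 0 b \<nu>) x0 \<bar>x\<bar>)"
        using C by (intro mult_right_mono ennreal_leI) auto
      finally show ?thesis .
    qed
    show ?thesis using on off unfolding \<rho>_def min_def by (auto split: if_splits)
  qed
  have "\<forall>t>0. distributed M lborel (X t) (\<lambda>x. ennreal (p t x)) \<and> (\<forall>x. 0 \<le> p t x) \<and> continuous_on UNIV (p t)"
    using dens by blast
  moreover have "\<exists>C>0. \<forall>t x. 0 < t \<longrightarrow> ennreal t < 1 / ennreal (Phi (levy_phi 0 b \<nu>) x0) \<longrightarrow>
        ennreal (p t (x + t * levy_drift b \<nu> (1 / psi_inv (levy_psi 0 b \<nu>) (1 / t))))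
          \<le> ennreal C * min (ennreal (Phi_inv (levy_phi 0 b \<nu>) (1 / t)))
                            (ennreal t * eta (levy_phi 0 b \<nu>) x0 \<bar>x\<bar>)"
    unfolding K(2) by (intro exI[of _ C] conjI allI impI C(1) bound)
  ultimately show ?thesis unfolding \<sigma> by (intro exI[of _ p] conjI)
qed

end
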